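(* Let $\Gamma$ be a connected (combinatorial) graph with first Betti number $b\ge 1$. Then $$\frac{2^b}{b!}\left(\frac{b}{\mathrm{Vol}(\Gamma)}\right)^b\le \mu(\mathcal{B}_{st}(\Gamma))\le \frac{2^b}{b!}.$$ The two cases of equality are attained by the bouquet of $b$ circles $\bigvee_{i=1}^b S^1_i$ (the graph with one vertex and $b$ loops).
   Context: A graph is a finite non-oriented multigraph $\Gamma=(V,E)$ (multiple edges and loops allowed). A combinatorial graph is regarded as a weighted graph in which all edges have weight (length) $1$; thus $\mathrm{Vol}(\Gamma)=|E|$. After choosing an orientation of each edge, the space of real $1$-chains is $C(\Gamma,\mathbb{R})=\bigoplus_{e\in E}\mathbb{R}e$, the real homology $H_1(\Gamma,\mathbb{R})$ is identified with the subspace of cycles (of dimension $b$), and $H_1(\Gamma,\mathbb{Z})$ with a lattice in $H_1(\Gamma,\mathbb{R})$. The scalar product on $C(\Gamma,\mathbb{R})$ is the one for which the edges form an orthonormal basis, and $\mu$ is the Haar (Lebesgue) measure on $H_1(\Gamma,\mathbb{R})$ induced by the restriction of this scalar product. Stable norm: fix $x_0\in V$; for $\alpha\in\pi_1(\Gamma,x_0)$ let $|\alpha|$ be the minimal length of a cycle based at $x_0$ representing $\alpha$, and for $h\in H_1(\Gamma,\mathbb{Z})$ let $|h|$ be the minimum of $|\alpha|$ over the $\alpha\in\pi_1(\Gamma,x_0)$ with homology class $h$. For $u\in H_1(\Gamma,\mathbb{R})$, $$|u|_{st}=\lim_{n\to+\infty}\frac1n|\overline{nu}|,$$ where $\overline{nu}$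 is a point of $H_1(\Gamma,\mathbb{Z})$ closest to $nu$ for an arbitrary fixed Euclidean metric; the limit exists and is independent of $x_0$. The unit ball is $\mathcal{B}_{st}(\Gamma)=\{u\in H_1(\Gamma,\mathbb{R})\mid |u|_{st}\le 1\}$. *)

theory Defs
  imports "HOL-Analysis.Analysis" "Graph_Theory.Digraph_Component"
begin

text \<open>
  A finite non-oriented multigraph is given by a \<^locale>\<open>fin_digraph\<close>, which allows loops and
  multiple edges: the arcs are the edges, each with the orientation that has been chosen to write
  down chains. Paths traverse edges in both directions. The edges are elements of a finite type
  \<open>'e\<close>, so that chains live in the Euclidean space \<open>real ^ 'e\<close>, where the
  vectors \<open>axis e 1\<close> form an orthonormal basis.
\<close>

definition volume :: "('v, 'e) pre_digraph \<Rightarrow> real" where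
  "volume G = real (card (arcs G))"

definition bouquet :: "'v \<Rightarrow> 'e set \<Rightarrow> ('v, 'e) pre_digraph" where
  "bouquet w A = \<lparr>verts = {w}, arcs = A, tail = (\<lambda>_. w), head = (\<lambda>_. w)\<rparr>"


subsection \<open>Homology\<close>

definition chains :: "('v, 'e::finite) pre_digraph \<Rightarrow> (real ^ 'e) set" where
  "chains G = {c. \<forall>e. e \<notin> arcs G \<longrightarrow> c $ e = 0}"

definition boundary :: "('v, 'e::finite) pre_digraph \<Rightarrow> real ^ 'e \<Rightarrow> 'v \<Rightarrow> real" where
  "boundary G c v =
     (\<Sum>e \<in> {e \<in> arcs G. head G e = v}. c $ e) - (\<Sum>e \<in> {e \<in> arcs G. tail G e = v}. c $ e)"

text \<open>There are no 2-chains, so homology consists of the cycles themselves.\<close>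

definition H1_real :: "('v, 'e::finite) pre_digraph \<Rightarrow> (real ^ 'e) set" where
  "H1_real G = {c \<in> chains G. \<forall>v \<in> verts G. boundary G c v = 0}"

definition H1_int :: "('v, 'e::finite) pre_digraph \<Rightarrow> (real ^ 'e) set" where
  "H1_int G = {c \<in> H1_real G. \<forall>e. c $ e \<in> \<int>}"

definition betti :: "('v, 'e::finite) pre_digraph \<Rightarrow> nat" where
  "betti G = dim (H1_real G)"


subsection \<open>The edge-path fundamental group\<close>

text \<open>
  The arc \<open>(e, True)\<close> is the edge \<open>e\<close> traversed along its chosen orientation,
  \<open>(e, False)\<close> is the same edge traversed backwards.
\<close>

definition bidirected :: "('v, 'e) pre_digraph \<Rightarrow> ('v, 'e \<times> bool) pre_digraph" where
  "bidirected G =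
     \<lparr>verts = verts G, arcs = arcs G \<times> UNIV,
      tail = (\<lambda>(e, d). if d then tail G e else head G e),
      head = (\<lambda>(e, d). if d then head G e else tail G e)\<rparr>"

definition based_cycles :: "('v, 'e) pre_digraph \<Rightarrow> 'v \<Rightarrow> ('e \<times> bool) list set" where
  "based_cycles G x0 = {p. pre_digraph.awalk (bidirected G) x0 p x0}"

definition backtrack_insertion ::
    "('v, 'e) pre_digraph \<Rightarrow> 'v \<Rightarrow> (('e \<times> bool) list \<times> ('e \<times> bool) list) set" where
  "backtrack_insertion G x0 =
     {(p @ r, p @ [(e, d), (e, \<not> d)] @ r) | p r e d.
        p @ r \<in> based_cycles G x0 \<and> p @ [(e, d), (e, \<not> d)] @ r \<in> based_cycles G x0}"

definition homotopy ::
    "('v, 'e) pre_digraph \<Rightarrow> 'v \<Rightarrow> (('e \<times> bool) list \<times> ('e \<times> bool) list) set" where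
  "homotopy G x0 =
     (backtrack_insertion G x0 \<union> (backtrack_insertion G x0)\<inverse>)\<^sup>*
       \<inter> based_cycles G x0 \<times> based_cycles G x0"

definition pi1 :: "('v, 'e) pre_digraph \<Rightarrow> 'v \<Rightarrow> ('e \<times> bool) list set set" where
  "pi1 G x0 = based_cycles G x0 // homotopy G x0"

definition pi1_length :: "('e \<times> bool) list set \<Rightarrow> nat" where
  "pi1_length \<alpha> = (LEAST n. \<exists>p \<in> \<alpha>. length p = n)"

definition walk_chain :: "('e::finite \<times> bool) list \<Rightarrow> real ^ 'e" where
  "walk_chain p = (\<Sum>(e, d) \<leftarrow> p. if d then axis e 1 else - axis e 1)"

text \<open>The representatives of an element of \<^const>\<open>pi1\<close> all have the same chain.\<close>

definition homology_class :: "('e::finite \<times> bool) list set \<Rightarrow> real ^ 'e" where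
  "homology_class \<alpha> = the_elem (walk_chain ` \<alpha>)"

definition homology_length :: "('v, 'e::finite) pre_digraph \<Rightarrow> 'v \<Rightarrow> real ^ 'e \<Rightarrow> nat" where
  "homology_length G x0 h =
     (LEAST n. \<exists>\<alpha> \<in> pi1 G x0. homology_class \<alpha> = h \<and> pi1_length \<alpha> = n)"


subsection \<open>The stable norm\<close>

text \<open>
  A Euclidean metric on a subspace is given by any bilinear form on the ambient space whose
  restriction to the subspace is an inner product; every inner product on the subspace extends
  to such a form.
\<close>

definition euclidean_on :: "'a::real_vector set \<Rightarrow> ('a \<Rightarrow> 'a \<Rightarrow> real) \<Rightarrow> bool" where
  "euclidean_on S q \<longleftrightarrow> bilinear q \<and> (\<forall>x \<in> S. \<forall>y \<in> S. q x y = q y x) \<and>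
     (\<forall>x \<in> S. x \<noteq> 0 \<longrightarrow> 0 < q x x)"

text \<open>A closest lattice point need not be unique; \<^const>\<open>arg_min\<close> picks one of them.\<close>

definition closest_H1_int ::
    "('v, 'e::finite) pre_digraph \<Rightarrow> (real ^ 'e \<Rightarrow> real ^ 'e \<Rightarrow> real) \<Rightarrow> real ^ 'e \<Rightarrow> real ^ 'e" where
  "closest_H1_int G q u = arg_min (\<lambda>z. q (u - z) (u - z)) (\<lambda>z. z \<in> H1_int G)"

definition stable_norm ::
    "('v, 'e::finite) pre_digraph \<Rightarrow> 'v \<Rightarrow> (real ^ 'e \<Rightarrow> real ^ 'e \<Rightarrow> real) \<Rightarrow> real ^ 'e \<Rightarrow> real" where
  "stable_norm G x0 q u =
     lim (\<lambda>n. real (homology_length G x0 (closest_H1_int G q (real n *\<^sub>R u))) / real n)"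

definition stable_ball ::
    "('v, 'e::finite) pre_digraph \<Rightarrow> 'v \<Rightarrow> (real ^ 'e \<Rightarrow> real ^ 'e \<Rightarrow> real) \<Rightarrow> (real ^ 'e) set" where
  "stable_ball G x0 q = {u \<in> H1_real G. stable_norm G x0 q u \<le> 1}"


subsection \<open>Lebesgue measure of a subspace\<close>

text \<open>
  This is Lebesgue measure in the coordinates of an orthonormal basis (indexed by the basis
  vectors themselves); it does not depend on the basis.
\<close>

definition orthonormal_basis_of :: "'a::euclidean_space set \<Rightarrow> 'a set \<Rightarrow> bool" where
  "orthonormal_basis_of S B \<longleftrightarrow>
     B \<subseteq> S \<and> pairwise orthogonal B \<and> (\<forall>v \<in> B. norm v = 1) \<and> span B = S"

definition subspace_lborel :: "'a::euclidean_space set \<Rightarrow> 'a measure" where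
  "subspace_lborel S =
     (let B = (SOME B. orthonormal_basis_of S B)
      in distr (\<Pi>\<^sub>M v \<in> B. lborel) (restrict_space borel S) (\<lambda>t. \<Sum>v \<in> B. t v *\<^sub>R v))"

definition haar :: "('v, 'e::finite) pre_digraph \<Rightarrow> (real ^ 'e) measure" where
  "haar G = subspace_lborel (H1_real G)"

end

theory Submission
  imports Defs "HOL-Probability.Probability" "HOL-Real_Asymp.Real_Asymp"
begin

text \<open>
  On cycles the stable norm is the \<open>l\<^sup>1\<close> norm. A real cycle is a positive combination of simple
  circuits that follow its signs; hence an integral cycle \<open>h\<close> can be spliced, circuit by circuit,
  into one fixed null-homologous tour of the vertices, and \<open>\<bar>h\<bar>\<close> differs from the \<open>l\<^sup>1\<close> norm by a
  bounded amount. So the stable ball is the section of the cross-polytope in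
  \<open>n = Vol(\<Gamma>)\<close> dimensions by the \<open>b\<close>-dimensional space \<open>E\<close> of cycles, and \<open>b!\<close> times
  its volume is the integral \<open>I\<close> of \<open>exp (- \<Sum> \<bar>x\<^sub>i\<bar>)\<close> over \<open>E\<close>. Both bounds on \<open>I\<close> hold for all
  subspaces.

  The function \<open>exp (- \<bar>t\<bar>)\<close> is the average of \<open>exp (- t\<^sup>2 / (2 r\<^sup>2))\<close> over a half-normal \<open>r\<close>, so \<open>I\<close>
  is an average of Gaussian integrals over \<open>E\<close>, which are computed in a diagonalizing orthonormal
  basis. The weighted arithmetic-geometric mean inequality bounds each of them by a product of
  powers of the \<open>r\<^sub>i\<close>, which gives \<open>I \<le> 2\<^sup>b\<close>. For the lower bound, if \<open>n \<ge> 2 b\<close> it suffices to compare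
  \<open>\<bar>t\<bar>\<close> with \<open>t\<^sup>2 / (2 s) + s / 2\<close> for \<open>s = b / n\<close>. Otherwise the Gaussian integral over \<open>E\<close> is traded for the dual
  one over the orthogonal complement, which gives \<open>I \<ge> 2\<^sup>b \<pi>\<^bsup>-(n-b)/2\<^esup>\<close>.
  For the bouquet \<open>n = b\<close>, and the two bounds coincide.
\<close>

section \<open>Integration over a subspace in orthonormal coordinates\<close>

text \<open>The lower bound is the delicate half, and no single comparison serves all
  \<open>n\<close>. Under the Gaussian comparison with \<open>s = b / n\<close> the bound
  \<open>(2 s)^b\<close> follows as long as \<open>2 e s \<le> \<pi>\<close>, that is for
  \<open>s\<close> up to about 0.578. So it cannot reach \<open>n = b\<close>, where the bound is
  attained. The dual bound is sharp at \<open>n = b\<close> and loses a factor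
  \<open>sqrt \<pi>\<close> for each further edge, whereas the target gives way by
  \<open>(n / b)^b\<close>, which is at least \<open>2^(n - b)\<close> as long as
  \<open>n \<le> 2 b\<close>. Since \<open>e < \<pi> < 4\<close>, the two ranges meet at
  \<open>n = 2 b\<close>. Passing to the complement helps because the double exponential turns there
  into the Cauchy function \<open>1 / (1 + z^2)\<close>, which has the elementary Gaussian minorant
  \<open>exp (- z^2)\<close>, with equality at \<open>z = 0\<close>. The mixture makes this duality
  a statement about Gaussians alone, so no Fourier transform has to be taken. In the upper bound the
  exponents of the scales are the diagonal entries of the orthogonal projection to the subspace:
  they lie in [0, 1], so Jensen's inequality applies to each power, and their sum is
  \<open>b\<close>.\<close>

interpretation lborel_PiM: product_sigma_finite "\<lambda>_. lborel :: real measure"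
  by (rule product_sigma_finite.intro) (rule sigma_finite_lborel)

text \<open>The product measure lives on functions on the index set and not on a Euclidean space, so
  translations and dilations are obtained one coordinate at a time: Fubini splits off a coordinate,
  and the one-dimensional substitution rule handles it.\<close>

lemma nn_integral_PiM_affine:
  fixes a c :: "'i \<Rightarrow> real"
  assumes "finite I" and "F \<in> borel_measurable (\<Pi>\<^sub>M i \<in> I. lborel)"
    and "\<And>i. i \<in> I \<Longrightarrow> c i \<noteq> 0"
  shows "(\<integral>\<^sup>+ t. F t \<partial>(\<Pi>\<^sub>M i \<in> I. lborel)) =
    ennreal (\<Prod>i\<in>I. \<bar>c i\<bar>) * (\<integral>\<^sup>+ t. F (\<lambda>i\<in>I. a i + c i * t i) \<partial>(\<Pi>\<^sub>M i \<in> I. lborel))"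
  using assms
proof (induction I arbitrary: F rule: finite_induct)
  case empty
  then show ?case by (simp add: PiM_empty nn_integral_count_space_finite restrict_def)
next
  case (insert i I)
  note [measurable] = insert.prems(1)
  let ?M = "\<lambda>I. \<Pi>\<^sub>M i \<in> I. (lborel :: real measure)"
  let ?r = "\<lambda>t. \<lambda>j\<in>I. a j + c j * t j"
  have "(\<lambda>p. F ((fst p)(i := snd p))) \<in> borel_measurable (?M I \<Otimes>\<^sub>M lborel)"
    using measurable_compose[OF measurable_add_dim insert.prems(1)] by (simp add: case_prod_beta)
  then have upd[measurable]: "(\<lambda>(x, y). F (x(i := y))) \<in> borel_measurable (?M I \<Otimes>\<^sub>M lborel)"
    by (simp add: case_prod_beta)
  have r[measurable]: "?r \<in> ?M I \<rightarrow>\<^sub>M ?M I"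
    by measurable
  have "(\<integral>\<^sup>+ t. F t \<partial>?M (insert i I)) = (\<integral>\<^sup>+ x. \<integral>\<^sup>+ y. F (x(i := y)) \<partial>lborel \<partial>?M I)"
    by (rule lborel_PiM.product_nn_integral_insert) (use insert in auto)
  also have "\<dots> = ennreal (\<Prod>i\<in>I. \<bar>c i\<bar>) * (\<integral>\<^sup>+ x. \<integral>\<^sup>+ y. F ((?r x)(i := y)) \<partial>lborel \<partial>?M I)"
    by (rule insert.IH) (measurable, use insert in auto)
  also have "(\<integral>\<^sup>+ x. \<integral>\<^sup>+ y. F ((?r x)(i := y)) \<partial>lborel \<partial>?M I) =
      (\<integral>\<^sup>+ x. \<bar>c i\<bar> * (\<integral>\<^sup>+ y. F ((?r x)(i := a i + c i * y)) \<partial>lborel) \<partial>?M I)"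
  proof (rule nn_integral_cong)
    fix x assume x: "x \<in> space (?M I)"
    have "?r x \<in> space (?M I)" using measurable_space[OF r x] .
    then have "(\<lambda>y. F ((?r x)(i := y))) \<in> borel_measurable borel"
      by measurable
    from nn_integral_real_affine[OF this, of "c i" "a i"] insert.prems(2)
    show "(\<integral>\<^sup>+ y. F ((?r x)(i := y)) \<partial>lborel) =
      \<bar>c i\<bar> * (\<integral>\<^sup>+ y. F ((?r x)(i := a i + c i * y)) \<partial>lborel)"
      by simp
  qed
  also have "\<dots> = \<bar>c i\<bar> * (\<integral>\<^sup>+ x. \<integral>\<^sup>+ y. F ((?r x)(i := a i + c i * y)) \<partial>lborel \<partial>?M I)"
    by (rule nn_integral_cmult) measurable
  also have "(\<integral>\<^sup>+ x. \<integral>\<^sup>+ y. F ((?r x)(i := a i + c i * y)) \<partial>lborel \<partial>?M I) =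
      (\<integral>\<^sup>+ x. \<integral>\<^sup>+ y. F (\<lambda>j\<in>insert i I. a j + c j * (x(i := y)) j) \<partial>lborel \<partial>?M I)"
    using insert(2) by (intro nn_integral_cong arg_cong[where f=F]) (auto simp: fun_eq_iff)
  also have "\<dots> = (\<integral>\<^sup>+ t. F (\<lambda>j\<in>insert i I. a j + c j * t j) \<partial>?M (insert i I))"
    by (rule lborel_PiM.product_nn_integral_insert[symmetric, OF insert(1,2)]) measurable
  finally show ?case
    unfolding prod.insert[OF insert(1,2)] ennreal_mult'[OF abs_ge_zero] by (simp only: mult_ac)
qed

text \<open>The basis stays a parameter so that each Gaussian can be integrated in a basis that
  diagonalizes it. By \<open>basis_integral_unique\<close> the value depends only on the span, which
  also makes the arbitrary choice in \<open>subspace_lborel\<close> harmless.\<close>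

definition basis_integral :: "'a::euclidean_space set \<Rightarrow> ('a \<Rightarrow> ennreal) \<Rightarrow> ennreal" where
  "basis_integral B f = (\<integral>\<^sup>+ t. f (\<Sum>v\<in>B. t v *\<^sub>R v) \<partial>(\<Pi>\<^sub>M v \<in> B. lborel))"

lemma orthonormal_basis_of_finite: "orthonormal_basis_of S B \<Longrightarrow> finite B"
  by (simp add: orthonormal_basis_of_def pairwise_orthogonal_imp_finite)

lemma orthonormal_basis_of_inner:
  assumes "orthonormal_basis_of S B" "v \<in> B" "w \<in> B"
  shows "v \<bullet> w = (if v = w then 1 else 0)"
proof (cases "v = w")
  case True
  then show ?thesis using assms by (simp add: orthonormal_basis_of_def dot_square_norm)
next
  case False
  then have "orthogonal v w" using assms by (simp add: orthonormal_basis_of_def pairwise_def)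
  then show ?thesis using False by (simp add: orthogonal_def)
qed

lemma orthonormal_basis_of_coord:
  assumes "orthonormal_basis_of S B" "w \<in> B"
  shows "(\<Sum>v\<in>B. t v *\<^sub>R v) \<bullet> w = t w"
proof -
  have "(\<Sum>v\<in>B. t v *\<^sub>R v) \<bullet> w = (\<Sum>v\<in>B. t v * (if v = w then 1 else 0))"
    using orthonormal_basis_of_inner[OF assms(1) _ assms(2)] by (simp add: inner_sum_left)
  also have "\<dots> = t w"
    using assms orthonormal_basis_of_finite by (subst sum.mono_neutral_cong_right[of B "{w}"]) auto
  finally show ?thesis .
qed

lemma orthonormal_basis_of_expand:
  assumes "orthonormal_basis_of S B" "x \<in> S"
  shows "x = (\<Sum>v\<in>B. (x \<bullet> v) *\<^sub>R v)"
proof -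
  have "x \<in> span B" using assms by (simp add: orthonormal_basis_of_def)
  then obtain t where t: "x = (\<Sum>v\<in>B. t v *\<^sub>R v)"
    unfolding span_finite[OF orthonormal_basis_of_finite[OF assms(1)]] by (elim rangeE)
  have "(\<Sum>v\<in>B. t v *\<^sub>R v) = (\<Sum>v\<in>B. (x \<bullet> v) *\<^sub>R v)"
    unfolding t by (intro sum.cong) (simp_all add: orthonormal_basis_of_coord[OF assms(1)])
  with t show ?thesis by (rule trans)
qed

lemma orthonormal_basis_of_norm:
  assumes "orthonormal_basis_of S B" "x \<in> S"
  shows "(norm x)\<^sup>2 = (\<Sum>v\<in>B. (x \<bullet> v)\<^sup>2)"
proof -
  have "(norm x)\<^sup>2 = x \<bullet> (\<Sum>v\<in>B. (x \<bullet> v) *\<^sub>R v)"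
    unfolding orthonormal_basis_of_expand[OF assms, symmetric] by (rule power2_norm_eq_inner)
  then show ?thesis by (simp add: inner_sum_right power2_eq_square)
qed

lemma orthonormal_basis_of_card:
  assumes "orthonormal_basis_of S B" shows "card B = dim S"
proof -
  have B: "pairwise orthogonal B" "\<forall>v\<in>B. norm v = 1" "span B = S"
    using assms by (simp_all add: orthonormal_basis_of_def)
  then have "0 \<notin> B" by auto
  with B have "independent B" by (intro pairwise_orthogonal_independent)
  then show ?thesis using dim_span_eq_card_independent[of B] B(3) by simp
qed

lemma orthonormal_basis_of_sum_mem:
  assumes "orthonormal_basis_of S B" shows "(\<Sum>v\<in>B. t v *\<^sub>R v) \<in> S"
proof -
  have "(\<Sum>v\<in>B. t v *\<^sub>R v) \<in> span B" by (intro span_sum span_scale span_base)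
  then show ?thesis using assms by (simp add: orthonormal_basis_of_def)
qed

lemma basis_integral_cong:
  assumes "orthonormal_basis_of S B" "\<And>x. x \<in> S \<Longrightarrow> f x = g x"
  shows "basis_integral B f = basis_integral B g"
  unfolding basis_integral_def
  by (intro nn_integral_cong assms(2) orthonormal_basis_of_sum_mem[OF assms(1)])

lemma basis_integral_mono:
  assumes "orthonormal_basis_of S B" "\<And>x. x \<in> S \<Longrightarrow> f x \<le> g x"
  shows "basis_integral B f \<le> basis_integral B g"
  unfolding basis_integral_def
  by (intro nn_integral_mono assms(2) orthonormal_basis_of_sum_mem[OF assms(1)])

lemma basis_integral_cmult:
  assumes [measurable]: "f \<in> borel_measurable borel"
  shows "basis_integral B (\<lambda>x. c * f x) = c * basis_integral B f"
  unfolding basis_integral_def by (rule nn_integral_cmult) measurable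

text \<open>One rule for three uses: translation (\<open>s = 1\<close>), reflection
  (\<open>s = - 1\<close>) and dilation (\<open>y = 0\<close>). The Jacobian is one factor
  \<bar>s\<bar> for each basis vector.\<close>

lemma basis_integral_affine:
  assumes B: "orthonormal_basis_of S B" and [measurable]: "f \<in> borel_measurable borel"
    and y: "y \<in> S" and s: "s \<noteq> 0"
  shows "basis_integral B f = ennreal (\<bar>s\<bar> ^ dim S) * basis_integral B (\<lambda>x. f (y + s *\<^sub>R x))"
proof -
  have "basis_integral B f = ennreal (\<Prod>v\<in>B. \<bar>s\<bar>) *
    (\<integral>\<^sup>+ t. f (\<Sum>v\<in>B. (\<lambda>v\<in>B. y \<bullet> v + s * t v) v *\<^sub>R v) \<partial>(\<Pi>\<^sub>M v \<in> B. lborel))"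
    unfolding basis_integral_def
    using nn_integral_PiM_affine[OF orthonormal_basis_of_finite[OF B],
        of "\<lambda>t. f (\<Sum>v\<in>B. t v *\<^sub>R v)" "\<lambda>_. s" "\<lambda>v. y \<bullet> v"] s
    by simp
  also have "(\<integral>\<^sup>+ t. f (\<Sum>v\<in>B. (\<lambda>v\<in>B. y \<bullet> v + s * t v) v *\<^sub>R v) \<partial>(\<Pi>\<^sub>M v \<in> B. lborel)) =
     basis_integral B (\<lambda>x. f (y + s *\<^sub>R x))"
    unfolding basis_integral_def
  proof (intro nn_integral_cong arg_cong[where f=f])
    fix t :: "'a \<Rightarrow> real"
    have "(\<Sum>v\<in>B. (\<lambda>v\<in>B. y \<bullet> v + s * t v) v *\<^sub>R v) =
        (\<Sum>v\<in>B. (y \<bullet> v) *\<^sub>R v) + s *\<^sub>R (\<Sum>v\<in>B. t v *\<^sub>R v)"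
      by (simp add: scaleR_left_distrib sum.distrib scaleR_sum_right)
    then show "(\<Sum>v\<in>B. (\<lambda>v\<in>B. y \<bullet> v + s * t v) v *\<^sub>R v) = y + s *\<^sub>R (\<Sum>v\<in>B. t v *\<^sub>R v)"
      using orthonormal_basis_of_expand[OF B y] by simp
  qed
  finally show ?thesis by (simp add: orthonormal_basis_of_card[OF B])
qed

section \<open>Gaussian integrals over a subspace\<close>

lemma nn_integral_gaussian:
  assumes "l > 0"
  shows "(\<integral>\<^sup>+ x. ennreal (exp (- (l * x\<^sup>2 / 2))) \<partial>lborel) = ennreal (sqrt (2 * pi / l))"
proof -
  let ?s = "1 / sqrt l"
  have s: "?s > 0" "?s\<^sup>2 = 1 / l" using assms by (simp_all add: power_divide)
  have e: "exp (- (l * x\<^sup>2 / 2)) = sqrt (2 * pi / l) * normal_density 0 ?s x" for x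
    unfolding normal_density_def s using assms by (simp add: field_simps)
  have "(\<integral>\<^sup>+ x. ennreal (normal_density 0 ?s x) \<partial>lborel) = ennreal 1"
    using s by (subst nn_integral_eq_integral) auto
  then show ?thesis
    unfolding e using assms by (simp add: ennreal_mult' nn_integral_cmult)
qed

lemma basis_integral_gaussian:
  assumes B: "orthonormal_basis_of S B" and l: "\<And>v. v \<in> B \<Longrightarrow> l v > 0"
  shows "basis_integral B (\<lambda>x. ennreal (exp (- ((\<Sum>v\<in>B. l v * (x \<bullet> v)\<^sup>2) / 2)))) =
    ennreal (\<Prod>v\<in>B. sqrt (2 * pi / l v))"
proof -
  have e: "ennreal (exp (- ((\<Sum>w\<in>B. l w * ((\<Sum>v\<in>B. t v *\<^sub>R v) \<bullet> w)\<^sup>2) / 2))) =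
      (\<Prod>v\<in>B. ennreal (exp (- (l v * (t v)\<^sup>2 / 2))))" for t
  proof -
    have "exp (- ((\<Sum>w\<in>B. l w * ((\<Sum>v\<in>B. t v *\<^sub>R v) \<bullet> w)\<^sup>2) / 2)) =
       exp (\<Sum>w\<in>B. - (l w * (t w)\<^sup>2 / 2))"
      using orthonormal_basis_of_coord[OF B]
      by (simp add: sum_negf sum_divide_distrib)
    also have "\<dots> = (\<Prod>v\<in>B. exp (- (l v * (t v)\<^sup>2 / 2)))"
      by (rule exp_sum) (rule orthonormal_basis_of_finite[OF B])
    finally show ?thesis by (simp add: prod_ennreal)
  qed
  have "basis_integral B (\<lambda>x. ennreal (exp (- ((\<Sum>v\<in>B. l v * (x \<bullet> v)\<^sup>2) / 2)))) =
     (\<Prod>v\<in>B. \<integral>\<^sup>+ x. ennreal (exp (- (l v * x\<^sup>2 / 2))) \<partial>lborel)"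
    unfolding basis_integral_def e
    by (rule lborel_PiM.product_nn_integral_prod) (use orthonormal_basis_of_finite[OF B] in auto)
  also have "\<dots> = (\<Prod>v\<in>B. ennreal (sqrt (2 * pi / l v)))"
    using l by (intro prod.cong nn_integral_gaussian) auto
  also have "\<dots> = ennreal (\<Prod>v\<in>B. sqrt (2 * pi / l v))"
    using l by (intro prod_ennreal) (simp add: less_imp_le)
  finally show ?thesis .
qed

lemma basis_integral_std_gaussian:
  assumes B: "orthonormal_basis_of S B" and "l > 0"
  shows "basis_integral B (\<lambda>x. ennreal (exp (- (l * (norm x)\<^sup>2 / 2)))) = ennreal (sqrt (2 * pi / l) ^ dim S)"
proof -
  have "basis_integral B (\<lambda>x. ennreal (exp (- (l * (norm x)\<^sup>2 / 2)))) =
    basis_integral B (\<lambda>x. ennreal (exp (- ((\<Sum>v\<in>B. l * (x \<bullet> v)\<^sup>2) / 2))))"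
    using orthonormal_basis_of_norm[OF B] by (intro basis_integral_cong[OF B]) (simp add: sum_distrib_left)
  then show ?thesis
    using basis_integral_gaussian[OF B, of "\<lambda>_. l"] assms(2) orthonormal_basis_of_card[OF B] by simp
qed

section \<open>Fubini and independence of the basis\<close>

lemma sigma_finite_PiM_lborel:
  "finite B \<Longrightarrow> sigma_finite_measure (\<Pi>\<^sub>M v \<in> B. (lborel :: real measure))"
  by (rule lborel_PiM.sigma_finite)

lemma basis_integral_nn_integral_swap:
  assumes "finite B" "sigma_finite_measure M"
    and [measurable]: "case_prod h \<in> borel_measurable (borel \<Otimes>\<^sub>M M)"
  shows "basis_integral B (\<lambda>x. \<integral>\<^sup>+ r. h x r \<partial>M) = (\<integral>\<^sup>+ r. basis_integral B (\<lambda>x. h x r) \<partial>M)"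
proof -
  interpret pair_sigma_finite "\<Pi>\<^sub>M v \<in> B. (lborel :: real measure)" M
    using sigma_finite_PiM_lborel[OF assms(1)] assms(2) by (simp add: pair_sigma_finite_def)
  show ?thesis unfolding basis_integral_def
    by (rule Fubini'[symmetric]) measurable
qed

lemma basis_integral_swap:
  assumes "finite B" "finite C" and [measurable]: "case_prod h \<in> borel_measurable (borel \<Otimes>\<^sub>M borel)"
  shows "basis_integral B (\<lambda>x. basis_integral C (\<lambda>y. h x y)) =
    basis_integral C (\<lambda>y. basis_integral B (\<lambda>x. h x y))"
  unfolding basis_integral_def[of C]
  by (rule basis_integral_nn_integral_swap[OF assms(1) sigma_finite_PiM_lborel[OF assms(2)]]) measurable

lemma basis_integral_measurable:
  assumes "finite C" and [measurable]: "case_prod h \<in> borel_measurable (M \<Otimes>\<^sub>M borel)"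
  shows "(\<lambda>x. basis_integral C (h x)) \<in> borel_measurable M"
proof -
  interpret sigma_finite_measure "\<Pi>\<^sub>M v \<in> C. (lborel :: real measure)"
    using assms(1) by (rule sigma_finite_PiM_lborel)
  show ?thesis unfolding basis_integral_def by measurable
qed

text \<open>Uniqueness of Haar measure: both sides are translation invariant, and they agree on
  the radial function \<open>exp (- (norm x)\<^sup>2 / 2)\<close>.\<close>

lemma basis_integral_unique:
  assumes B: "orthonormal_basis_of S B" and C: "orthonormal_basis_of S C"
    and f[measurable]: "f \<in> borel_measurable borel"
  shows "basis_integral B f = basis_integral C f"
proof -
  define g where "g x = ennreal (exp (- (1 * (norm x)\<^sup>2 / 2)))" for x :: 'a
  have g[measurable]: "g \<in> borel_measurable borel" unfolding g_def by measurable
  note fin = orthonormal_basis_of_finite[OF B] orthonormal_basis_of_finite[OF C]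
  have sub: "subspace S" using B by (metis orthonormal_basis_of_def subspace_span)
  define K where "K = sqrt (2 * pi / 1) ^ dim S"
  have K: "K > 0" unfolding K_def by simp
  have KB: "basis_integral B g = ennreal K" and KC: "basis_integral C g = ennreal K"
    using basis_integral_std_gaussian[OF B, of 1] basis_integral_std_gaussian[OF C, of 1]
    unfolding g_def K_def by simp_all
  have shift: "basis_integral B f = basis_integral B (\<lambda>x. f (y + x))"
    if "y \<in> S" and [measurable]: "f \<in> borel_measurable borel" for f y
    using basis_integral_affine[OF B that(2,1), of 1] by simp
  have shiftC: "basis_integral C f = basis_integral C (\<lambda>x. f (y + x))"
    if "y \<in> S" and [measurable]: "f \<in> borel_measurable borel" for f y
    using basis_integral_affine[OF C that(2,1), of 1] by simp
  have shiftN: "basis_integral B f = basis_integral B (\<lambda>x. f (y - x))"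
    if "y \<in> S" and [measurable]: "f \<in> borel_measurable borel" for f y
    using basis_integral_affine[OF B that(2,1), of "-1"] by simp
  \<comment> \<open>The double integral of \<open>f x * g (y - x)\<close> is evaluated in two ways:
    integrating \<open>g\<close> first gives \<open>K\<close>; replacing \<open>x\<close> by
    \<open>y - x\<close> and swapping moves \<open>f\<close> to the other basis.\<close>
  have "ennreal K * basis_integral B f = basis_integral B (\<lambda>x. f x * basis_integral C g)"
    using basis_integral_cmult[OF f, of B "ennreal K"] by (simp add: KC mult.commute)
  also have "\<dots> = basis_integral B (\<lambda>x. basis_integral C (\<lambda>y. f x * g (y - x)))"
  proof (intro basis_integral_cong[OF B])
    fix x assume "x \<in> S"
    then show "f x * basis_integral C g = basis_integral C (\<lambda>y. f x * g (y - x))"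
      using sub by (subst shiftC[of "- x"]) (auto simp: basis_integral_cmult subspace_neg)
  qed
  also have "\<dots> = basis_integral C (\<lambda>y. basis_integral B (\<lambda>x. f x * g (y - x)))"
    by (rule basis_integral_swap) (use fin in auto)
  also have "\<dots> = basis_integral C (\<lambda>y. basis_integral B (\<lambda>x. f (y - x) * g x))"
    by (intro basis_integral_cong[OF C], subst shiftN) auto
  also have "\<dots> = basis_integral B (\<lambda>x. basis_integral C (\<lambda>y. f (y - x) * g x))"
    by (rule basis_integral_swap) (use fin in auto)
  also have "\<dots> = basis_integral B (\<lambda>x. basis_integral C f * g x)"
  proof (intro basis_integral_cong[OF B])
    fix x assume "x \<in> S"
    then show "basis_integral C (\<lambda>y. f (y - x) * g x) = basis_integral C f * g x"
      using sub by (subst shiftC[of "- x" f])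
        (auto simp: basis_integral_cmult subspace_neg mult.commute[of _ "g x"])
  qed
  also have "\<dots> = ennreal K * basis_integral C f"
    using basis_integral_cmult[OF g, of B "basis_integral C f"] by (simp add: KB mult.commute)
  finally show ?thesis using K by (simp add: ennreal_mult_cancel_left)
qed

text \<open>Spectral theorem for the restriction of a form to a subspace. A maximum point
  \<open>v\<close> of \<open>q\<close> on the unit sphere of \<open>S\<close> is
  \<open>q\<close>-orthogonal to every vector of \<open>S\<close> orthogonal to it, since otherwise
  a small rotation towards that vector would increase \<open>q\<close>; the induction continues in
  the orthogonal complement of \<open>v\<close>.\<close>

lemma diagonalizing_basis:
  fixes q :: "'a::euclidean_space \<Rightarrow> 'a \<Rightarrow> real"
  assumes q: "bilinear q" and sym: "\<And>x y. q x y = q y x" and "subspace S"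
  obtains B where "orthonormal_basis_of S B" "\<And>v w. v \<in> B \<Longrightarrow> w \<in> B \<Longrightarrow> v \<noteq> w \<Longrightarrow> q v w = 0"
proof -
  have "\<exists>B. orthonormal_basis_of S B \<and> (\<forall>v\<in>B. \<forall>w\<in>B. v \<noteq> w \<longrightarrow> q v w = 0)"
    using \<open>subspace S\<close>
  proof (induction "dim S" arbitrary: S rule: less_induct)
    case less
    show ?case
    proof (cases "S = {0}")
      case True
      then have "orthonormal_basis_of S {}" by (auto simp: orthonormal_basis_of_def)
      then show ?thesis by blast
    next
      case False
      interpret q: bounded_bilinear q using q by (simp add: bilinear_conv_bounded_bilinear)
      let ?U = "sphere 0 1 \<inter> S"
      obtain x where x: "x \<in> S" "x \<noteq> 0" using False subspace_0[OF less.prems] by blast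
      then have "x /\<^sub>R norm x \<in> ?U" using less.prems by (simp add: subspace_scale)
      then have ne: "?U \<noteq> {}" by blast
      have cpt: "compact ?U"
        by (intro compact_Int_closed compact_sphere closed_subspace less.prems)
      have cont: "continuous_on ?U (\<lambda>x. q x x)"
        by (intro q.continuous_on continuous_on_id)
      obtain v where v: "v \<in> ?U" "\<And>y. y \<in> ?U \<Longrightarrow> q y y \<le> q v v"
        using continuous_attains_sup[OF cpt ne cont] by metis
      have max: "q y y \<le> q v v * (norm y)\<^sup>2" if "y \<in> S" for y
      proof (cases "y = 0")
        case False
        then have "y /\<^sub>R norm y \<in> ?U" using that less.prems by (simp add: subspace_scale)
        from v(2)[OF this] have "inverse (norm y) * (inverse (norm y) * q y y) \<le> q v v"
          by (simp add: q.scaleR_left q.scaleR_right)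
        then show ?thesis using False by (simp add: field_simps power2_eq_square)
      qed (simp add: q.zero_left)
      have ortho: "q v w = 0" if w: "w \<in> S" "w \<bullet> v = 0" for w
      proof (rule ccontr)
        assume ne: "q v w \<noteq> 0"
        let ?M = "q v v * (norm w)\<^sup>2 - q w w"
        have key: "2 * t * q v w \<le> t\<^sup>2 * ?M" for t
        proof -
          have m: "v + t *\<^sub>R w \<in> S" using v(1) w less.prems by (simp add: subspace_add subspace_scale)
          have "v \<bullet> v = 1" "v \<bullet> w = 0" using v(1) w(2) by (auto simp: norm_eq_1 inner_commute)
          then have n: "(norm (v + t *\<^sub>R w))\<^sup>2 = 1 + t\<^sup>2 * (norm w)\<^sup>2"
            unfolding power2_norm_eq_inner using w(2)
            by (simp add: inner_add_left inner_add_right power2_eq_square)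
          have "q (v + t *\<^sub>R w) (v + t *\<^sub>R w) = q v v + 2 * t * q v w + t\<^sup>2 * q w w"
            by (simp add: q.add_left q.add_right q.scaleR_left q.scaleR_right sym[of w v]
                power2_eq_square algebra_simps)
          with max[OF m] show ?thesis unfolding n by (simp add: algebra_simps)
        qed
        \<comment> \<open>For small \<open>t\<close> the linear side of \<open>key\<close> beats the
          quadratic one. This value has the sign that makes the linear side positive, and that side
          becomes twice the upper bound of the other; the \<open>+ 1\<close> keeps the denominator
          positive.\<close>
        define s where "s = q v w / (\<bar>?M\<bar> + 1)"
        have a: "2 * s * q v w = 2 * (q v w)\<^sup>2 / (\<bar>?M\<bar> + 1)"
          by (simp add: s_def power2_eq_square)
        have "s\<^sup>2 * ?M \<le> s\<^sup>2 * (\<bar>?M\<bar> + 1)" by (intro mult_left_mono) auto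
        also have "\<dots> = (q v w)\<^sup>2 / (\<bar>?M\<bar> + 1)"
          unfolding s_def by (simp add: power_divide power2_eq_square)
        finally have "2 * (q v w)\<^sup>2 / (\<bar>?M\<bar> + 1) \<le> (q v w)\<^sup>2 / (\<bar>?M\<bar> + 1)"
          using key[of s] a by linarith
        moreover have "(q v w)\<^sup>2 / (\<bar>?M\<bar> + 1) > 0" using ne by (intro divide_pos_pos) auto
        ultimately show False by simp
      qed
      let ?S = "{w \<in> S. w \<bullet> v = 0}"
      have sub: "subspace ?S"
        using less.prems by (auto simp: subspace_def inner_add_left)
      have vS: "v \<in> S" "v \<notin> ?S" and v1: "v \<bullet> v = 1" using v(1) by (auto simp: norm_eq_1)
      have "dim ?S < dim S"
      proof -
        have "dim ?S \<le> dim S" by (intro dim_subset) auto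
        moreover have "dim ?S \<noteq> dim S"
        proof
          assume "dim ?S = dim S"
          then have "?S = S" by (intro subspace_dim_equal sub less.prems) auto
          with vS(1) have "v \<in> ?S" by metis
          with vS(2) show False by contradiction
        qed
        ultimately show ?thesis by simp
      qed
      from less.hyps[OF this sub] obtain B where
        "orthonormal_basis_of ?S B \<and> (\<forall>v\<in>B. \<forall>w\<in>B. v \<noteq> w \<longrightarrow> q v w = 0)" ..
      then have B: "orthonormal_basis_of ?S B" "\<forall>v\<in>B. \<forall>w\<in>B. v \<noteq> w \<longrightarrow> q v w = 0"
        by simp_all
      then have BS: "B \<subseteq> ?S" "span B = ?S" by (simp_all add: orthonormal_basis_of_def)
      have "span (insert v B) = S"
      proof
        show "span (insert v B) \<subseteq> S" using BS vS less.prems by (intro span_minimal) auto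
        show "S \<subseteq> span (insert v B)"
        proof
          fix x assume "x \<in> S"
          then have "x - (x \<bullet> v) *\<^sub>R v \<in> span B"
            using BS vS v1 less.prems by (simp add: subspace_diff subspace_scale inner_diff_left)
          then show "x \<in> span (insert v B)" by (auto simp: span_breakdown_eq)
        qed
      qed
      moreover have "pairwise orthogonal (insert v B)"
        using B(1) BS(1) by (auto simp: orthonormal_basis_of_def pairwise_insert orthogonal_def
            inner_commute[of v])
      moreover have "\<forall>w\<in>insert v B. norm w = 1"
        using B(1) v1 by (simp add: orthonormal_basis_of_def norm_eq_1)
      moreover have "insert v B \<subseteq> S" using BS(1) vS(1) by blast
      ultimately have "orthonormal_basis_of S (insert v B)"
        by (simp add: orthonormal_basis_of_def)
      moreover have "\<forall>v'\<in>insert v B. \<forall>w\<in>insert v B. v' \<noteq> w \<longrightarrow> q v' w = 0"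
      proof (intro ballI impI)
        have 1: "q v w = 0" "q w v = 0" if "w \<in> B" for w
          using that ortho[of w] BS(1) sym[of w v] by auto
        fix v' w assume "v' \<in> insert v B" "w \<in> insert v B" "v' \<noteq> w"
        then show "q v' w = 0" using 1 B(2) by (elim insertE) simp_all
      qed
      ultimately show ?thesis by (intro exI conjI)
    qed
  qed
  then obtain B where "orthonormal_basis_of S B \<and> (\<forall>v\<in>B. \<forall>w\<in>B. v \<noteq> w \<longrightarrow> q v w = 0)" ..
  then show ?thesis by (intro that[of B]) simp_all
qed

lemma orthonormal_basis_of_exists:
  fixes S :: "'a::euclidean_space set"
  assumes "subspace S"
  obtains B where "orthonormal_basis_of S B"
proof -
  have "bilinear (\<lambda>x y :: 'a. 0 :: real)" by (auto simp: bilinear_def intro!: linearI)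
  then show ?thesis using diagonalizing_basis[OF _ _ assms] that by blast
qed

section \<open>The double exponential as a mixture of Gaussians\<close>

text \<open>A rescaled error function. The mixture integral is found through an explicit primitive,
  whose boundary values need both limits of \<open>\<Psi>\<close> and, in a degenerate case, its
  value at 0.\<close>

lemma gaussian_primitive:
  obtains \<Psi> :: "real \<Rightarrow> real" where "\<And>u. (\<Psi> has_real_derivative exp (- (u\<^sup>2 / 2))) (at u)"
    "(\<Psi> \<longlongrightarrow> sqrt (pi / 2)) at_top" "(\<Psi> \<longlongrightarrow> - sqrt (pi / 2)) at_bot" "\<Psi> 0 = 0"
proof -
  let ?f = "\<lambda>t :: real. exp (- (t\<^sup>2 / 2))"
  define \<Psi> where "\<Psi> u = (LBINT t=0..ereal u. ?f t)" for u :: real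
  have deriv: "(\<Psi> has_real_derivative ?f u) (at u)" for u
  proof -
    \<comment> \<open>The interval contains 0 and has \<open>u\<close> in its interior, so the
      derivative within it is a full derivative.\<close>
    have 1: "((\<lambda>u. LBINT t=ereal 0..u. ?f t) has_vector_derivative ?f u) (at u within {- \<bar>u\<bar> - 1..\<bar>u\<bar> + 1})"
    proof (rule interval_integral_FTC2)
      show "continuous_on {- \<bar>u\<bar> - 1..\<bar>u\<bar> + 1} ?f" by (intro continuous_intros) simp
    qed arith+
    have "u \<in> interior {- \<bar>u\<bar> - 1..\<bar>u\<bar> + 1}" unfolding interior_atLeastAtMost_real by simp arith
    from 1[unfolded at_within_interior[OF this]] show ?thesis
      unfolding \<Psi>_def has_real_derivative_iff_has_vector_derivative zero_ereal_def .
  qed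
  have pos: "(\<Psi> \<longlongrightarrow> sqrt (pi / 2)) at_top"
  proof -
    \<comment> \<open>Substitution of \<open>x / sqrt 2\<close> in the half-line integral of
      \<open>exp (- x\<^sup>2)\<close>.\<close>
    have "has_bochner_integral lborel (\<lambda>x. indicator {0..} (0 + (1 / sqrt 2) * x) *\<^sub>R exp (- (0 + (1 / sqrt 2) * x)\<^sup>2))
        ((sqrt pi / 2) /\<^sub>R \<bar>1 / sqrt 2\<bar>)"
      by (rule lborel_has_bochner_integral_real_affine_iff[THEN iffD1, OF _ gaussian_moment_0]) simp
    also have "(\<lambda>x :: real. indicator {0..} (0 + (1 / sqrt 2) * x) *\<^sub>R exp (- (0 + (1 / sqrt 2) * x)\<^sup>2)) =
        (\<lambda>x. indicator {0..} x *\<^sub>R ?f x)"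
    proof
      fix x :: real
      have "(0 \<le> x / sqrt 2) = (0 \<le> x)" by (simp add: zero_le_divide_iff)
      then show "indicator {0..} (0 + (1 / sqrt 2) * x) *\<^sub>R exp (- (0 + (1 / sqrt 2) * x)\<^sup>2) =
          indicator {0..} x *\<^sub>R ?f x"
        by (simp add: power_divide indicator_def)
    qed
    also have "(sqrt pi / 2) /\<^sub>R \<bar>1 / sqrt 2\<bar> = sqrt (pi / 2)"
    proof -
      have "sqrt pi / 2 * sqrt 2 = sqrt pi / (sqrt 2 * sqrt 2) * sqrt 2" by simp
      also have "\<dots> = sqrt pi / sqrt 2" by (simp del: real_sqrt_mult_self)
      finally show ?thesis by (simp add: real_sqrt_divide mult.commute)
    qed
    finally have g: "has_bochner_integral lborel (\<lambda>x. indicator {0..} x *\<^sub>R ?f x) (sqrt (pi / 2))" .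
    have "((\<lambda>y. \<integral> x. indicator {.. y} x *\<^sub>R (indicator {0..} x *\<^sub>R ?f x) \<partial>lborel) \<longlongrightarrow>
        (\<integral> x. indicator {0..} x *\<^sub>R ?f x \<partial>lborel)) at_top"
      using g by (intro tendsto_integral_at_top) (auto simp: has_bochner_integral_iff)
    moreover have "(\<integral> x. indicator {0..} x *\<^sub>R ?f x \<partial>lborel) = sqrt (pi / 2)"
      using g by (simp add: has_bochner_integral_iff)
    moreover have "eventually (\<lambda>y. (\<integral> x. indicator {.. y} x *\<^sub>R (indicator {0..} x *\<^sub>R ?f x) \<partial>lborel) = \<Psi> y) at_top"
      using eventually_ge_at_top[of 0]
    proof eventually_elim
      case (elim y)
      then have "\<Psi> y = (LBINT t:{0..y}. ?f t)"
        unfolding \<Psi>_def zero_ereal_def by (intro interval_integral_Icc)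
      also have "\<dots> = (\<integral> x. indicator {.. y} x *\<^sub>R (indicator {0..} x *\<^sub>R ?f x) \<partial>lborel)"
        unfolding set_lebesgue_integral_def by (intro Bochner_Integration.integral_cong) (auto simp: indicator_def)
      finally show ?case by simp
    qed
    ultimately show ?thesis by (simp add: filterlim_cong)
  qed
  have odd: "\<Psi> u = - \<Psi> (- u)" for u
  proof -
    have "\<Psi> u = (LBINT t=ereal (- u)..0. ?f t)"
      unfolding \<Psi>_def by (subst interval_integral_reflect) simp
    also have "\<dots> = - \<Psi> (- u)" unfolding \<Psi>_def by (rule interval_integral_endpoints_reverse)
    finally show ?thesis .
  qed
  from odd[of 0] have zero: "\<Psi> 0 = 0" by simp
  have "((\<lambda>u. - \<Psi> (- u)) \<longlongrightarrow> - sqrt (pi / 2)) at_bot"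
    by (intro tendsto_minus filterlim_compose[OF pos] filterlim_uminus_at_top_at_bot)
  then have "(\<Psi> \<longlongrightarrow> - sqrt (pi / 2)) at_bot" by (simp flip: odd)
  then show thesis using that[OF deriv pos _ zero] by simp
qed

lemma nn_integral_gaussian_mixture:
  assumes "x \<ge> 0"
  shows "(\<integral>\<^sup>+ r. ennreal (exp (- (r\<^sup>2 / 2) - x\<^sup>2 / (2 * r\<^sup>2))) * indicator {0<..} r \<partial>lborel) =
    ennreal (sqrt (pi / 2) * exp (- x))"
proof -
  let ?f = "\<lambda>r :: real. exp (- (r\<^sup>2 / 2) - x\<^sup>2 / (2 * r\<^sup>2))"
  obtain \<Psi> :: "real \<Rightarrow> real" where \<Psi>: "\<And>u. (\<Psi> has_real_derivative exp (- (u\<^sup>2 / 2))) (at u)"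
    "(\<Psi> \<longlongrightarrow> sqrt (pi / 2)) at_top" "(\<Psi> \<longlongrightarrow> - sqrt (pi / 2)) at_bot" "\<Psi> 0 = 0"
    using gaussian_primitive by blast
  \<comment> \<open>Both \<open>exp (- x) * exp (- (r - x / r)\<^sup>2 / 2)\<close> and \<open>exp x * exp (- (r + x / r)\<^sup>2 / 2)\<close> equal \<open>?f r\<close>,
    and the derivatives of \<open>r - x / r\<close> and \<open>r + x / r\<close> add up to \<open>2\<close>.\<close>
  define F where "F r = (exp (- x) * \<Psi> (r - x / r) + exp x * \<Psi> (r + x / r)) / 2" for r
  have dF: "(F has_real_derivative ?f r) (at r)" if "r > 0" for r
  proof -
    have 1: "((\<lambda>r. r - x / r) has_real_derivative 1 + x / r\<^sup>2) (at r)"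
      and 2: "((\<lambda>r. r + x / r) has_real_derivative 1 - x / r\<^sup>2) (at r)"
      using that by (auto intro!: derivative_eq_intros simp: power2_eq_square)
    have "(r - x / r)\<^sup>2 / 2 = r\<^sup>2 / 2 + x\<^sup>2 / (2 * r\<^sup>2) - x"
      "(r + x / r)\<^sup>2 / 2 = r\<^sup>2 / 2 + x\<^sup>2 / (2 * r\<^sup>2) + x"
      using that by (simp_all add: power2_eq_square field_simps)
    then have e: "exp (- x) * exp (- ((r - x / r)\<^sup>2 / 2)) = ?f r"
      "exp x * exp (- ((r + x / r)\<^sup>2 / 2)) = ?f r"
      by (simp_all add: algebra_simps flip: exp_add)
    have "(F has_real_derivative (exp (- x) * (exp (- ((r - x / r)\<^sup>2 / 2)) * (1 + x / r\<^sup>2)) +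
        exp x * (exp (- ((r + x / r)\<^sup>2 / 2)) * (1 - x / r\<^sup>2))) / 2) (at r)"
      unfolding F_def
      by (intro DERIV_cdivide DERIV_add DERIV_cmult DERIV_chain2[OF \<Psi>(1) 1] DERIV_chain2[OF \<Psi>(1) 2])
    also have "(exp (- x) * (exp (- ((r - x / r)\<^sup>2 / 2)) * (1 + x / r\<^sup>2)) +
        exp x * (exp (- ((r + x / r)\<^sup>2 / 2)) * (1 - x / r\<^sup>2))) / 2 = ?f r"
      unfolding mult.assoc[symmetric] e by (simp add: algebra_simps)
    finally show ?thesis .
  qed
  let ?s = "sqrt (pi / 2)"
  have "filterlim (\<lambda>r. r - x / r) at_top at_top \<and> filterlim (\<lambda>r. r + x / r) at_top at_top"
  proof (cases "x = 0")
    case False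
    then have "x > 0" using assms by simp
    then show ?thesis by (intro conjI) real_asymp+
  qed (simp add: filterlim_ident)
  then have top: "(F \<longlongrightarrow> (exp (- x) * ?s + exp x * ?s) / 2) at_top"
    unfolding F_def
    by (intro tendsto_divide tendsto_add tendsto_mult tendsto_const filterlim_compose[OF \<Psi>(2)]) simp_all
  \<comment> \<open>For \<open>x > 0\<close> the arguments of \<open>\<Psi>\<close> tend to minus
    and plus infinity; for \<open>x = 0\<close> both are \<open>r\<close> and tend to 0. The stated
    limit covers both cases.\<close>
  have bot: "(F \<longlongrightarrow> (exp x * ?s - exp (- x) * ?s) / 2) (at_right 0)"
  proof (cases "x = 0")
    case True
    then have F: "F = \<Psi>" by (simp add: F_def fun_eq_iff)
    have "(F \<longlongrightarrow> 0) (at_right 0)"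
      unfolding F using DERIV_isCont[OF \<Psi>(1), of 0] \<Psi>(4)
      by (auto simp: isCont_def intro: tendsto_mono[OF at_le])
    with True show ?thesis by simp
  next
    case False
    then have x: "x > 0" using assms by simp
    have lim: "filterlim (\<lambda>r. r - x / r) at_bot (at_right 0)" "filterlim (\<lambda>r. r + x / r) at_top (at_right 0)"
      using x by real_asymp+
    have "(F \<longlongrightarrow> (exp (- x) * (- ?s) + exp x * ?s) / 2) (at_right 0)"
      unfolding F_def
      by (intro tendsto_divide tendsto_add tendsto_mult tendsto_const filterlim_compose[OF \<Psi>(3) lim(1)]
          filterlim_compose[OF \<Psi>(2) lim(2)]) simp
    then show ?thesis by (simp add: algebra_simps)
  qed
  have p1: "((F \<circ> real_of_ereal) \<longlongrightarrow> (exp x * ?s - exp (- x) * ?s) / 2) (at_right (ereal 0))"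
    and p2: "((F \<circ> real_of_ereal) \<longlongrightarrow> (exp (- x) * ?s + exp x * ?s) / 2) (at_left \<infinity>)"
    using bot top by (simp_all only: ereal_tendsto_simps1)
  have p3: "ereal 0 < \<infinity>" by simp
  have dF': "DERIV F r :> ?f r" if "ereal 0 < ereal r" "ereal r < \<infinity>" for r
    using dF that by simp
  have p4: "isCont ?f r" if "ereal 0 < ereal r" "ereal r < \<infinity>" for r
    using that by (auto intro!: continuous_intros)
  have p5: "AE r in lborel. ereal 0 < ereal r \<longrightarrow> ereal r < \<infinity> \<longrightarrow> 0 \<le> ?f r" by simp
  have i: "set_integrable lborel (einterval 0 \<infinity>) ?f"
    "(LBINT r=0..\<infinity>. ?f r) = (exp (- x) * ?s + exp x * ?s) / 2 - (exp x * ?s - exp (- x) * ?s) / 2"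
    using p1 p2 interval_integral_FTC_nonneg[OF p3 dF' p4 p5 p1 p2] by (simp_all add: zero_ereal_def)
  have e: "einterval 0 \<infinity> = {0<..}" by (simp add: zero_ereal_def)
  have "(\<integral>\<^sup>+ r. ennreal (?f r) * indicator {0<..} r \<partial>lborel) = (\<integral>\<^sup>+ r. ennreal (indicator {0<..} r *\<^sub>R ?f r) \<partial>lborel)"
    by (intro nn_integral_cong) (auto simp: indicator_def)
  also have "\<dots> = ennreal (LBINT r:{0<..}. ?f r)"
    using i(1) unfolding e set_integrable_def set_lebesgue_integral_def
    by (intro nn_integral_eq_integral) auto
  also have "(LBINT r:{0<..}. ?f r) = (LBINT r=0..\<infinity>. ?f r)"
    by (simp add: interval_lebesgue_integral_def e)
  \<comment> \<open>The two terms with \<open>exp x\<close> cancel.\<close>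
  also have "\<dots> = ?s * exp (- x)" unfolding i(2) by (simp add: field_simps)
  finally show ?thesis .
qed

text \<open>The law of the absolute value of a standard normal variable. The value 0, at which
  \<open>1 / r\<close> degenerates, is excluded from the density.\<close>

definition half_normal :: "real measure" where
  "half_normal = density lborel (\<lambda>r. ennreal (sqrt (2 / pi) * exp (- (r\<^sup>2 / 2))) * indicator {0<..} r)"

lemma sets_half_normal[simp, measurable_cong]: "sets half_normal = sets borel"
  by (simp add: half_normal_def)

lemma space_half_normal[simp]: "space half_normal = UNIV"
  by (simp add: half_normal_def)

lemma nn_integral_half_normal:
  assumes [measurable]: "f \<in> borel_measurable borel"
  shows "(\<integral>\<^sup>+ r. f r \<partial>half_normal) = ennreal (sqrt (2 / pi)) *
    (\<integral>\<^sup>+ r. ennreal (exp (- (r\<^sup>2 / 2))) * f r * indicator {0<..} r \<partial>lborel)"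
proof -
  have "(\<integral>\<^sup>+ r. f r \<partial>half_normal) = (\<integral>\<^sup>+ r. ennreal (sqrt (2 / pi)) *
      (ennreal (exp (- (r\<^sup>2 / 2))) * f r * indicator {0<..} r) \<partial>lborel)"
    unfolding half_normal_def
    by (subst nn_integral_density) (auto intro!: nn_integral_cong simp: ennreal_mult' mult_ac)
  then show ?thesis by (simp add: nn_integral_cmult)
qed

text \<open>The case \<open>x = 0\<close> says that \<open>half_normal\<close> has total mass
  1.\<close>

lemma nn_integral_half_normal_laplace:
  "(\<integral>\<^sup>+ r. ennreal (exp (- (x\<^sup>2 / (2 * r\<^sup>2)))) \<partial>half_normal) = ennreal (exp (- \<bar>x\<bar>))"
proof -
  have "(\<integral>\<^sup>+ r. ennreal (exp (- (x\<^sup>2 / (2 * r\<^sup>2)))) \<partial>half_normal) =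
    ennreal (sqrt (2 / pi)) * (\<integral>\<^sup>+ r. ennreal (exp (- (r\<^sup>2 / 2) - \<bar>x\<bar>\<^sup>2 / (2 * r\<^sup>2))) * indicator {0<..} r \<partial>lborel)"
  proof -
    have eq: "ennreal (exp (- (r\<^sup>2 / 2))) * ennreal (exp (- (x\<^sup>2 / (2 * r\<^sup>2)))) =
        ennreal (exp (- (r\<^sup>2 / 2) - \<bar>x\<bar>\<^sup>2 / (2 * r\<^sup>2)))" for r :: real
      by (simp add: mult_exp_exp flip: ennreal_mult')
    have m: "(\<lambda>r :: real. ennreal (exp (- (x\<^sup>2 / (2 * r\<^sup>2))))) \<in> borel_measurable borel" by measurable
    show ?thesis unfolding nn_integral_half_normal[OF m] eq by (rule refl)
  qed
  also have "\<dots> = ennreal (sqrt (2 / pi) * sqrt (pi / 2) * exp (- \<bar>x\<bar>))"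
    by (subst nn_integral_gaussian_mixture) (auto simp: ennreal_mult' mult.assoc)
  also have "sqrt (2 / pi) * sqrt (pi / 2) = 1" by (simp flip: real_sqrt_mult)
  finally show ?thesis by simp
qed

lemma prob_space_half_normal: "prob_space half_normal"
  using nn_integral_half_normal_laplace[of 0] by (intro prob_spaceI) (simp add: nn_integral_const)

interpretation half_normal_PiM: product_sigma_finite "\<lambda>_. half_normal"
  by (rule product_sigma_finite.intro) (rule prob_space_imp_sigma_finite[OF prob_space_half_normal])

lemma AE_half_normal_pos: "AE r in half_normal. r > 0"
  unfolding half_normal_def by (subst AE_density) (auto simp: indicator_def)

lemma AE_PiM_half_normal_pos:
  "finite A \<Longrightarrow> AE r in (\<Pi>\<^sub>M i \<in> A. half_normal). \<forall>i\<in>A. r i > 0"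
  by (intro AE_finite_allI AE_PiM_component prob_space_half_normal AE_half_normal_pos)

text \<open>The factor \<open>r\<close> gives the integrand an elementary primitive. With
  \<open>z = 0\<close> this is the mean of the scale, which the upper bound uses; general
  \<open>z\<close> produces the Cauchy function of the dual bound, where the factor \<open>r\<close>
  comes from a determinant.\<close>

lemma nn_integral_half_normal_linear:
  "(\<integral>\<^sup>+ r. ennreal (r * exp (- (r\<^sup>2 * z\<^sup>2 / 2))) \<partial>half_normal) = ennreal (sqrt (2 / pi) / (1 + z\<^sup>2))"
proof -
  have pos: "1 + z\<^sup>2 > 0" by (intro add_pos_nonneg) auto
  have "(\<integral>\<^sup>+ r. ennreal (r * exp (- (r\<^sup>2 * z\<^sup>2 / 2))) \<partial>half_normal) = ennreal (sqrt (2 / pi)) *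
      (\<integral>\<^sup>+ r. ennreal (r * exp (- ((1 + z\<^sup>2) * r\<^sup>2 / 2))) * indicator {0..} r \<partial>lborel)"
  proof -
    have eq: "ennreal (exp (- (r\<^sup>2 / 2))) * ennreal (r * exp (- (r\<^sup>2 * z\<^sup>2 / 2))) * indicator {0<..} r =
        ennreal (r * exp (- ((1 + z\<^sup>2) * r\<^sup>2 / 2))) * indicator {0..} r" for r :: real
    proof -
      have "exp (- (r\<^sup>2 / 2)) * (r * exp (- (r\<^sup>2 * z\<^sup>2 / 2))) = r * exp (- (r\<^sup>2 / 2) + - (r\<^sup>2 * z\<^sup>2 / 2))"
        unfolding exp_add by simp
      also have "- (r\<^sup>2 / 2) + - (r\<^sup>2 * z\<^sup>2 / 2) = - ((1 + z\<^sup>2) * r\<^sup>2 / 2)"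
        by (simp add: field_simps)
      \<comment> \<open>The two indicators differ only at 0, where the factor \<open>r\<close>
        vanishes.\<close>
      finally show ?thesis
        by (cases "r = 0") (auto simp: indicator_def simp flip: ennreal_mult')
    qed
    have m: "(\<lambda>r :: real. ennreal (r * exp (- (r\<^sup>2 * z\<^sup>2 / 2)))) \<in> borel_measurable borel" by measurable
    show ?thesis unfolding nn_integral_half_normal[OF m] eq by (rule refl)
  qed
  also have "(\<integral>\<^sup>+ r. ennreal (r * exp (- ((1 + z\<^sup>2) * r\<^sup>2 / 2))) * indicator {0..} r \<partial>lborel) =
      ennreal (1 / (1 + z\<^sup>2))"
  proof -
    define a where "a = 1 + z\<^sup>2"
    have a: "a > 0" using pos by (simp add: a_def)
    have "(\<integral>\<^sup>+ r. ennreal (r * exp (- (a * r\<^sup>2 / 2))) * indicator {0..} r \<partial>lborel) =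
        ennreal (0 - (- exp (- (a * 0\<^sup>2 / 2)) / a))"
    proof (rule nn_integral_FTC_atLeast)
      show "((\<lambda>r. - exp (- (a * r\<^sup>2 / 2)) / a) has_real_derivative r * exp (- (a * r\<^sup>2 / 2))) (at r)" for r
        using a by (auto intro!: derivative_eq_intros)
      show "((\<lambda>r. - exp (- (a * r\<^sup>2 / 2)) / a) \<longlongrightarrow> 0) at_top"
        using a by real_asymp
    qed simp_all
    then show ?thesis unfolding a_def by simp
  qed
  finally show ?thesis by (simp flip: ennreal_mult')
qed

text \<open>The right side is the tangent at \<open>m\<close> of the concave function
  \<open>r powr c\<close>. Integrated against a law with mean \<open>m\<close>, this becomes
  Jensen's inequality.\<close>

lemma powr_le_affine:
  fixes m r c :: real
  assumes "m > 0" "r > 0" "0 \<le> c" "c \<le> 1"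
  shows "r powr c \<le> m powr c * (c / m * r + (1 - c))"
proof -
  have "(r / m) powr c * 1 powr (1 - c) \<le> c * (r / m) + (1 - c) * 1"
    by (rule Youngs_inequality_0) (use assms in auto)
  then have "(r / m) powr c \<le> c / m * r + (1 - c)" by simp
  moreover have "r powr c = m powr c * (r / m) powr c"
    using assms by (simp flip: powr_mult)
  ultimately show ?thesis using assms by (simp add: mult_left_mono)
qed

lemma nn_integral_half_normal_powr:
  assumes "0 \<le> c" "c \<le> 1"
  shows "(\<integral>\<^sup>+ r. ennreal (r powr c) \<partial>half_normal) \<le> ennreal (sqrt (2 / pi) powr c)"
proof -
  interpret prob_space half_normal by (rule prob_space_half_normal)
  let ?m = "sqrt (2 / pi)"
  have m: "?m > 0" by simp
  have "(\<integral>\<^sup>+ r. ennreal (r powr c) \<partial>half_normal) \<le>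
      (\<integral>\<^sup>+ r. ennreal (?m powr c) * (ennreal (c / ?m) * ennreal r + ennreal (1 - c)) \<partial>half_normal)"
  proof (rule nn_integral_mono_AE, use AE_half_normal_pos in eventually_elim)
    fix r :: real assume r: "r > 0"
    have "ennreal (r powr c) \<le> ennreal (?m powr c * (c / ?m * r + (1 - c)))"
      by (intro ennreal_leI powr_le_affine) (use assms r in auto)
    also have "\<dots> = ennreal (?m powr c) * (ennreal (c / ?m) * ennreal r + ennreal (1 - c))"
    proof -
      have "0 \<le> c / ?m" "0 \<le> c / ?m * r" "0 \<le> 1 - c" using assms r by auto
      then show ?thesis
        unfolding ennreal_mult'[OF powr_ge_zero] by (simp only: ennreal_plus ennreal_mult')
    qed
    finally show "ennreal (r powr c) \<le> \<dots>" .
  qed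
  also have "\<dots> = ennreal (?m powr c) * (ennreal (c / ?m) * (\<integral>\<^sup>+ r. ennreal r \<partial>half_normal) + ennreal (1 - c))"
    by (simp add: nn_integral_cmult nn_integral_add emeasure_space_1[simplified])
  also have "(\<integral>\<^sup>+ r. ennreal r \<partial>half_normal) = ennreal ?m"
    using nn_integral_half_normal_linear[of 0] by simp
  also have "ennreal (c / ?m) * ennreal ?m + ennreal (1 - c) = 1"
    using assms by (simp flip: ennreal_mult' ennreal_plus)
  finally show ?thesis by simp
qed

section \<open>Sections of the cross-polytope\<close>

lemma borel_measurable_vec_nth[measurable (raw)]:
  fixes f :: "'a \<Rightarrow> real ^ 'e::finite"
  assumes "f \<in> borel_measurable M"
  shows "(\<lambda>x. f x $ i) \<in> borel_measurable M"
  by (rule measurable_compose[OF assms borel_measurable_continuous_onI]) (intro continuous_intros)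

lemma quadratic_form_diagonal:
  fixes q :: "'a::euclidean_space \<Rightarrow> 'a \<Rightarrow> real"
  assumes q: "bilinear q" and B: "orthonormal_basis_of S B"
    and diag: "\<And>v w. v \<in> B \<Longrightarrow> w \<in> B \<Longrightarrow> v \<noteq> w \<Longrightarrow> q v w = 0"
    and x: "x \<in> S"
  shows "q x x = (\<Sum>v\<in>B. q v v * (x \<bullet> v)\<^sup>2)"
proof -
  have fin: "finite B" using orthonormal_basis_of_finite[OF B] .
  let ?y = "\<Sum>v\<in>B. (x \<bullet> v) *\<^sub>R v"
  have "q x x = q ?y ?y" using orthonormal_basis_of_expand[OF B x] by (rule arg_cong)
  also have "\<dots> = (\<Sum>(v, w)\<in>B \<times> B. q ((x \<bullet> v) *\<^sub>R v) ((x \<bullet> w) *\<^sub>R w))"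
    by (rule bilinear_sum[OF q])
  also have "\<dots> = (\<Sum>v\<in>B. \<Sum>w\<in>B. (x \<bullet> v) * ((x \<bullet> w) * q v w))"
    by (simp add: sum.cartesian_product bilinear_lmul[OF q] bilinear_rmul[OF q] mult_ac)
  also have "\<dots> = (\<Sum>v\<in>B. q v v * (x \<bullet> v)\<^sup>2)"
  proof (rule sum.cong)
    fix v assume v: "v \<in> B"
    have "(\<Sum>w\<in>B. (x \<bullet> v) * ((x \<bullet> w) * q v w)) = (\<Sum>w\<in>{v}. (x \<bullet> v) * ((x \<bullet> w) * q v w))"
      using v fin diag by (intro sum.mono_neutral_right) auto
    then show "(\<Sum>w\<in>B. (x \<bullet> v) * ((x \<bullet> w) * q v w)) = q v v * (x \<bullet> v)\<^sup>2"
      by (simp add: power2_eq_square)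
  qed simp
  finally show ?thesis .
qed

text \<open>Both sums are the squared length of the orthogonal projection of \<open>a\<close> to
  \<open>S\<close>. For \<open>a = axis i 1\<close> this is a diagonal entry of the projection
  matrix, the exponent that the \<open>i\<close>-th scale receives below.\<close>

lemma orthonormal_basis_of_sum_inner_sq:
  assumes B: "orthonormal_basis_of S B" and C: "orthonormal_basis_of S C"
  shows "(\<Sum>v\<in>B. (v \<bullet> a)\<^sup>2) = (\<Sum>w\<in>C. (w \<bullet> a)\<^sup>2)"
proof -
  have expand: "v \<bullet> a = (\<Sum>w\<in>C. (v \<bullet> w) * (w \<bullet> a))"
    if C: "orthonormal_basis_of S C" and v: "v \<in> S" for v C
    using arg_cong[OF orthonormal_basis_of_expand[OF C v], of "\<lambda>x. x \<bullet> a"]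
    by (simp add: inner_sum_left)
  have sub: "B \<subseteq> S" "C \<subseteq> S" using B C by (simp_all add: orthonormal_basis_of_def)
  have "(\<Sum>v\<in>B. (v \<bullet> a)\<^sup>2) = (\<Sum>v\<in>B. \<Sum>w\<in>C. (v \<bullet> a) * ((v \<bullet> w) * (w \<bullet> a)))"
    unfolding power2_eq_square sum_distrib_left[symmetric]
    by (intro sum.cong refl arg_cong2[where f="(*)"] expand[OF C]) (use sub in blast)
  also have "\<dots> = (\<Sum>w\<in>C. \<Sum>v\<in>B. (w \<bullet> a) * ((w \<bullet> v) * (v \<bullet> a)))"
    by (subst sum.swap) (simp add: inner_commute mult_ac)
  also have "\<dots> = (\<Sum>w\<in>C. (w \<bullet> a)\<^sup>2)"
    unfolding power2_eq_square sum_distrib_left[symmetric]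
    by (intro sum.cong refl arg_cong2[where f="(*)"] expand[OF B, symmetric]) (use sub in blast)
  finally show ?thesis .
qed

text \<open>Applied to coordinate vectors, this keeps the exponents of the scales at most 1, as
  Jensen's inequality requires.\<close>

lemma orthonormal_basis_of_Bessel:
  assumes B: "orthonormal_basis_of S B"
  shows "(\<Sum>v\<in>B. (v \<bullet> a)\<^sup>2) \<le> (norm a)\<^sup>2"
proof -
  define y where "y = (\<Sum>v\<in>B. (a \<bullet> v) *\<^sub>R v)"
  have y: "y \<in> S" unfolding y_def by (rule orthonormal_basis_of_sum_mem[OF B])
  have yv: "y \<bullet> v = a \<bullet> v" if "v \<in> B" for v
    unfolding y_def using orthonormal_basis_of_coord[OF B that] .
  have ya: "y \<bullet> a = (\<Sum>v\<in>B. (v \<bullet> a)\<^sup>2)"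
    unfolding y_def inner_sum_left by (simp add: power2_eq_square inner_commute)
  have "(norm y)\<^sup>2 = (\<Sum>v\<in>B. (v \<bullet> a)\<^sup>2)"
    using orthonormal_basis_of_norm[OF B y] yv by (simp add: inner_commute)
  moreover have "0 \<le> (norm (a - y))\<^sup>2" by simp
  ultimately show ?thesis using ya
    unfolding power2_norm_eq_inner by (simp add: inner_diff_left inner_diff_right inner_commute)
qed

section \<open>Upper bound for the exponential integral over a subspace\<close>

lemma weighted_arith_geom_mean:
  fixes x :: "'i \<Rightarrow> real"
  assumes A: "finite A" and w: "\<And>i. i \<in> A \<Longrightarrow> 0 \<le> w i" "sum w A = 1"
    and x: "\<And>i. i \<in> A \<Longrightarrow> 0 < x i"
  shows "exp (\<Sum>i\<in>A. w i * ln (x i)) \<le> (\<Sum>i\<in>A. w i * x i)"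
proof -
  have ne: "A \<noteq> {}" using w(2) by auto
  have "ln (\<Sum>i\<in>A. w i *\<^sub>R x i) \<ge> (\<Sum>i\<in>A. w i * ln (x i))"
    by (rule concave_on_sum[OF A ne ln_concave w(2)]) (use w x in auto)
  moreover have "(\<Sum>i\<in>A. w i * x i) > 0"
  proof -
    obtain i where i: "i \<in> A" "w i > 0"
      using w by (metis less_eq_real_def sum.neutral zero_neq_one)
    have "0 < w i * x i" using i x by simp
    also have "\<dots> \<le> (\<Sum>i\<in>A. w i * x i)"
      using i A w x by (intro member_le_sum) (auto simp: less_imp_le)
    finally show ?thesis .
  qed
  ultimately show ?thesis by (simp add: ln_ge_iff)
qed

lemma bilinear_weighted_inner:
  fixes d :: "'e::finite \<Rightarrow> real"
  shows "bilinear (\<lambda>x y :: real ^ 'e. \<Sum>i\<in>A. d i * x $ i * y $ i)"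
  unfolding bilinear_def
  by (auto intro!: linearI simp: sum.distrib sum_distrib_left algebra_simps)

lemma sum_UNIV_eq:
  fixes f :: "'e::finite \<Rightarrow> real"
  assumes "\<And>i. i \<notin> A \<Longrightarrow> f i = 0"
  shows "sum f UNIV = sum f A"
  using assms by (intro sum.mono_neutral_right) auto

lemma norm_vec_sq: "(norm (x :: real ^ 'e::finite))\<^sup>2 = (\<Sum>i\<in>UNIV. (x $ i)\<^sup>2)"
  unfolding power2_norm_eq_inner inner_vec_def by (simp add: power2_eq_square)

text \<open>The Gaussian case of the geometric Brascamp-Lieb inequality. In a diagonalizing basis
  \<open>C\<close> the integral is the product of the \<open>sqrt (2 * pi / q v v)\<close>, and
  \<open>q v v\<close> is the mean of the numbers \<open>1 / (r i)\<^sup>2\<close> with the weights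
  \<open>(v $ i)\<^sup>2\<close>, hence at least their geometric mean. The resulting exponents do
  not depend on the basis, so they can be stated in terms of \<open>B\<close>, which is fixed while
  \<open>C\<close> varies with \<open>r\<close>.\<close>

lemma gaussian_section_le:
  fixes S :: "(real ^ 'e::finite) set"
  assumes S: "subspace S" "\<And>x i. x \<in> S \<Longrightarrow> i \<notin> A \<Longrightarrow> x $ i = 0"
    and B: "orthonormal_basis_of S B" and r: "\<And>i. i \<in> A \<Longrightarrow> 0 < r i"
  shows "basis_integral B (\<lambda>x. ennreal (exp (- (\<Sum>i\<in>A. (x $ i)\<^sup>2 / (2 * (r i)\<^sup>2))))) \<le>
    ennreal (sqrt (2 * pi) ^ dim S * (\<Prod>i\<in>A. r i powr (\<Sum>v\<in>B. (v $ i)\<^sup>2)))"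
proof -
  define q where "q x y = (\<Sum>i\<in>A. 1 / (r i)\<^sup>2 * x $ i * y $ i)" for x y :: "real ^ 'e"
  have q: "bilinear q" unfolding q_def by (rule bilinear_weighted_inner)
  have sym: "q x y = q y x" for x y unfolding q_def by (simp add: mult_ac)
  obtain C where C: "orthonormal_basis_of S C"
    and diag: "\<And>v w. v \<in> C \<Longrightarrow> w \<in> C \<Longrightarrow> v \<noteq> w \<Longrightarrow> q v w = 0"
    using diagonalizing_basis[OF q sym S(1)] by blast
  have CS: "v \<in> S" "norm v = 1" if "v \<in> C" for v
    using C that by (auto simp: orthonormal_basis_of_def)
  have lam: "exp (\<Sum>i\<in>A. - 2 * (v $ i)\<^sup>2 * ln (r i)) \<le> q v v" if v: "v \<in> C" for v
  proof -
    have "(\<Sum>i\<in>A. (v $ i)\<^sup>2) = (norm v)\<^sup>2"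
      unfolding norm_vec_sq using S(2)[OF CS(1)[OF v]] by (intro sum_UNIV_eq[symmetric]) simp
    then have one: "(\<Sum>i\<in>A. (v $ i)\<^sup>2) = 1" using CS(2)[OF v] by simp
    have "exp (\<Sum>i\<in>A. (v $ i)\<^sup>2 * ln (1 / (r i)\<^sup>2)) \<le> (\<Sum>i\<in>A. (v $ i)\<^sup>2 * (1 / (r i)\<^sup>2))"
      using one by (intro weighted_arith_geom_mean) (auto dest: r)
    also have "\<dots> = q v v" unfolding q_def by (simp add: power2_eq_square mult_ac)
    also have "(\<Sum>i\<in>A. (v $ i)\<^sup>2 * ln (1 / (r i)\<^sup>2)) = (\<Sum>i\<in>A. - 2 * (v $ i)\<^sup>2 * ln (r i))"
      using r by (intro sum.cong) (auto simp: ln_div ln_realpow)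
    finally show ?thesis .
  qed
  then have lam_pos: "q v v > 0" if "v \<in> C" for v
    using that less_le_trans[OF exp_gt_zero] by blast
  have "basis_integral B (\<lambda>x. ennreal (exp (- (\<Sum>i\<in>A. (x $ i)\<^sup>2 / (2 * (r i)\<^sup>2))))) =
      basis_integral C (\<lambda>x. ennreal (exp (- (\<Sum>i\<in>A. (x $ i)\<^sup>2 / (2 * (r i)\<^sup>2)))))"
    by (rule basis_integral_unique[OF B C]) measurable
  also have "\<dots> = basis_integral C (\<lambda>x. ennreal (exp (- ((\<Sum>v\<in>C. q v v * (x \<bullet> v)\<^sup>2) / 2))))"
  proof (rule basis_integral_cong[OF C])
    fix x assume x: "x \<in> S"
    have "(\<Sum>v\<in>C. q v v * (x \<bullet> v)\<^sup>2) = q x x"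
      using quadratic_form_diagonal[OF q C _ x] diag by simp
    moreover have "(\<Sum>i\<in>A. (x $ i)\<^sup>2 / (2 * (r i)\<^sup>2)) = q x x / 2"
      unfolding q_def by (simp add: sum_divide_distrib power2_eq_square mult_ac)
    ultimately show "ennreal (exp (- (\<Sum>i\<in>A. (x $ i)\<^sup>2 / (2 * (r i)\<^sup>2)))) =
        ennreal (exp (- ((\<Sum>v\<in>C. q v v * (x \<bullet> v)\<^sup>2) / 2)))" by simp
  qed
  also have "\<dots> = ennreal (\<Prod>v\<in>C. sqrt (2 * pi / q v v))"
    by (rule basis_integral_gaussian[OF C lam_pos])
  also have "\<dots> \<le> ennreal (\<Prod>v\<in>C. sqrt (2 * pi) * exp (\<Sum>i\<in>A. (v $ i)\<^sup>2 * ln (r i)))"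
  proof (intro ennreal_leI prod_mono conjI)
    fix v assume v: "v \<in> C"
    show "0 \<le> sqrt (2 * pi / q v v)" using lam_pos[OF v] by simp
    let ?E = "exp (\<Sum>i\<in>A. (v $ i)\<^sup>2 * ln (r i))"
    have "exp (\<Sum>i\<in>A. - 2 * (v $ i)\<^sup>2 * ln (r i)) = exp (- 2 * (\<Sum>i\<in>A. (v $ i)\<^sup>2 * ln (r i)))"
      by (simp add: sum_distrib_left mult.assoc)
    also have "\<dots> = 1 / ?E\<^sup>2"
      by (simp add: exp_minus exp_double divide_inverse)
    finally have "1 / ?E\<^sup>2 \<le> q v v" using lam[OF v] by simp
    then have "1 \<le> q v v * ?E\<^sup>2" by (simp add: divide_le_eq)
    then have "2 * pi / q v v \<le> 2 * pi * ?E\<^sup>2"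
      using lam_pos[OF v] by (simp add: divide_le_eq mult_ac)
    then have "sqrt (2 * pi / q v v) \<le> sqrt (2 * pi * ?E\<^sup>2)" by (rule real_sqrt_le_mono)
    also have "\<dots> = sqrt (2 * pi) * ?E" by (simp add: real_sqrt_mult)
    finally show "sqrt (2 * pi / q v v) \<le> sqrt (2 * pi) * ?E" .
  qed
  also have "(\<Prod>v\<in>C. sqrt (2 * pi) * exp (\<Sum>i\<in>A. (v $ i)\<^sup>2 * ln (r i))) =
      sqrt (2 * pi) ^ dim S * (\<Prod>i\<in>A. r i powr (\<Sum>v\<in>B. (v $ i)\<^sup>2))"
  proof -
    have c: "(\<Sum>v\<in>C. (v $ i)\<^sup>2) = (\<Sum>v\<in>B. (v $ i)\<^sup>2)" for i
      using orthonormal_basis_of_sum_inner_sq[OF C B, of "axis i 1"] by (simp add: inner_axis)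
    have "(\<Prod>v\<in>C. exp (\<Sum>i\<in>A. (v $ i)\<^sup>2 * ln (r i))) = exp (\<Sum>v\<in>C. \<Sum>i\<in>A. (v $ i)\<^sup>2 * ln (r i))"
      by (rule exp_sum[symmetric]) (rule orthonormal_basis_of_finite[OF C])
    also have "(\<Sum>v\<in>C. \<Sum>i\<in>A. (v $ i)\<^sup>2 * ln (r i)) = (\<Sum>i\<in>A. (\<Sum>v\<in>B. (v $ i)\<^sup>2) * ln (r i))"
      by (subst sum.swap) (simp add: c flip: sum_distrib_right)
    also have "exp \<dots> = (\<Prod>i\<in>A. exp ((\<Sum>v\<in>B. (v $ i)\<^sup>2) * ln (r i)))"
      by (rule exp_sum) simp
    also have "\<dots> = (\<Prod>i\<in>A. r i powr (\<Sum>v\<in>B. (v $ i)\<^sup>2))"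
      by (intro prod.cong) (auto simp: powr_def dest: r)
    finally show ?thesis by (simp add: prod.distrib orthonormal_basis_of_card[OF C])
  qed
  finally show ?thesis .
qed

lemma laplace_eq_mixture:
  fixes x :: "real ^ 'e::finite"
  shows "ennreal (exp (- (\<Sum>i\<in>A. \<bar>x $ i\<bar>))) =
    (\<integral>\<^sup>+ r. ennreal (exp (- (\<Sum>i\<in>A. (x $ i)\<^sup>2 / (2 * (r i)\<^sup>2)))) \<partial>(\<Pi>\<^sub>M i \<in> A. half_normal))"
proof -
  have "(\<integral>\<^sup>+ r. ennreal (exp (- (\<Sum>i\<in>A. (x $ i)\<^sup>2 / (2 * (r i)\<^sup>2)))) \<partial>(\<Pi>\<^sub>M i \<in> A. half_normal)) =
      (\<integral>\<^sup>+ r. (\<Prod>i\<in>A. ennreal (exp (- ((x $ i)\<^sup>2 / (2 * (r i)\<^sup>2))))) \<partial>(\<Pi>\<^sub>M i \<in> A. half_normal))"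
    by (simp add: prod_ennreal flip: exp_sum sum_negf)
  also have "\<dots> = (\<Prod>i\<in>A. ennreal (exp (- \<bar>x $ i\<bar>)))"
    by (subst half_normal_PiM.product_nn_integral_prod) (simp_all add: nn_integral_half_normal_laplace)
  also have "\<dots> = ennreal (exp (- (\<Sum>i\<in>A. \<bar>x $ i\<bar>)))"
    by (simp add: prod_ennreal flip: exp_sum sum_negf)
  finally show ?thesis by (rule sym)
qed

text \<open>The scales are independent, so the average of the Gaussian bounds factors over the
  coordinates, and Jensen's inequality replaces each scale by its mean \<open>sqrt (2 / pi)\<close>.
  The exponents \<open>c i\<close> add up to the trace of the projection, that is
  \<open>dim S\<close>; each dimension contributes
  \<open>sqrt (2 * pi) * sqrt (2 / pi) = 2\<close>.\<close>

lemma laplace_section_le: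
  fixes S :: "(real ^ 'e::finite) set"
  assumes S: "subspace S" "\<And>x i. x \<in> S \<Longrightarrow> i \<notin> A \<Longrightarrow> x $ i = 0"
    and B: "orthonormal_basis_of S B"
  shows "basis_integral B (\<lambda>x. ennreal (exp (- (\<Sum>i\<in>A. \<bar>x $ i\<bar>)))) \<le> 2 ^ dim S"
proof -
  let ?H = "\<Pi>\<^sub>M i \<in> A. half_normal"
  define c where "c i = (\<Sum>v\<in>B. (v $ i)\<^sup>2)" for i
  have c: "0 \<le> c i" "c i \<le> 1" for i
    using orthonormal_basis_of_Bessel[OF B, of "axis i 1"] unfolding c_def
    by (auto simp: inner_axis intro: sum_nonneg)
  have BS: "v \<in> S" "norm v = 1" if "v \<in> B" for v
    using B that by (auto simp: orthonormal_basis_of_def)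
  have csum: "(\<Sum>i\<in>A. c i) = dim S"
  proof -
    have "(\<Sum>i\<in>A. c i) = (\<Sum>v\<in>B. \<Sum>i\<in>A. (v $ i)\<^sup>2)" unfolding c_def by (rule sum.swap)
    also have "\<dots> = (\<Sum>v\<in>B. (norm v)\<^sup>2)"
      unfolding norm_vec_sq using S(2)[OF BS(1)] by (intro sum.cong refl sum_UNIV_eq[symmetric]) simp
    also have "\<dots> = (\<Sum>v\<in>B. 1)" using BS(2) by (intro sum.cong) simp_all
    finally show ?thesis by (simp add: orthonormal_basis_of_card[OF B])
  qed
  let ?m = "sqrt (2 / pi)"
  have "basis_integral B (\<lambda>x. ennreal (exp (- (\<Sum>i\<in>A. \<bar>x $ i\<bar>)))) =
      (\<integral>\<^sup>+ r. basis_integral B (\<lambda>x. ennreal (exp (- (\<Sum>i\<in>A. (x $ i)\<^sup>2 / (2 * (r i)\<^sup>2))))) \<partial>?H)"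
    unfolding laplace_eq_mixture
    by (rule basis_integral_nn_integral_swap[OF orthonormal_basis_of_finite[OF B]
          half_normal_PiM.sigma_finite]) (simp, measurable)
  also have "\<dots> \<le> (\<integral>\<^sup>+ r. ennreal (sqrt (2 * pi) ^ dim S) * (\<Prod>i\<in>A. ennreal (r i powr c i)) \<partial>?H)"
  proof (rule nn_integral_mono_AE, use AE_PiM_half_normal_pos[OF finite[of A]] in eventually_elim)
    fix r :: "'e \<Rightarrow> real" assume "\<forall>i\<in>A. 0 < r i"
    then show "basis_integral B (\<lambda>x. ennreal (exp (- (\<Sum>i\<in>A. (x $ i)\<^sup>2 / (2 * (r i)\<^sup>2))))) \<le>
        ennreal (sqrt (2 * pi) ^ dim S) * (\<Prod>i\<in>A. ennreal (r i powr c i))"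
      using gaussian_section_le[OF S B, where r = r]
      by (simp add: c_def prod_ennreal ennreal_mult')
  qed
  also have "\<dots> = ennreal (sqrt (2 * pi) ^ dim S) * (\<Prod>i\<in>A. \<integral>\<^sup>+ r. ennreal (r powr c i) \<partial>half_normal)"
    by (subst nn_integral_cmult, measurable)
      (subst half_normal_PiM.product_nn_integral_prod, simp_all)
  also have "\<dots> \<le> ennreal (sqrt (2 * pi) ^ dim S) * (\<Prod>i\<in>A. ennreal (?m powr c i))"
    by (intro mult_left_mono prod_mono_ennreal nn_integral_half_normal_powr c) simp
  also have "(\<Prod>i\<in>A. ennreal (?m powr c i)) = ennreal (?m ^ dim S)"
    by (simp add: prod_ennreal csum powr_realpow flip: powr_sum)
  also have "ennreal (sqrt (2 * pi) ^ dim S) * ennreal (?m ^ dim S) = ennreal ((sqrt (2 * pi) * ?m) ^ dim S)"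
    by (simp add: power_mult_distrib flip: ennreal_mult')
  also have "sqrt (2 * pi) * ?m = 2" by (simp flip: real_sqrt_mult)
  finally show ?thesis by (simp flip: ennreal_power)
qed

section \<open>Lower bound by comparison with one Gaussian\<close>

lemma laplace_section_ge_gaussian:
  fixes S :: "(real ^ 'e::finite) set"
  assumes S: "\<And>x i. x \<in> S \<Longrightarrow> i \<notin> A \<Longrightarrow> x $ i = 0"
    and B: "orthonormal_basis_of S B" and b: "dim S \<ge> 1" "2 * dim S \<le> card A"
  shows "ennreal (2 ^ dim S * (real (dim S) / card A) ^ dim S) \<le>
    basis_integral B (\<lambda>x. ennreal (exp (- (\<Sum>i\<in>A. \<bar>x $ i\<bar>))))"
proof -
  let ?b = "dim S" and ?n = "real (card A)"
  \<comment> \<open>The comparison in \<open>pt\<close> is an equality at \<bar>t\<bar> = s. Among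
    all positive \<open>s\<close>, this one maximizes
    \<open>exp (- n s / 2) * (2 \<pi> s)^(b / 2)\<close>, the value of the resulting
    integral.\<close>
  define s where "s = ?b / ?n"
  have s: "0 < s" "s \<le> 1 / 2" "?n * s = ?b" using b by (auto simp: s_def field_simps)
  have pt: "\<bar>t\<bar> \<le> t\<^sup>2 / (2 * s) + s / 2" for t :: real
  proof -
    have "0 \<le> (\<bar>t\<bar> - s)\<^sup>2" by simp
    then have "2 * (s * \<bar>t\<bar>) \<le> t\<^sup>2 + s * s"
      unfolding power2_diff by (simp add: power2_eq_square[of s] mult_ac)
    then show ?thesis using s(1) by (simp add: field_simps)
  qed
  have "ennreal (2 ^ ?b * s ^ ?b) \<le> ennreal (exp (- (?b / 2)) * sqrt (2 * pi / (1 / s)) ^ ?b)"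
  proof (rule ennreal_leI)
    \<comment> \<open>Squared, this is \<open>2 e s \<le> \<pi>\<close>, which follows from
      \<open>s \<le> 1 / 2\<close> and \<open>e \<le> \<pi>\<close>; here the number of edges has to
      be at least twice the dimension.\<close>
    have "2 * s \<le> exp (- (1 / 2)) * sqrt (2 * pi * s)"
    proof (rule power2_le_imp_le)
      have "exp 1 * (4 * s\<^sup>2) \<le> pi * (2 * s)"
      proof -
        have "exp 1 \<le> pi" using e_less_272 pi_gt3 by linarith
        moreover have "4 * s\<^sup>2 \<le> 2 * s"
          using mult_left_mono[OF s(2), of s] s(1) by (simp add: power2_eq_square)
        ultimately show ?thesis by (rule mult_mono) simp_all
      qed
      then have "4 * s\<^sup>2 \<le> exp (- 1) * (2 * pi * s)"
        by (simp add: exp_minus field_simps)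
      also have "\<dots> = (exp (- (1 / 2)) * sqrt (2 * pi * s))\<^sup>2"
        using s by (simp add: power_mult_distrib flip: exp_double)
      finally show "(2 * s)\<^sup>2 \<le> (exp (- (1 / 2)) * sqrt (2 * pi * s))\<^sup>2" by (simp add: power_mult_distrib)
    qed (use s in simp)
    then have "(2 * s) ^ ?b \<le> (exp (- (1 / 2)) * sqrt (2 * pi * s)) ^ ?b"
      using s by (intro power_mono) auto
    also have "\<dots> = exp (- (?b / 2)) * sqrt (2 * pi / (1 / s)) ^ ?b"
      by (simp add: power_mult_distrib flip: exp_of_nat_mult)
    finally show "2 ^ ?b * s ^ ?b \<le> exp (- (?b / 2)) * sqrt (2 * pi / (1 / s)) ^ ?b"
      by (simp add: power_mult_distrib)
  qed
  also have "\<dots> = ennreal (exp (- (?b / 2))) * basis_integral B (\<lambda>x. ennreal (exp (- (1 / s * (norm x)\<^sup>2 / 2))))"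
    using basis_integral_std_gaussian[OF B, of "1 / s"] s(1) by (simp add: ennreal_mult')
  also have "\<dots> = basis_integral B (\<lambda>x. ennreal (exp (- (?b / 2))) * ennreal (exp (- (1 / s * (norm x)\<^sup>2 / 2))))"
    by (rule basis_integral_cmult[symmetric]) measurable
  also have "\<dots> \<le> basis_integral B (\<lambda>x. ennreal (exp (- (\<Sum>i\<in>A. \<bar>x $ i\<bar>))))"
  proof (rule basis_integral_mono[OF B])
    fix x assume x: "x \<in> S"
    have "(\<Sum>i\<in>A. \<bar>x $ i\<bar>) \<le> (\<Sum>i\<in>A. (x $ i)\<^sup>2 / (2 * s) + s / 2)" by (intro sum_mono pt)
    also have "\<dots> = (\<Sum>i\<in>A. (x $ i)\<^sup>2) / (2 * s) + ?n * s / 2"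
      by (simp add: sum.distrib sum_divide_distrib)
    also have "(\<Sum>i\<in>A. (x $ i)\<^sup>2) = (norm x)\<^sup>2"
      unfolding norm_vec_sq using S[OF x] by (intro sum_UNIV_eq[symmetric]) simp
    finally have "- (?b / 2) + - (1 / s * (norm x)\<^sup>2 / 2) \<le> - (\<Sum>i\<in>A. \<bar>x $ i\<bar>)"
      using s(3) by simp
    then show "ennreal (exp (- (?b / 2))) * ennreal (exp (- (1 / s * (norm x)\<^sup>2 / 2))) \<le>
        ennreal (exp (- (\<Sum>i\<in>A. \<bar>x $ i\<bar>)))"
      by (simp only: ennreal_mult'[symmetric] exp_ge_zero mult_exp_exp) (intro ennreal_leI, simp)
  qed
  finally show ?thesis unfolding s_def .
qed

section \<open>Lower bound by duality with the orthogonal complement\<close>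

lemma orthonormal_basis_of_axis:
  "orthonormal_basis_of (UNIV :: (real ^ 'e::finite) set) (range (\<lambda>i. axis i 1))"
proof -
  have B: "range (\<lambda>i. axis i 1) = (Basis :: (real ^ 'e) set)"
    by (auto simp: Basis_vec_def)
  show ?thesis unfolding B orthonormal_basis_of_def
    by (auto simp: pairwise_def orthogonal_def inner_Basis)
qed

lemma orthogonal_complement_basis:
  assumes S: "subspace S" and B: "orthonormal_basis_of S B"
    and D: "orthonormal_basis_of {w. \<forall>x\<in>S. x \<bullet> w = 0} D"
  shows "orthonormal_basis_of UNIV (B \<union> D)" "B \<inter> D = {}"
proof -
  let ?W = "{w. \<forall>x\<in>S. x \<bullet> w = 0}"
  have sub: "B \<subseteq> S" "D \<subseteq> ?W" "span B = S" "span D = ?W"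
    and pw: "pairwise orthogonal B" "pairwise orthogonal D"
    and n: "\<forall>v\<in>B. norm v = 1" "\<forall>v\<in>D. norm v = 1"
    using B D by (simp_all add: orthonormal_basis_of_def)
  have o: "v \<bullet> w = 0" "w \<bullet> v = 0" if "v \<in> B" "w \<in> D" for v w
    using that sub(1,2) by (auto simp: inner_commute[of w])
  show "B \<inter> D = {}"
  proof (rule equals0I)
    fix v assume "v \<in> B \<inter> D"
    then have "v \<bullet> v = 0" "norm v = 1" using o n(1) by simp_all
    then show False by simp
  qed
  have "x \<in> span (B \<union> D)" for x
  proof -
    define y where "y = (\<Sum>v\<in>B. (x \<bullet> v) *\<^sub>R v)"
    have "y \<in> S" unfolding y_def by (rule orthonormal_basis_of_sum_mem[OF B])
    have "u \<bullet> (x - y) = 0" if u: "u \<in> S" for u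
    proof -
      have uv: "u \<bullet> x = (\<Sum>v\<in>B. (u \<bullet> v) * (v \<bullet> x))"
        using arg_cong[OF orthonormal_basis_of_expand[OF B u], of "\<lambda>z. z \<bullet> x"] by (simp add: inner_sum_left)
      have "u \<bullet> y = (\<Sum>v\<in>B. (x \<bullet> v) * (u \<bullet> v))" unfolding y_def by (simp add: inner_sum_right)
      then show ?thesis unfolding inner_diff_right uv by (simp add: inner_commute[of x] mult.commute)
    qed
    then have "x - y \<in> ?W" by simp
    then have "y \<in> span (B \<union> D)" "x - y \<in> span (B \<union> D)"
      using \<open>y \<in> S\<close> sub(3,4) span_mono[of B "B \<union> D"] span_mono[of D "B \<union> D"] by blast+
    from span_add[OF this] show ?thesis by simp
  qed
  moreover have "pairwise orthogonal (B \<union> D)"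
  proof (rule pairwiseI)
    fix v w assume "v \<in> B \<union> D" "w \<in> B \<union> D" "v \<noteq> w"
    then show "orthogonal v w"
      using pw[THEN pairwiseD, of v w] o[of v w] o[of w v] by (auto simp: orthogonal_def)
  qed
  ultimately show "orthonormal_basis_of UNIV (B \<union> D)"
    using n by (auto simp: orthonormal_basis_of_def)
qed

lemma basis_integral_union:
  assumes B: "finite B" "finite D" "B \<inter> D = {}" and [measurable]: "f \<in> borel_measurable borel"
  shows "basis_integral (B \<union> D) f = basis_integral D (\<lambda>w. basis_integral B (\<lambda>x. f (x + w)))"
proof -
  have "basis_integral (D \<union> B) f = (\<integral>\<^sup>+ s. \<integral>\<^sup>+ t. f (\<Sum>v\<in>D \<union> B. merge D B (s, t) v *\<^sub>R v)
      \<partial>(\<Pi>\<^sub>M v \<in> B. lborel) \<partial>(\<Pi>\<^sub>M v \<in> D. lborel))"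
    unfolding basis_integral_def
    by (rule lborel_PiM.product_nn_integral_fold) (use B in auto)
  also have "\<dots> = basis_integral D (\<lambda>w. basis_integral B (\<lambda>x. f (x + w)))"
    unfolding basis_integral_def
  proof (intro nn_integral_cong arg_cong[where f=f])
    fix s t :: "'a \<Rightarrow> real"
    have "(\<Sum>v\<in>D \<union> B. merge D B (s, t) v *\<^sub>R v) =
        (\<Sum>v\<in>D. merge D B (s, t) v *\<^sub>R v) + (\<Sum>v\<in>B. merge D B (s, t) v *\<^sub>R v)"
      using B by (intro sum.union_disjoint) auto
    also have "(\<Sum>v\<in>D. merge D B (s, t) v *\<^sub>R v) = (\<Sum>v\<in>D. s v *\<^sub>R v)"
      by (intro sum.cong) (auto simp: merge_def)
    also have "(\<Sum>v\<in>B. merge D B (s, t) v *\<^sub>R v) = (\<Sum>v\<in>B. t v *\<^sub>R v)"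
      using B(3) by (intro sum.cong) (auto simp: merge_def)
    finally show "(\<Sum>v\<in>D \<union> B. merge D B (s, t) v *\<^sub>R v) = (\<Sum>v\<in>B. t v *\<^sub>R v) + (\<Sum>v\<in>D. s v *\<^sub>R v)"
      by simp
  qed
  finally show ?thesis by (simp add: Un_commute)
qed

text \<open>Up to constants, the two integrals are the inverse square roots of the determinants of
  complementary diagonal blocks of a positive definite matrix and of its inverse; the inequality is
  in fact an equality.\<close>

lemma gaussian_complement_le:
  fixes S :: "(real ^ 'e::finite) set" and r :: "'e \<Rightarrow> real"
  defines "W \<equiv> {w. \<forall>x\<in>S. x \<bullet> w = 0}"
  assumes S: "subspace S" and B: "orthonormal_basis_of S B" and D: "orthonormal_basis_of W D"
    and r: "\<And>i. 0 < r i"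
  shows "ennreal (sqrt (2 * pi) ^ CARD('e) * (\<Prod>i\<in>UNIV. r i)) *
      basis_integral D (\<lambda>z. ennreal (exp (- (\<Sum>i\<in>UNIV. (r i)\<^sup>2 * (z $ i)\<^sup>2 / 2)))) \<le>
    ennreal ((2 * pi) ^ dim W) *
      basis_integral B (\<lambda>x. ennreal (exp (- (\<Sum>i\<in>UNIV. (x $ i)\<^sup>2 / (2 * (r i)\<^sup>2)))))"
proof -
  define q where "q x y = (\<Sum>i\<in>UNIV. 1 / (r i)\<^sup>2 * x $ i * y $ i)" for x y :: "real ^ 'e"
  define Q where "Q x y = (\<Sum>i\<in>UNIV. (r i)\<^sup>2 * x $ i * y $ i)" for x y :: "real ^ 'e"
  have q: "bilinear q" and Q: "bilinear Q" unfolding q_def Q_def by (rule bilinear_weighted_inner)+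
  have qs: "q x y = q y x" and Qs: "Q x y = Q y x" for x y
    unfolding q_def Q_def by (simp_all add: mult_ac)
  have W: "subspace W" unfolding W_def by (auto simp: subspace_def inner_add_right)
  have qpos: "q x x > 0" and Qpos: "Q x x > 0" if "x \<noteq> 0" for x
  proof -
    obtain i where i: "x $ i \<noteq> 0" using \<open>x \<noteq> 0\<close> by (auto simp: vec_eq_iff)
    have "1 / (r i)\<^sup>2 * x $ i * x $ i = (x $ i / r i)\<^sup>2" "(r i)\<^sup>2 * x $ i * x $ i = (r i * x $ i)\<^sup>2" for i
      by (simp_all add: power_divide power_mult_distrib power2_eq_square)
    then have e: "q x x = (\<Sum>i\<in>UNIV. (x $ i / r i)\<^sup>2)" "Q x x = (\<Sum>i\<in>UNIV. (r i * x $ i)\<^sup>2)"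
      unfolding q_def Q_def by simp_all
    have "x $ i / r i \<noteq> 0" "r i * x $ i \<noteq> 0" using i r[of i] by simp_all
    then show "q x x > 0" "Q x x > 0" unfolding e by (intro sum_pos2[of _ i]; simp)+
  qed
  obtain B' where B': "orthonormal_basis_of S B'"
    and qd: "\<And>v w. v \<in> B' \<Longrightarrow> w \<in> B' \<Longrightarrow> v \<noteq> w \<Longrightarrow> q v w = 0"
    using diagonalizing_basis[OF q qs S] by blast
  obtain D' where D': "orthonormal_basis_of W D'"
    and Qd: "\<And>v w. v \<in> D' \<Longrightarrow> w \<in> D' \<Longrightarrow> v \<noteq> w \<Longrightarrow> Q v w = 0"
    using diagonalizing_basis[OF Q Qs W] by blast
  have nz: "v \<noteq> 0" if "v \<in> B' \<or> v \<in> D'" for v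
    using that B' D' by (auto simp: orthonormal_basis_of_def)
  define lam where "lam v = q v v" for v
  define kap where "kap v = Q v v" for v
  have lam: "lam v > 0" if "v \<in> B'" for v using qpos nz that by (simp add: lam_def)
  have kap: "kap v > 0" if "v \<in> D'" for v using Qpos nz that by (simp add: kap_def)
  note fin = orthonormal_basis_of_finite[OF B'] orthonormal_basis_of_finite[OF D']
  define GB where "GB = basis_integral B' (\<lambda>x. ennreal (exp (- (q x x / 2))))"
  have qm[measurable]: "(\<lambda>x. q x x) \<in> borel_measurable borel" unfolding q_def by measurable
  have Qm[measurable]: "(\<lambda>x. Q x x) \<in> borel_measurable borel" unfolding Q_def by measurable
  have eB: "basis_integral B (\<lambda>x. ennreal (exp (- (\<Sum>i\<in>UNIV. (x $ i)\<^sup>2 / (2 * (r i)\<^sup>2))))) = GB"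
  proof -
    have "(\<Sum>i\<in>UNIV. (x $ i)\<^sup>2 / (2 * (r i)\<^sup>2)) = q x x / 2" for x
      unfolding q_def by (simp add: sum_divide_distrib power2_eq_square mult_ac)
    then show ?thesis unfolding GB_def by (simp only:) (rule basis_integral_unique[OF B B'], measurable)
  qed
  have eD: "basis_integral D (\<lambda>z. ennreal (exp (- (\<Sum>i\<in>UNIV. (r i)\<^sup>2 * (z $ i)\<^sup>2 / 2)))) =
      ennreal (\<Prod>v\<in>D'. sqrt (2 * pi / kap v))"
  proof -
    have "(\<Sum>i\<in>UNIV. (r i)\<^sup>2 * (z $ i)\<^sup>2 / 2) = Q z z / 2" for z
      unfolding Q_def by (simp add: sum_divide_distrib power2_eq_square mult_ac)
    then have "basis_integral D (\<lambda>z. ennreal (exp (- (\<Sum>i\<in>UNIV. (r i)\<^sup>2 * (z $ i)\<^sup>2 / 2)))) =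
        basis_integral D' (\<lambda>z. ennreal (exp (- (Q z z / 2))))"
      by (simp only:) (rule basis_integral_unique[OF D D'], measurable)
    also have "\<dots> = basis_integral D' (\<lambda>z. ennreal (exp (- ((\<Sum>v\<in>D'. kap v * (z \<bullet> v)\<^sup>2) / 2))))"
      using quadratic_form_diagonal[OF Q D'] Qd by (intro basis_integral_cong[OF D']) (simp add: kap_def)
    also have "\<dots> = ennreal (\<Prod>v\<in>D'. sqrt (2 * pi / kap v))"
      by (rule basis_integral_gaussian[OF D' kap])
    finally show ?thesis .
  qed
  \<comment> \<open>Completing the square: \<open>q (x + w)\<close> equals \<open>q (\<beta> + x)\<close> plus the minimum of \<open>q\<close> on \<open>w + S\<close>, which is
    bounded below by duality, with the test vector \<open>z\<close> in \<open>W\<close>.\<close>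
  have key: "(\<Sum>l\<in>D'. 1 / kap l * (w \<bullet> l)\<^sup>2) + q (\<beta> + x) (\<beta> + x) \<le> q (x + w) (x + w)"
    if x: "x \<in> S" and w: "w \<in> W" and \<beta>: "\<beta> = (\<Sum>v\<in>B'. (q v w / lam v) *\<^sub>R v)" for x w \<beta>
  proof -
    have \<beta>S: "\<beta> \<in> S" unfolding \<beta> by (rule orthonormal_basis_of_sum_mem[OF B'])
    \<comment> \<open>\<open>\<beta>\<close> is the \<open>q\<close>-orthogonal projection of
      \<open>w\<close> to \<open>S\<close>, so \<open>w - \<beta>\<close> is
      \<open>q\<close>-orthogonal to \<open>S\<close>; this completes the square.\<close>
    have qv\<beta>: "q v \<beta> = q v w" if v: "v \<in> B'" for v
    proof -
      have "q v \<beta> = (\<Sum>u\<in>B'. (q u w / lam u) * q v u)"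
        unfolding \<beta> using q linear_sum[of "q v"] by (simp add: bilinear_def linear_sum linear_cmul)
      also have "\<dots> = (\<Sum>u\<in>{v}. (q u w / lam u) * q v u)"
        using v fin qd by (intro sum.mono_neutral_right) auto
      also have "\<dots> = q v w" using lam[OF v] by (simp add: lam_def)
      finally show ?thesis .
    qed
    have qu: "q u \<beta> = q u w" if u: "u \<in> S" for u
    proof -
      have lin: "linear (\<lambda>x. q x y)" for y using q by (simp add: bilinear_def)
      have e: "q u y = (\<Sum>v\<in>B'. (u \<bullet> v) * q v y)" for y
        using arg_cong[OF orthonormal_basis_of_expand[OF B' u], of "\<lambda>x. q x y"]
        by (simp add: linear_sum[OF lin] linear_cmul[OF lin])
      show ?thesis unfolding e using qv\<beta> by simp
    qed
    define y where "y = w - \<beta>"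
    \<comment> \<open>The maximizer of \<open>2 * (w \<bullet> z) - Q z z\<close> on
      \<open>W\<close>, found coordinate by coordinate in the basis \<open>D'\<close>, where
      \<open>Q\<close> is diagonal.\<close>
    define z where "z = (\<Sum>l\<in>D'. ((w \<bullet> l) / kap l) *\<^sub>R l)"
    have zW: "z \<in> W" unfolding z_def by (rule orthonormal_basis_of_sum_mem[OF D'])
    have zl: "z \<bullet> l = (w \<bullet> l) / kap l" if "l \<in> D'" for l
      unfolding z_def by (rule orthonormal_basis_of_coord[OF D' that])
    have "Q z z = (\<Sum>l\<in>D'. kap l * (z \<bullet> l)\<^sup>2)"
      using quadratic_form_diagonal[OF Q D' _ zW] Qd by (simp add: kap_def)
    also have "\<dots> = (\<Sum>l\<in>D'. 1 / kap l * (w \<bullet> l)\<^sup>2)"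
      using kap by (intro sum.cong) (auto simp: zl power_divide power2_eq_square dest: kap)
    finally have Qz: "Q z z = (\<Sum>l\<in>D'. 1 / kap l * (w \<bullet> l)\<^sup>2)" .
    have "\<beta> \<bullet> z = 0" using \<beta>S zW by (simp add: W_def)
    then have "y \<bullet> z = w \<bullet> z" by (simp add: y_def inner_diff_left)
    also have "\<dots> = (\<Sum>l\<in>D'. 1 / kap l * (w \<bullet> l)\<^sup>2)"
      unfolding z_def by (simp add: inner_sum_right power2_eq_square)
    finally have yz: "y \<bullet> z = (\<Sum>l\<in>D'. 1 / kap l * (w \<bullet> l)\<^sup>2)" .
    \<comment> \<open>The Fenchel inequality for the mutually inverse diagonal forms
      \<open>q\<close> and \<open>Q\<close>.\<close>
    have "2 * (y \<bullet> z) - Q z z \<le> q y y"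
    proof -
      have "0 \<le> (\<Sum>i\<in>UNIV. (y $ i / r i - r i * z $ i)\<^sup>2)" by (intro sum_nonneg) simp
      also have "\<dots> = (\<Sum>i\<in>UNIV. 1 / (r i)\<^sup>2 * y $ i * y $ i - 2 * (y $ i * z $ i) + (r i)\<^sup>2 * z $ i * z $ i)"
      proof (intro sum.cong refl)
        fix i
        show "(y $ i / r i - r i * z $ i)\<^sup>2 =
            1 / (r i)\<^sup>2 * y $ i * y $ i - 2 * (y $ i * z $ i) + (r i)\<^sup>2 * z $ i * z $ i"
          unfolding power2_diff using r[of i] by (simp add: power_divide power_mult_distrib) (simp add: power2_eq_square)
      qed
      also have "\<dots> = q y y - 2 * (y \<bullet> z) + Q z z"
        unfolding q_def Q_def inner_vec_def by (simp add: sum.distrib sum_subtractf sum_distrib_left)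
      finally show ?thesis by simp
    qed
    then have "(\<Sum>l\<in>D'. 1 / kap l * (w \<bullet> l)\<^sup>2) \<le> q y y" unfolding yz Qz by simp
    also have "q y y = q w w - q \<beta> \<beta>"
      unfolding y_def bilinear_lsub[OF q] bilinear_rsub[OF q] qs[of w \<beta>] qu[OF \<beta>S, symmetric] by simp
    moreover have "q (x + w) (x + w) - q (\<beta> + x) (\<beta> + x) = q w w - q \<beta> \<beta>"
      unfolding bilinear_ladd[OF q] bilinear_radd[OF q] qs[of w x] qs[of \<beta> x] qu[OF x] by simp
    ultimately show ?thesis by simp
  qed
  \<comment> \<open>The Gaussian integral over the whole space is explicit in the standard
    coordinates; it is then computed again fibre by fibre, along the translates \<open>w + S\<close>
    with \<open>w\<close> in \<open>W\<close>.\<close>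
  have "ennreal (sqrt (2 * pi) ^ CARD('e) * (\<Prod>i\<in>UNIV. r i)) =
      basis_integral (range (\<lambda>i. axis i 1)) (\<lambda>x. ennreal (exp (- (q x x / 2))))"
  proof -
    let ?a = "\<lambda>i :: 'e. axis i 1 :: real ^ 'e"
    have inj: "inj ?a" by (auto simp: inj_def axis_eq_axis)
    define l where "l v = 1 / (r (inv ?a v))\<^sup>2" for v
    have l: "l (?a i) = 1 / (r i)\<^sup>2" for i by (simp add: l_def inv_f_f[OF inj])
    have qx: "(\<Sum>v\<in>range ?a. l v * (x \<bullet> v)\<^sup>2) = q x x" for x
      unfolding q_def by (simp add: sum.reindex inj l inner_axis power2_eq_square)
    have lpos: "0 < l v" if "v \<in> range ?a" for v
      using that
    proof (rule rangeE)
      fix i assume "v = ?a i"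
      then show ?thesis using r[of i] by (simp add: l)
    qed
    have "basis_integral (range ?a) (\<lambda>x. ennreal (exp (- (q x x / 2)))) =
        ennreal (\<Prod>v\<in>range ?a. sqrt (2 * pi / l v))"
      using basis_integral_gaussian[OF orthonormal_basis_of_axis, of l] lpos unfolding qx by blast
    also have "(\<Prod>v\<in>range ?a. sqrt (2 * pi / l v)) = (\<Prod>i\<in>UNIV. sqrt (2 * pi) * r i)"
      using r by (simp add: prod.reindex inj l real_sqrt_mult less_imp_le)
    also have "\<dots> = sqrt (2 * pi) ^ CARD('e) * (\<Prod>i\<in>UNIV. r i)" by (simp add: prod.distrib)
    finally show ?thesis by (rule sym)
  qed
  also have "\<dots> = basis_integral (B' \<union> D') (\<lambda>x. ennreal (exp (- (q x x / 2))))"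
    by (rule basis_integral_unique[OF orthonormal_basis_of_axis
          orthogonal_complement_basis(1)[OF S B' D'[unfolded W_def]]]) measurable
  also have "\<dots> = basis_integral D' (\<lambda>w. basis_integral B' (\<lambda>x. ennreal (exp (- (q (x + w) (x + w) / 2)))))"
    by (rule basis_integral_union[OF fin orthogonal_complement_basis(2)[OF S B' D'[unfolded W_def]]]) measurable
  also have "\<dots> \<le> basis_integral D' (\<lambda>w. GB * ennreal (exp (- ((\<Sum>l\<in>D'. 1 / kap l * (w \<bullet> l)\<^sup>2) / 2))))"
  proof (rule basis_integral_mono[OF D'])
    fix w assume w: "w \<in> W"
    define \<beta> where "\<beta> = (\<Sum>v\<in>B'. (q v w / lam v) *\<^sub>R v)"
    have \<beta>S: "\<beta> \<in> S" unfolding \<beta>_def by (rule orthonormal_basis_of_sum_mem[OF B'])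
    let ?c = "exp (- ((\<Sum>l\<in>D'. 1 / kap l * (w \<bullet> l)\<^sup>2) / 2))"
    have "basis_integral B' (\<lambda>x. ennreal (exp (- (q (x + w) (x + w) / 2)))) \<le>
        basis_integral B' (\<lambda>x. ennreal ?c * ennreal (exp (- (q (\<beta> + x) (\<beta> + x) / 2))))"
    proof (rule basis_integral_mono[OF B'])
      fix x assume "x \<in> S"
      from key[OF this w \<beta>_def]
      have "exp (- (q (x + w) (x + w) / 2)) \<le> ?c * exp (- (q (\<beta> + x) (\<beta> + x) / 2))"
        unfolding mult_exp_exp by simp
      then show "ennreal (exp (- (q (x + w) (x + w) / 2))) \<le> ennreal ?c * ennreal (exp (- (q (\<beta> + x) (\<beta> + x) / 2)))"
        by (simp add: ennreal_leI flip: ennreal_mult')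
    qed
    also have "\<dots> = ennreal ?c * basis_integral B' (\<lambda>x. ennreal (exp (- (q (\<beta> + x) (\<beta> + x) / 2))))"
      by (rule basis_integral_cmult) measurable
    also have "basis_integral B' (\<lambda>x. ennreal (exp (- (q (\<beta> + x) (\<beta> + x) / 2)))) = GB"
      using basis_integral_affine[OF B' _ \<beta>S, of "\<lambda>x. ennreal (exp (- (q x x / 2)))" 1] by (simp add: GB_def)
    finally show "basis_integral B' (\<lambda>x. ennreal (exp (- (q (x + w) (x + w) / 2)))) \<le> GB * ennreal ?c"
      by (simp add: mult.commute)
  qed
  also have "\<dots> = GB * ennreal (\<Prod>v\<in>D'. sqrt (2 * pi / (1 / kap v)))"
    using basis_integral_gaussian[OF D', of "\<lambda>v. 1 / kap v"] kap by (subst basis_integral_cmult) auto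
  finally have *: "ennreal (sqrt (2 * pi) ^ CARD('e) * (\<Prod>i\<in>UNIV. r i)) \<le>
      GB * ennreal (\<Prod>v\<in>D'. sqrt (2 * pi / (1 / kap v)))" .
  \<comment> \<open>The eigenvalues \<open>kap v\<close> disappear: the two factors of
    \<open>v\<close> are \<open>sqrt (2 * pi * kap v)\<close> and
    \<open>sqrt (2 * pi / kap v)\<close>, with product \<open>2 * pi\<close>.\<close>
  have "ennreal (\<Prod>v\<in>D'. sqrt (2 * pi / (1 / kap v))) * ennreal (\<Prod>v\<in>D'. sqrt (2 * pi / kap v)) =
      ennreal ((2 * pi) ^ dim W)"
  proof -
    have "(\<Prod>v\<in>D'. sqrt (2 * pi / (1 / kap v))) * (\<Prod>v\<in>D'. sqrt (2 * pi / kap v)) = (\<Prod>v\<in>D'. 2 * pi)"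
      unfolding prod.distrib[symmetric]
    proof (rule prod.cong)
      fix v assume "v \<in> D'"
      then have "kap v > 0" by (rule kap)
      then have "2 * pi / (1 / kap v) * (2 * pi / kap v) = (2 * pi)\<^sup>2" by (simp add: power2_eq_square)
      then show "sqrt (2 * pi / (1 / kap v)) * sqrt (2 * pi / kap v) = 2 * pi"
        unfolding real_sqrt_mult[symmetric] by (simp only: real_sqrt_abs) simp
    qed simp
    then have "(\<Prod>v\<in>D'. sqrt (2 * pi / (1 / kap v))) * (\<Prod>v\<in>D'. sqrt (2 * pi / kap v)) = (2 * pi) ^ dim W"
      by (simp add: orthonormal_basis_of_card[OF D'])
    moreover have "0 \<le> (\<Prod>v\<in>D'. sqrt (2 * pi / (1 / kap v)))" by (intro prod_nonneg) (auto dest: kap intro: less_imp_le)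
    ultimately show ?thesis by (simp flip: ennreal_mult')
  qed
  then show ?thesis
    unfolding eB eD using mult_right_mono[OF *, of "ennreal (\<Prod>v\<in>D'. sqrt (2 * pi / kap v))"]
    by (simp add: mult_ac)
qed

text \<open>Fourier duality turns an integral over \<open>S\<close> into one of the transform over
  the complement, and the transform of the double exponential is a Cauchy function. Here the duality
  is applied to each Gaussian of the mixture; averaging over the scales then yields the factors
  \<open>1 / (1 + (z $ i)\<^sup>2)\<close>, and their Gaussian minorants have an explicit integral
  over \<open>W\<close>. The number \<open>k\<close> is the codimension of \<open>S\<close> in the
  coordinate space of \<open>A\<close>.\<close>

lemma laplace_section_ge_dual:
  fixes S :: "(real ^ 'e::finite) set"
  assumes S: "subspace S" "\<And>x i. x \<in> S \<Longrightarrow> i \<notin> A \<Longrightarrow> x $ i = 0"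
    and B: "orthonormal_basis_of S B" and k: "card A = dim S + k"
  shows "ennreal (2 ^ dim S) \<le>
    ennreal (sqrt pi ^ k) * basis_integral B (\<lambda>x. ennreal (exp (- (\<Sum>i\<in>A. \<bar>x $ i\<bar>))))"
proof -
  let ?H = "\<Pi>\<^sub>M i \<in> A. half_normal"
  let ?n = "card A" and ?N = "CARD('e)"
  define W where "W = {w. \<forall>x\<in>S. x \<bullet> w = 0}"
  have W: "subspace W" unfolding W_def by (auto simp: subspace_def inner_add_right)
  obtain D where D: "orthonormal_basis_of W D"
    by (rule orthonormal_basis_of_exists[OF W])
  have D': "orthonormal_basis_of {w. \<forall>x\<in>S. x \<bullet> w = 0} D" using D by (simp add: W_def)
  note fin = orthonormal_basis_of_finite[OF B] orthonormal_basis_of_finite[OF D]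
  have dims: "dim S + dim W = ?N"
  proof -
    have "card (B \<union> D) = dim (UNIV :: (real ^ 'e) set)"
      by (rule orthonormal_basis_of_card[OF orthogonal_complement_basis(1)[OF S(1) B D']])
    also have "card (B \<union> D) = card B + card D"
      by (rule card_Un_disjoint[OF fin orthogonal_complement_basis(2)[OF S(1) B D']])
    finally show ?thesis by (simp add: orthonormal_basis_of_card[OF B] orthonormal_basis_of_card[OF D])
  qed
  have "?n \<le> ?N" by (intro card_mono) auto
  \<comment> \<open>The complement \<open>W\<close> is taken in the whole space, so it also contains
    the \<open>m\<close> coordinate axes outside \<open>A\<close>.\<close>
  then obtain m where m: "?N = ?n + m" using le_Suc_ex by blast
  have cA: "card (- A) = m" by (simp add: Compl_eq_Diff_UNIV card_Diff_subset m)
  have w: "dim W = k + m" using dims m k by simp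
  \<comment> \<open>With \<open>sqrt 2\<close> off \<open>A\<close>, the dual Gaussian has the factor \<open>exp (- z\<^sup>2)\<close> in these
    coordinates, the same one that bounds \<open>1 / (1 + z\<^sup>2)\<close> on \<open>A\<close>.\<close>
  define R where "R r i = (if i \<in> A then r i else sqrt 2)" for r :: "'e \<Rightarrow> real" and i
  \<comment> \<open>The part of the constant in \<open>gaussian_complement_le\<close> that does not
    depend on the scales \<open>r\<close>.\<close>
  define c0 where "c0 = sqrt (2 * pi) ^ ?N * sqrt 2 ^ m"
  let ?g = "\<lambda>r x. ennreal (exp (- (\<Sum>i\<in>A. (x $ i)\<^sup>2 / (2 * (r i)\<^sup>2))))"
  let ?h = "\<lambda>(z :: real ^ 'e) r. ennreal (c0 * exp (- (\<Sum>i\<in>- A. (z $ i)\<^sup>2))) *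
      (\<Prod>i\<in>A. ennreal (r i * exp (- ((r i)\<^sup>2 * (z $ i)\<^sup>2 / 2))))"
  have c0: "c0 \<ge> 0" by (simp add: c0_def)
  have dual: "basis_integral D (\<lambda>z. ?h z r) \<le> ennreal ((2 * pi) ^ dim W) * basis_integral B (?g r)"
    if r: "\<forall>i\<in>A. 0 < r i" for r
  proof -
    have R: "0 < R r i" for i using r by (simp add: R_def)
    have eB: "basis_integral B (\<lambda>x. ennreal (exp (- (\<Sum>i\<in>UNIV. (x $ i)\<^sup>2 / (2 * (R r i)\<^sup>2))))) =
        basis_integral B (?g r)"
    proof (rule basis_integral_cong[OF B])
      fix x assume x: "x \<in> S"
      have "(\<Sum>i\<in>UNIV. (x $ i)\<^sup>2 / (2 * (R r i)\<^sup>2)) = (\<Sum>i\<in>A. (x $ i)\<^sup>2 / (2 * (R r i)\<^sup>2))"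
        using S(2)[OF x] by (intro sum_UNIV_eq) simp
      also have "\<dots> = (\<Sum>i\<in>A. (x $ i)\<^sup>2 / (2 * (r i)\<^sup>2))" by (simp add: R_def)
      finally show "ennreal (exp (- (\<Sum>i\<in>UNIV. (x $ i)\<^sup>2 / (2 * (R r i)\<^sup>2)))) = ?g r x" by simp
    qed
    have split: "(\<Prod>i\<in>UNIV. f i) = (\<Prod>i\<in>A. f i) * (\<Prod>i\<in>- A. f i)" for f :: "'e \<Rightarrow> real"
      using prod.union_disjoint[of A "- A" f] by simp
    have pR: "(\<Prod>i\<in>UNIV. R r i) = (\<Prod>i\<in>A. r i) * sqrt 2 ^ m"
      unfolding split by (simp add: R_def cA)
    have ss: "(\<Sum>i\<in>UNIV. (R r i)\<^sup>2 * (z $ i)\<^sup>2 / 2) =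
        (\<Sum>i\<in>A. (r i)\<^sup>2 * (z $ i)\<^sup>2 / 2) + (\<Sum>i\<in>- A. (z $ i)\<^sup>2)" for z
      using sum.union_disjoint[of A "- A" "\<lambda>i. (R r i)\<^sup>2 * (z $ i)\<^sup>2 / 2"] by (simp add: R_def)
    have "basis_integral D (\<lambda>z. ?h z r) = basis_integral D (\<lambda>z.
        ennreal (sqrt (2 * pi) ^ ?N * (\<Prod>i\<in>UNIV. R r i)) *
        ennreal (exp (- (\<Sum>i\<in>UNIV. (R r i)\<^sup>2 * (z $ i)\<^sup>2 / 2))))"
    proof (intro arg_cong[where f = "basis_integral D"] ext)
      fix z :: "real ^ 'e"
      have "(\<Prod>i\<in>A. ennreal (r i * exp (- ((r i)\<^sup>2 * (z $ i)\<^sup>2 / 2)))) =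
          ennreal (\<Prod>i\<in>A. r i * exp (- ((r i)\<^sup>2 * (z $ i)\<^sup>2 / 2)))"
        using r by (intro prod_ennreal) (simp add: less_imp_le)
      also have "(\<Prod>i\<in>A. r i * exp (- ((r i)\<^sup>2 * (z $ i)\<^sup>2 / 2))) =
          (\<Prod>i\<in>A. r i) * exp (- (\<Sum>i\<in>A. (r i)\<^sup>2 * (z $ i)\<^sup>2 / 2))"
        by (simp add: prod.distrib flip: exp_sum sum_negf)
      finally have "?h z r = ennreal (c0 * exp (- (\<Sum>i\<in>- A. (z $ i)\<^sup>2)) *
          ((\<Prod>i\<in>A. r i) * exp (- (\<Sum>i\<in>A. (r i)\<^sup>2 * (z $ i)\<^sup>2 / 2))))"
        using c0 by (simp add: ennreal_mult')
      also have "c0 * exp (- (\<Sum>i\<in>- A. (z $ i)\<^sup>2)) *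
          ((\<Prod>i\<in>A. r i) * exp (- (\<Sum>i\<in>A. (r i)\<^sup>2 * (z $ i)\<^sup>2 / 2))) =
          sqrt (2 * pi) ^ ?N * (\<Prod>i\<in>UNIV. R r i) * exp (- (\<Sum>i\<in>UNIV. (R r i)\<^sup>2 * (z $ i)\<^sup>2 / 2))"
        unfolding ss pR c0_def minus_add_distrib exp_add by (simp only: mult_ac)
      finally show "?h z r = ennreal (sqrt (2 * pi) ^ ?N * (\<Prod>i\<in>UNIV. R r i)) *
          ennreal (exp (- (\<Sum>i\<in>UNIV. (R r i)\<^sup>2 * (z $ i)\<^sup>2 / 2)))"
        by (simp only: ennreal_mult''[OF exp_ge_zero])
    qed
    also have "\<dots> = ennreal (sqrt (2 * pi) ^ ?N * (\<Prod>i\<in>UNIV. R r i)) *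
        basis_integral D (\<lambda>z. ennreal (exp (- (\<Sum>i\<in>UNIV. (R r i)\<^sup>2 * (z $ i)\<^sup>2 / 2))))"
      by (rule basis_integral_cmult) measurable
    also have "\<dots> \<le> ennreal ((2 * pi) ^ dim W) * basis_integral B (?g r)"
      using gaussian_complement_le[where r = "R r", OF S(1) B D' R] unfolding eB W_def .
    finally show ?thesis .
  qed
  have h_meas[measurable]: "case_prod ?h \<in> borel_measurable (borel \<Otimes>\<^sub>M ?H)" by measurable
  have g_meas[measurable]: "(\<lambda>(r, x). ?g r x) \<in> borel_measurable (?H \<Otimes>\<^sub>M borel)" by measurable
  have g_meas'[measurable]: "(\<lambda>(x, r). ?g r x) \<in> borel_measurable (borel \<Otimes>\<^sub>M ?H)" by measurable
  have gB[measurable]: "(\<lambda>r. basis_integral B (?g r)) \<in> borel_measurable ?H"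
    by (rule basis_integral_measurable[OF fin(1)]) measurable
  let ?C = "c0 * sqrt (2 / pi) ^ ?n"
  have "ennreal (?C * sqrt pi ^ dim W) = ennreal ?C * ennreal (sqrt (2 * pi / 2) ^ dim W)"
    using c0 by (simp add: ennreal_mult')
  also have "\<dots> = basis_integral D (\<lambda>z. ennreal ?C * ennreal (exp (- (2 * (norm z)\<^sup>2 / 2))))"
    using basis_integral_std_gaussian[OF D, of 2] by (subst basis_integral_cmult) simp_all
  also have "\<dots> \<le> basis_integral D (\<lambda>z. \<integral>\<^sup>+ r. ?h z r \<partial>?H)"
  proof (rule basis_integral_mono[OF D])
    fix z :: "real ^ 'e"
    have "exp (- t) \<le> 1 / (1 + t)" if "t \<ge> 0" for t :: real
      using exp_ge_add_one_self[of t] that by (simp add: exp_minus field_simps)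
    then have le: "sqrt (2 / pi) * exp (- (t\<^sup>2)) \<le> sqrt (2 / pi) / (1 + t\<^sup>2)" for t :: real
      using mult_left_mono[of "exp (- (t\<^sup>2))" "1 / (1 + t\<^sup>2)" "sqrt (2 / pi)"] by simp
    have "(\<Sum>i\<in>UNIV. (z $ i)\<^sup>2) = (\<Sum>i\<in>A. (z $ i)\<^sup>2) + (\<Sum>i\<in>- A. (z $ i)\<^sup>2)"
      using sum.union_disjoint[of A "- A" "\<lambda>i. (z $ i)\<^sup>2"] by simp
    then have nz: "exp (- (norm z)\<^sup>2) = exp (- (\<Sum>i\<in>- A. (z $ i)\<^sup>2)) * (\<Prod>i\<in>A. exp (- (z $ i)\<^sup>2))"
      unfolding norm_vec_sq exp_sum[OF finite, symmetric] sum_negf mult_exp_exp by simp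
    have eq: "?C * exp (- (2 * (norm z)\<^sup>2 / 2)) = c0 * exp (- (\<Sum>i\<in>- A. (z $ i)\<^sup>2)) *
        (\<Prod>i\<in>A. sqrt (2 / pi) * exp (- (z $ i)\<^sup>2))"
      by (simp add: nz prod.distrib mult_ac)
    have pe: "(\<Prod>i\<in>A. ennreal (sqrt (2 / pi) * exp (- (z $ i)\<^sup>2))) =
        ennreal (\<Prod>i\<in>A. sqrt (2 / pi) * exp (- (z $ i)\<^sup>2))"
      by (intro prod_ennreal) simp
    have nn: "0 \<le> ?C" "0 \<le> c0 * exp (- (\<Sum>i\<in>- A. (z $ i)\<^sup>2))" using c0 by simp_all
    have "ennreal ?C * ennreal (exp (- (2 * (norm z)\<^sup>2 / 2))) =
        ennreal (c0 * exp (- (\<Sum>i\<in>- A. (z $ i)\<^sup>2))) * (\<Prod>i\<in>A. ennreal (sqrt (2 / pi) * exp (- (z $ i)\<^sup>2)))"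
      unfolding pe ennreal_mult'[OF nn(1), symmetric] ennreal_mult'[OF nn(2), symmetric] eq by (rule refl)
    also have "\<dots> \<le> ennreal (c0 * exp (- (\<Sum>i\<in>- A. (z $ i)\<^sup>2))) *
        (\<Prod>i\<in>A. ennreal (sqrt (2 / pi) / (1 + (z $ i)\<^sup>2)))"
      using le by (intro mult_left_mono prod_mono_ennreal ennreal_leI) simp_all
    also have "\<dots> = (\<integral>\<^sup>+ r. ?h z r \<partial>?H)"
    proof -
      have "(\<integral>\<^sup>+ r. (\<Prod>i\<in>A. ennreal (r i * exp (- ((r i)\<^sup>2 * (z $ i)\<^sup>2 / 2)))) \<partial>?H) =
          (\<Prod>i\<in>A. ennreal (sqrt (2 / pi) / (1 + (z $ i)\<^sup>2)))"
        by (subst half_normal_PiM.product_nn_integral_prod) (simp_all add: nn_integral_half_normal_linear)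
      then show ?thesis by (subst nn_integral_cmult) simp_all
    qed
    finally show "ennreal ?C * ennreal (exp (- (2 * (norm z)\<^sup>2 / 2))) \<le> (\<integral>\<^sup>+ r. ?h z r \<partial>?H)" .
  qed
  also have "\<dots> = (\<integral>\<^sup>+ r. basis_integral D (\<lambda>z. ?h z r) \<partial>?H)"
    by (rule basis_integral_nn_integral_swap[OF fin(2) half_normal_PiM.sigma_finite[OF finite] h_meas])
  also have "\<dots> \<le> (\<integral>\<^sup>+ r. ennreal ((2 * pi) ^ dim W) * basis_integral B (?g r) \<partial>?H)"
    by (rule nn_integral_mono_AE, use AE_PiM_half_normal_pos[OF finite[of A]] in eventually_elim) (rule dual)
  also have "\<dots> = ennreal ((2 * pi) ^ dim W) * (\<integral>\<^sup>+ r. basis_integral B (?g r) \<partial>?H)"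
    by (rule nn_integral_cmult) measurable
  also have "(\<integral>\<^sup>+ r. basis_integral B (?g r) \<partial>?H) =
      basis_integral B (\<lambda>x. ennreal (exp (- (\<Sum>i\<in>A. \<bar>x $ i\<bar>))))"
    unfolding laplace_eq_mixture
    by (rule basis_integral_nn_integral_swap[OF fin(1) half_normal_PiM.sigma_finite[OF finite] g_meas', symmetric])
  finally have main: "ennreal (?C * sqrt pi ^ dim W) \<le> ennreal ((2 * pi) ^ dim W) *
      basis_integral B (\<lambda>x. ennreal (exp (- (\<Sum>i\<in>A. \<bar>x $ i\<bar>))))" (is "_ \<le> _ * ?I") .
  \<comment> \<open>Powers of \<open>sqrt 2\<close> and \<open>sqrt pi\<close> are counted
    separately, with all exponents expressed by \<open>dim S\<close>, \<open>k\<close> and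
    \<open>m\<close>.\<close>
  have num: "sqrt pi ^ k * (?C * sqrt pi ^ dim W) = 2 ^ dim S * (2 * pi) ^ dim W"
  proof -
    define u v where "u = sqrt 2" and "v = sqrt pi"
    have v: "v \<noteq> 0" by (simp add: v_def)
    have sq: "u ^ j * u ^ j = 2 ^ j" "v ^ j * v ^ j = pi ^ j" for j
      by (simp_all add: u_def v_def flip: power_mult_distrib)
    have N: "?N = dim S + k + m" "?n = dim S + k" using m k by simp_all
    have "sqrt pi ^ k * (?C * sqrt pi ^ dim W) =
        v ^ k * (((u * v) ^ (dim S + k + m) * u ^ m) * (u / v) ^ (dim S + k) * v ^ (k + m))"
      unfolding c0_def N w by (simp add: u_def v_def real_sqrt_mult real_sqrt_divide)
    also have "\<dots> = (u ^ dim S * u ^ dim S) * (u ^ (k + m) * u ^ (k + m)) * (v ^ (k + m) * v ^ (k + m))"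
      using v by (simp add: power_add power_mult_distrib power_divide)
    also have "\<dots> = 2 ^ dim S * (2 * pi) ^ dim W" unfolding sq w by (simp add: power_mult_distrib)
    finally show ?thesis .
  qed
  have "ennreal ((2 * pi) ^ dim W) * ennreal (2 ^ dim S) = ennreal (sqrt pi ^ k) * ennreal (?C * sqrt pi ^ dim W)"
    using num c0 by (simp add: mult.commute flip: ennreal_mult')
  also have "\<dots> \<le> ennreal (sqrt pi ^ k) * (ennreal ((2 * pi) ^ dim W) * ?I)"
    by (intro mult_left_mono main) simp
  also have "\<dots> = ennreal ((2 * pi) ^ dim W) * (ennreal (sqrt pi ^ k) * ?I)" by (simp only: mult_ac)
  finally show ?thesis by (subst (asm) ennreal_mult_le_mult_iff) simp_all
qed

lemma laplace_section_ge:
  fixes S :: "(real ^ 'e::finite) set"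
  assumes S: "subspace S" "\<And>x i. x \<in> S \<Longrightarrow> i \<notin> A \<Longrightarrow> x $ i = 0"
    and B: "orthonormal_basis_of S B" and b: "dim S \<ge> 1"
  shows "ennreal (2 ^ dim S * (real (dim S) / card A) ^ dim S) \<le>
    basis_integral B (\<lambda>x. ennreal (exp (- (\<Sum>i\<in>A. \<bar>x $ i\<bar>))))"
proof (cases "2 * dim S \<le> card A")
  case True
  then show ?thesis by (intro laplace_section_ge_gaussian[OF S(2) B b])
next
  case False
  have "dim S \<le> card A"
  proof -
    let ?a = "\<lambda>i :: 'e. axis i 1 :: real ^ 'e"
    have "S \<subseteq> span (?a ` A)"
    proof
      fix x assume x: "x \<in> S"
      have "x = (\<Sum>i\<in>UNIV. x $ i *\<^sub>R ?a i)"
        by (simp add: vec_eq_iff axis_def if_distrib cong: if_cong)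
      also have "\<dots> = (\<Sum>i\<in>A. x $ i *\<^sub>R ?a i)"
        using S(2)[OF x] by (intro sum.mono_neutral_right) auto
      also have "\<dots> \<in> span (?a ` A)" by (intro span_sum span_scale span_base) auto
      finally show "x \<in> span (?a ` A)" .
    qed
    then have "dim S \<le> card (?a ` A)" by (intro dim_le_card) auto
    also have "\<dots> \<le> card A" by (intro card_image_le) simp
    finally show ?thesis .
  qed
  then obtain k where k: "card A = dim S + k" using le_Suc_ex by blast
  let ?b = "real (dim S)"
  have kb: "k \<le> dim S" "?b > 0" using False k b by simp_all
  \<comment> \<open>The convexity bound \<open>2 powr x \<le> 1 + x\<close> on [0, 1], at
    \<open>x = k / b\<close>. Raised to the power \<open>b\<close> it gives
    \<open>2 ^ k \<le> (n / b) ^ b\<close>, and \<open>sqrt pi \<le> 2\<close> then absorbs the loss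
    of the dual bound.\<close>
  have "2 powr (k / ?b) * 1 powr (1 - k / ?b) \<le> k / ?b * 2 + (1 - k / ?b) * 1"
    by (rule Youngs_inequality_0) (use kb in auto)
  moreover have ratio: "card A / ?b = k / ?b + 1"
  proof -
    have "?b / ?b = 1" using kb(2) by (intro divide_self) linarith
    then show ?thesis unfolding k of_nat_add add_divide_distrib by linarith
  qed
  ultimately have "2 powr (k / ?b) \<le> card A / ?b" unfolding ratio by simp
  then have "(2 powr (k / ?b)) ^ dim S \<le> (card A / ?b) ^ dim S" by (intro power_mono) simp_all
  moreover have "(2 powr (k / ?b)) ^ dim S = 2 ^ k"
  proof -
    have b0: "?b \<noteq> 0" using kb(2) by linarith
    have "(2 powr (k / ?b)) ^ dim S = 2 powr (k / ?b * ?b)"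
      by (simp only: powr_powr[symmetric]) (rule powr_realpow[symmetric], simp)
    also have "k / ?b * ?b = k" using nonzero_eq_divide_eq[OF b0] by blast
    finally show ?thesis by (simp add: powr_realpow)
  qed
  ultimately have two: "2 ^ k \<le> (card A / ?b) ^ dim S" by simp
  have "sqrt pi \<le> 2" using pi_less_4 real_sqrt_le_mono[of pi 4] by simp
  then have "sqrt pi ^ k \<le> 2 ^ k" by (intro power_mono) simp_all
  with two have sp: "sqrt pi ^ k \<le> (card A / ?b) ^ dim S" by simp
  have "sqrt pi ^ k * (2 ^ dim S * (?b / card A) ^ dim S) \<le>
      (card A / ?b) ^ dim S * (2 ^ dim S * (?b / card A) ^ dim S)"
    by (intro mult_right_mono sp) simp
  also have "\<dots> = 2 ^ dim S * (card A / ?b * (?b / card A)) ^ dim S"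
    unfolding power_mult_distrib by simp
  also have "card A / ?b * (?b / card A) = 1"
  proof -
    have cancel: "x / y * (y / x) = 1" if "x \<noteq> 0" "y \<noteq> 0" for x y :: real using that by simp
    show ?thesis by (rule cancel) (use kb(2) k in linarith)+
  qed
  finally have "ennreal (sqrt pi ^ k) * ennreal (2 ^ dim S * (?b / card A) ^ dim S) \<le> ennreal (2 ^ dim S)"
    by (simp add: ennreal_leI flip: ennreal_mult')
  also have "\<dots> \<le> ennreal (sqrt pi ^ k) * basis_integral B (\<lambda>x. ennreal (exp (- (\<Sum>i\<in>A. \<bar>x $ i\<bar>))))"
    by (rule laplace_section_ge_dual[OF S B k])
  finally show ?thesis by (subst (asm) ennreal_mult_le_mult_iff) simp_all
qed

section \<open>From the exponential integral to the volume\<close>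

lemma laplace_section_eq_volume:
  fixes S :: "(real ^ 'e::finite) set"
  assumes B: "orthonormal_basis_of S B"
  shows "basis_integral B (\<lambda>x. ennreal (exp (- (\<Sum>i\<in>A. \<bar>x $ i\<bar>)))) =
    ennreal (fact (dim S)) * basis_integral B (indicator {x. (\<Sum>i\<in>A. \<bar>x $ i\<bar>) \<le> 1})"
proof -
  let ?l = "\<lambda>x :: real ^ 'e. \<Sum>i\<in>A. \<bar>x $ i\<bar>"
  define V where "V = basis_integral B (indicator {x. ?l x \<le> 1})"
  have l_nonneg: "?l x \<ge> 0" for x by (simp add: sum_nonneg)
  have l_meas[measurable]: "?l \<in> borel_measurable borel" by measurable
  have S: "0 \<in> S" using B by (metis orthonormal_basis_of_def span_zero)
  \<comment> \<open>Layer-cake formula: the exponential is a superposition of the sublevel sets of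
    the norm. These are dilates of the unit ball, with volume \<open>s ^ dim S * V\<close>, and the
    factorial arises as the integral of \<open>s ^ dim S * exp (- s)\<close>.\<close>
  have e: "ennreal (exp (- y)) = (\<integral>\<^sup>+ s. ennreal (exp (- s)) * indicator {y..} s \<partial>lborel)" for y :: real
  proof -
    have "(\<integral>\<^sup>+ s. ennreal (exp (- s)) * indicator {y..} s \<partial>lborel) = ennreal (0 - (- exp (- y)))"
    proof (rule nn_integral_FTC_atLeast)
      show "((\<lambda>s. - exp (- s)) has_real_derivative exp (- s)) (at s)" for s :: real
        by (auto intro!: derivative_eq_intros)
      show "((\<lambda>s :: real. - exp (- s)) \<longlongrightarrow> 0) at_top" by real_asymp
    qed simp_all
    then show ?thesis by simp
  qed
  have m2[measurable]: "Measurable.pred (borel \<Otimes>\<^sub>M borel) (\<lambda>(x, s). ?l x \<le> s)" by measurable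
  have ind: "indicator {?l x..} s = indicator {x. ?l x \<le> s} x" for x :: "real ^ 'e" and s :: real
    by (simp add: indicator_def)
  have "basis_integral B (\<lambda>x. ennreal (exp (- ?l x))) =
      basis_integral B (\<lambda>x. \<integral>\<^sup>+ s. ennreal (exp (- s)) * indicator {?l x..} s \<partial>lborel)"
    by (simp only: e[symmetric])
  also have "\<dots> = (\<integral>\<^sup>+ s. basis_integral B (\<lambda>x. ennreal (exp (- s)) * indicator {?l x..} s) \<partial>lborel)"
    unfolding indicator_def of_bool_def atLeast_iff
    by (rule basis_integral_nn_integral_swap[OF orthonormal_basis_of_finite[OF B] sigma_finite_lborel]) measurable
  also have "\<dots> = (\<integral>\<^sup>+ s. ennreal (s ^ dim S * exp (- s)) * indicator {0..} s * V \<partial>lborel)"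
  proof (rule nn_integral_cong_AE)
    \<comment> \<open>At \<open>s = 0\<close> the dilation is not invertible; this single level is a
      null set.\<close>
    have "AE s in lborel. s \<noteq> (0 :: real)" by (rule AE_lborel_singleton)
    then show "AE s in lborel. basis_integral B (\<lambda>x. ennreal (exp (- s)) * indicator {?l x..} s) =
        ennreal (s ^ dim S * exp (- s)) * indicator {0..} s * V"
    proof eventually_elim
      case (elim s)
      show ?case
      proof (cases "s > 0")
        case True
        have [measurable]: "{x. ?l x \<le> s} \<in> sets borel" by measurable
        have sc: "?l (s *\<^sub>R x) = s * ?l x" for x
          using True by (simp add: abs_mult sum_distrib_left)
        have "basis_integral B (\<lambda>x. ennreal (exp (- s)) * indicator {?l x..} s) =
            ennreal (exp (- s)) * basis_integral B (indicator {x. ?l x \<le> s})"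
          unfolding ind by (rule basis_integral_cmult) measurable
        also have "basis_integral B (indicator {x. ?l x \<le> s}) =
            ennreal (\<bar>s\<bar> ^ dim S) * basis_integral B (\<lambda>x. indicator {x. ?l x \<le> s} (0 + s *\<^sub>R x))"
        proof (rule basis_integral_affine[OF B _ S])
          show "indicator {x. ?l x \<le> s} \<in> borel_measurable borel" by (rule borel_measurable_indicator) measurable
        qed (use True in simp)
        also have "(\<lambda>x. indicator {x. ?l x \<le> s} (0 + s *\<^sub>R x) :: ennreal) = indicator {x. ?l x \<le> 1}"
        proof
          fix x
          have "s * ?l x \<le> s \<longleftrightarrow> ?l x \<le> 1" using True by (simp add: mult_le_cancel_left2)
          then show "(indicator {x. ?l x \<le> s} (0 + s *\<^sub>R x) :: ennreal) = indicator {x. ?l x \<le> 1} x"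
            unfolding indicator_def add_0 mem_Collect_eq sc by simp
        qed
        finally have "basis_integral B (\<lambda>x. ennreal (exp (- s)) * indicator {?l x..} s) =
            ennreal (exp (- s)) * (ennreal (\<bar>s\<bar> ^ dim S) * V)" unfolding V_def .
        also have "\<dots> = ennreal (s ^ dim S * exp (- s)) * indicator {0..} s * V"
          using True by (simp add: ennreal_mult' mult_ac)
        finally show ?thesis .
      next
        case False
        then have "s < 0" using elim by simp
        then have "indicator {?l x..} s = (0 :: ennreal)" for x
        proof -
          have "\<not> ?l x \<le> s" using l_nonneg[of x] \<open>s < 0\<close> by linarith
          then show ?thesis by (simp add: indicator_def)
        qed
        then show ?thesis using \<open>s < 0\<close> by (simp add: indicator_def basis_integral_def)
      qed
    qed
  qed
  also have "\<dots> = (\<integral>\<^sup>+ s. ennreal (s ^ dim S * exp (- s)) * indicator {0..} s \<partial>lborel) * V"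
    by (rule nn_integral_multc) measurable
  also have "\<dots> = ennreal (fact (dim S)) * V"
    by (subst nn_intergal_power_times_exp_Ici) simp
  finally show ?thesis unfolding V_def .
qed

lemma cross_polytope_section_volume:
  fixes S :: "(real ^ 'e::finite) set"
  assumes S: "subspace S" "\<And>x i. x \<in> S \<Longrightarrow> i \<notin> A \<Longrightarrow> x $ i = 0" and b: "dim S \<ge> 1"
  defines "K \<equiv> {x \<in> S. (\<Sum>i\<in>A. \<bar>x $ i\<bar>) \<le> 1}"
  shows "2 ^ dim S / fact (dim S) * (real (dim S) / card A) ^ dim S \<le> measure (subspace_lborel S) K"
    and "measure (subspace_lborel S) K \<le> 2 ^ dim S / fact (dim S)"
proof -
  define B where "B = (SOME B. orthonormal_basis_of S B)"
  have "\<exists>B. orthonormal_basis_of S B"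
    using orthonormal_basis_of_exists[OF S(1)] by blast
  then have B: "orthonormal_basis_of S B" unfolding B_def by (rule someI_ex)
  let ?P = "\<Pi>\<^sub>M v \<in> B. (lborel :: real measure)" and ?f = "\<lambda>t. \<Sum>v\<in>B. t v *\<^sub>R v"
  let ?I = "basis_integral B (\<lambda>x. ennreal (exp (- (\<Sum>i\<in>A. \<bar>x $ i\<bar>))))"
  let ?L = "{x :: real ^ 'e. (\<Sum>i\<in>A. \<bar>x $ i\<bar>) \<le> 1}"
  have L: "?L \<in> sets borel" by measurable
  have f: "?f \<in> ?P \<rightarrow>\<^sub>M restrict_space borel S"
    by (rule measurable_restrict_space2) (use orthonormal_basis_of_sum_mem[OF B] in auto)
  have K: "K \<in> sets (restrict_space borel S)"
    unfolding sets_restrict_space K_def using L by (intro image_eqI[of _ _ ?L]) auto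
  have "emeasure (subspace_lborel S) K = emeasure ?P (?f -` K \<inter> space ?P)"
    unfolding subspace_lborel_def Let_def B_def[symmetric] by (rule emeasure_distr[OF f K])
  also have "\<dots> = (\<integral>\<^sup>+ t. indicator (?f -` K \<inter> space ?P) t \<partial>?P)"
    by (rule nn_integral_indicator[symmetric]) (rule measurable_sets[OF f K])
  also have "\<dots> = basis_integral B (indicator ?L)"
    unfolding basis_integral_def
    by (rule nn_integral_cong) (simp add: indicator_def K_def orthonormal_basis_of_sum_mem[OF B])
  finally have V: "emeasure (subspace_lborel S) K = basis_integral B (indicator ?L)" .
  have I: "?I = ennreal (fact (dim S)) * emeasure (subspace_lborel S) K"
    unfolding V by (rule laplace_section_eq_volume[OF B])
  have up: "?I \<le> ennreal (2 ^ dim S)"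
    using laplace_section_le[OF S B] by (simp flip: ennreal_power)
  \<comment> \<open>\<open>measure\<close> is 0 by convention on sets of infinite measure, so
    finiteness must be settled before either bound can be transferred; the upper bound on the
    integral supplies it.\<close>
  have "emeasure (subspace_lborel S) K < \<infinity>"
  proof (rule ccontr)
    assume "\<not> ?thesis"
    then have "emeasure (subspace_lborel S) K = \<infinity>" by (simp flip: less_top)
    then have "?I = \<infinity>" unfolding I by (simp add: ennreal_mult_eq_top_iff)
    then show False using up by (simp add: top_unique)
  qed
  then have em: "emeasure (subspace_lborel S) K = ennreal (measure (subspace_lborel S) K)"
    by (intro emeasure_eq_ennreal_measure) simp
  then have I': "?I = ennreal (fact (dim S) * measure (subspace_lborel S) K)"
    unfolding I by (simp add: ennreal_mult')
  have fct: "(fact (dim S) :: real) > 0" by simp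
  have "fact (dim S) * measure (subspace_lborel S) K \<le> 2 ^ dim S"
    using up unfolding I' by (subst (asm) ennreal_le_iff) simp_all
  then show "measure (subspace_lborel S) K \<le> 2 ^ dim S / fact (dim S)"
    unfolding pos_le_divide_eq[OF fct] by (simp only: mult.commute)
  have "2 ^ dim S * (real (dim S) / card A) ^ dim S \<le> fact (dim S) * measure (subspace_lborel S) K"
    using laplace_section_ge[OF S(1) _ B b, of A] S(2) unfolding I' by (subst (asm) ennreal_le_iff) simp_all
  then show "2 ^ dim S / fact (dim S) * (real (dim S) / card A) ^ dim S \<le> measure (subspace_lborel S) K"
    unfolding times_divide_eq_left pos_divide_le_eq[OF fct] by (simp only: mult.commute)
qed

section \<open>Integral cycles and the stable norm\<close>

text \<open>The sum runs over the whole edge type, so the norm is independent of the graph; on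
  chains it agrees with the sum over the arcs.\<close>

definition l1_norm :: "real ^ 'e::finite \<Rightarrow> real" where
  "l1_norm c = (\<Sum>e\<in>UNIV. \<bar>c $ e\<bar>)"

lemma l1_norm_zero[simp]: "l1_norm 0 = 0"
  by (simp add: l1_norm_def)

lemma l1_norm_nonneg: "0 \<le> l1_norm c"
  by (simp add: l1_norm_def sum_nonneg)

lemma l1_norm_triangle: "l1_norm (a + b) \<le> l1_norm a + l1_norm b"
  unfolding l1_norm_def by (simp add: sum_mono flip: sum.distrib)

lemma l1_norm_minus_commute: "l1_norm (a - b) = l1_norm (b - a)"
  by (simp add: l1_norm_def abs_minus_commute)

lemma l1_norm_scaleR: "l1_norm (t *\<^sub>R c) = \<bar>t\<bar> * l1_norm c"
  by (simp add: l1_norm_def abs_mult sum_distrib_left)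

lemma l1_norm_le_norm: "l1_norm (c :: real ^ 'e::finite) \<le> CARD('e) * norm c"
proof -
  have "l1_norm c \<le> (\<Sum>e\<in>(UNIV :: 'e set). norm c)"
    unfolding l1_norm_def by (intro sum_mono component_le_norm_cart)
  then show ?thesis by simp
qed

lemma norm_le_l1_norm: "norm c \<le> l1_norm c"
  unfolding l1_norm_def by (rule norm_le_l1_cart)

section \<open>Chains of edge walks\<close>

lemma walk_chain_Nil[simp]: "walk_chain [] = 0"
  by (simp add: walk_chain_def)

lemma walk_chain_Cons[simp]:
  "walk_chain ((e, d) # p) = (if d then axis e 1 else - axis e 1) + walk_chain p"
  by (simp add: walk_chain_def)

lemma walk_chain_append[simp]: "walk_chain (p @ q) = walk_chain p + walk_chain q"
  by (simp add: walk_chain_def)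

text \<open>Traversals in opposite directions can only cancel. This is the source of the lower bound
  on the length of a homology class.\<close>

lemma l1_norm_walk_chain: "l1_norm (walk_chain p) \<le> length p"
proof (induction p)
  case (Cons a p)
  obtain e d where a: "a = (e, d)" by (cases a)
  have "l1_norm (if d then axis e 1 else - axis e 1) = 1"
    unfolding l1_norm_def by (simp add: axis_def if_distrib cong: if_cong)
  then show ?case
    using l1_norm_triangle[of "if d then axis e 1 else - axis e 1" "walk_chain p"] Cons by (simp add: a)
qed simp

lemma walk_chain_distinct:
  assumes "distinct (map fst p)"
  shows "walk_chain p $ e = (if (e, True) \<in> set p then 1 else if (e, False) \<in> set p then - 1 else 0)"
  using assms
proof (induction p)
  case (Cons a p)
  obtain e' d where a: "a = (e', d)" by (cases a)
  have "(e', d') \<notin> set p" for d' using Cons.prems by (force simp: a)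
  then show ?case using Cons by (auto simp: a axis_def)
qed simp

section \<open>Walks, boundaries and integral cycles\<close>

locale multigraph = fin_digraph G for G :: "('v, 'e::finite) pre_digraph"
begin

lemma tail_bidirected[simp]: "tail (bidirected G) (e, d) = (if d then tail G e else head G e)"
  and head_bidirected[simp]: "head (bidirected G) (e, d) = (if d then head G e else tail G e)"
  and verts_bidirected[simp]: "verts (bidirected G) = verts G"
  and arcs_bidirected[simp]: "arcs (bidirected G) = arcs G \<times> UNIV"
  by (simp_all add: bidirected_def)

lemma wf_bidirected: "wf_digraph (bidirected G)"
  by unfold_locales auto

abbreviation walk :: "'v \<Rightarrow> ('e \<times> bool) list \<Rightarrow> 'v \<Rightarrow> bool" where
  "walk \<equiv> pre_digraph.awalk (bidirected G)"

lemma walk_Nil: "walk u [] v \<longleftrightarrow> u = v \<and> u \<in> verts G"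
  using wf_digraph.awalk_Nil_iff[OF wf_bidirected] by simp

lemma walk_Cons: "walk u (a # p) v \<longleftrightarrow>
    fst a \<in> arcs G \<and> u = tail (bidirected G) a \<and> walk (head (bidirected G) a) p v"
  using wf_digraph.awalk_Cons_iff[OF wf_bidirected] by (simp add: mem_Times_iff)

lemma walk_verts: "walk u p v \<Longrightarrow> u \<in> verts G \<and> v \<in> verts G"
  using wf_digraph.awalk_hd_in_verts[OF wf_bidirected] wf_digraph.awalk_last_in_verts[OF wf_bidirected] by simp

lemma walk_append: "walk u p v \<Longrightarrow> walk v q w \<Longrightarrow> walk u (p @ q) w"
  by (induction p arbitrary: u) (auto simp: walk_Nil walk_Cons)

lemma walk_arcs: "walk u p v \<Longrightarrow> fst ` set p \<subseteq> arcs G"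
  by (induction p arbitrary: u) (auto simp: walk_Cons)

lemma walk_reverse:
  assumes "walk u p v"
  obtains p' where "walk v p' u" "walk_chain p' = - walk_chain p"
proof -
  have "\<exists>p'. walk v p' u \<and> walk_chain p' = - walk_chain p"
    using assms
  proof (induction p arbitrary: u)
    case Nil
    then show ?case by (intro exI[of _ "[]"]) (auto simp: walk_Nil)
  next
    case (Cons a p)
    obtain e d where a: "a = (e, d)" by (cases a)
    have e: "e \<in> arcs G" "u = tail (bidirected G) (e, d)" "walk (head (bidirected G) (e, d)) p v"
      using Cons.prems by (simp_all add: walk_Cons a)
    from Cons.IH[OF e(3)] obtain p' where p': "walk v p' (head (bidirected G) (e, d))"
      "walk_chain p' = - walk_chain p" by blast
    have "walk (head (bidirected G) (e, d)) [(e, \<not> d)] u"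
      using e by (auto simp: walk_Cons walk_Nil)
    from walk_append[OF p'(1) this] show ?case
      by (intro exI[of _ "p' @ [(e, \<not> d)]"]) (simp add: p' a)
  qed
  then show ?thesis using that by blast
qed

text \<open>As one sum over the arcs the boundary is visibly linear, and a loop contributes
  zero.\<close>

lemma boundary_eq:
  "boundary G c v = (\<Sum>e\<in>arcs G. c $ e * (of_bool (head G e = v) - of_bool (tail G e = v)))"
proof -
  have "(\<Sum>e\<in>{e \<in> arcs G. f e = v}. c $ e) = (\<Sum>e\<in>arcs G. c $ e * of_bool (f e = v))" for f
    unfolding sum.inter_filter[OF finite_arcs] by (intro sum.cong) auto
  then show ?thesis unfolding boundary_def by (simp add: sum_subtractf right_diff_distrib)
qed

lemma boundary_add: "boundary G (a + b) v = boundary G a v + boundary G b v"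
  unfolding boundary_eq by (simp add: sum.distrib distrib_right)

lemma boundary_scaleR: "boundary G (t *\<^sub>R a) v = t * boundary G a v"
  unfolding boundary_eq by (simp add: sum_distrib_left mult.assoc)

lemma boundary_axis:
  assumes "e \<in> arcs G"
  shows "boundary G (axis e 1) v = of_bool (head G e = v) - of_bool (tail G e = v)"
proof -
  have "boundary G (axis e 1) v = (\<Sum>e'\<in>{e}. axis e 1 $ e' * (of_bool (head G e' = v) - of_bool (tail G e' = v)))"
    unfolding boundary_eq using assms by (intro sum.mono_neutral_right) (auto simp: axis_def)
  then show ?thesis by (simp add: axis_def)
qed

lemma boundary_walk_chain:
  "walk u p v \<Longrightarrow> boundary G (walk_chain p) x = of_bool (v = x) - of_bool (u = x)"
proof (induction p arbitrary: u)
  case Nil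
  then show ?case by (simp add: walk_Nil boundary_eq)
next
  case (Cons a p)
  obtain e d where a: "a = (e, d)" by (cases a)
  have e: "e \<in> arcs G" "u = tail (bidirected G) (e, d)" "walk (head (bidirected G) (e, d)) p v"
    using Cons.prems by (simp_all add: walk_Cons a)
  have "boundary G (if d then axis e 1 else - axis e 1) x =
      of_bool (head (bidirected G) (e, d) = x) - of_bool (u = x)"
    using boundary_axis[OF e(1), of x] boundary_scaleR[of "- 1" "axis e 1" x] e(2) by simp
  then show ?case using Cons.IH[OF e(3)] by (simp add: a boundary_add)
qed

lemma subspace_H1_real: "subspace (H1_real G)"
  unfolding H1_real_def chains_def
  by (auto simp: subspace_def boundary_add boundary_scaleR) (simp add: boundary_eq)

lemma H1_real_support: "c \<in> H1_real G \<Longrightarrow> e \<notin> arcs G \<Longrightarrow> c $ e = 0"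
  by (simp add: H1_real_def chains_def)

lemma H1_int_subset: "H1_int G \<subseteq> H1_real G"
  by (auto simp: H1_int_def)

lemma H1_int_add: "a \<in> H1_int G \<Longrightarrow> b \<in> H1_int G \<Longrightarrow> a + b \<in> H1_int G"
  using subspace_add[OF subspace_H1_real] by (auto simp: H1_int_def)

lemma H1_int_scale: "a \<in> H1_int G \<Longrightarrow> t \<in> \<int> \<Longrightarrow> t *\<^sub>R a \<in> H1_int G"
  using subspace_scale[OF subspace_H1_real] by (auto simp: H1_int_def)

lemma H1_int_zero: "0 \<in> H1_int G"
  using subspace_0[OF subspace_H1_real] by (auto simp: H1_int_def)

lemma walk_chain_Ints: "walk_chain p $ e \<in> \<int>"
  by (induction p) (auto simp: axis_def)

lemma walk_chain_in_H1_int: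
  assumes "walk u p u"
  shows "walk_chain p \<in> H1_int G"
proof -
  have "walk_chain p $ e = 0" if "e \<notin> fst ` set p" for p :: "('e \<times> bool) list" and e
    using that by (induction p) (auto simp: axis_def)
  then have "walk_chain p \<in> chains G" using walk_arcs[OF assms] by (auto simp: chains_def)
  then show ?thesis
    using boundary_walk_chain[OF assms] by (simp add: H1_int_def H1_real_def walk_chain_Ints)
qed

section \<open>Circuits along the flow of a cycle\<close>

definition conformal :: "real ^ 'e \<Rightarrow> ('e \<times> bool) \<Rightarrow> bool" where
  "conformal c a \<longleftrightarrow> fst a \<in> arcs G \<and> c $ fst a \<noteq> 0 \<and> (snd a \<longleftrightarrow> 0 < c $ fst a)"

text \<open>Conservation of flow, where a conformal arc is one traversed in the direction in which
  the flow \<open>c\<close> runs. If no flow left the head of \<open>a\<close>, all terms of the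
  boundary there would be nonnegative and hence zero. A nonzero term is avoided only if the edge of
  \<open>a\<close> is a loop, but then \<open>a\<close> itself leaves this vertex.\<close>

lemma conformal_step:
  assumes c: "c \<in> H1_real G" and a: "conformal c a"
  shows "\<exists>a'. conformal c a' \<and> tail (bidirected G) a' = head (bidirected G) a"
proof (rule ccontr)
  assume no: "\<not> ?thesis"
  let ?v = "head (bidirected G) a"
  let ?f = "\<lambda>e. c $ e * (of_bool (head G e = ?v) - of_bool (tail G e = ?v))"
  have out: "c $ e \<le> 0" if "e \<in> arcs G" "tail G e = ?v" for e
  proof (rule ccontr)
    assume "\<not> c $ e \<le> 0"
    then have "conformal c (e, True)" using that by (simp add: conformal_def)
    moreover have "tail (bidirected G) (e, True) = ?v" using that by simp
    ultimately show False using no by blast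
  qed
  have inn: "0 \<le> c $ e" if "e \<in> arcs G" "head G e = ?v" for e
  proof (rule ccontr)
    assume "\<not> 0 \<le> c $ e"
    then have "conformal c (e, False)" using that by (simp add: conformal_def)
    moreover have "tail (bidirected G) (e, False) = ?v" using that by simp
    ultimately show False using no by blast
  qed
  have nn: "0 \<le> ?f e" if "e \<in> arcs G" for e
    using out[OF that] inn[OF that] by (auto simp: of_bool_def)
  have "?v \<in> verts G" using a by (cases a) (auto simp: conformal_def)
  then have "(\<Sum>e\<in>arcs G. ?f e) = 0"
    using c by (simp add: H1_real_def flip: boundary_eq)
  then have z: "?f e = 0" if "e \<in> arcs G" for e
    using sum_nonneg_eq_0_iff[of "arcs G" ?f] nn that by auto
  obtain e d where ed: "a = (e, d)" by (cases a)
  have e: "e \<in> arcs G" "c $ e \<noteq> 0" "d \<longleftrightarrow> 0 < c $ e" using a by (simp_all add: conformal_def ed)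
  have "head G e = ?v \<longleftrightarrow> tail G e = ?v" using z[OF e(1)] e(2) by (auto simp: of_bool_def split: if_splits)
  moreover have "head G e = ?v \<or> tail G e = ?v" by (simp add: ed)
  ultimately show False using out[OF e(1)] inn[OF e(1)] e(2) by simp
qed

text \<open>Following the flow from arc to arc must lead back to some vertex, as there are finitely
  many.\<close>

lemma conformal_circuit:
  assumes c: "c \<in> H1_real G" "c \<noteq> 0"
  obtains u p where "walk u p u" "p \<noteq> []" "distinct (map fst p)" "\<And>a. a \<in> set p \<Longrightarrow> conformal c a"
proof -
  obtain e where e: "c $ e \<noteq> 0" using c(2) by (auto simp: vec_eq_iff)
  have a0: "conformal c (e, 0 < c $ e)"
    using e H1_real_support[OF c(1)] by (auto simp: conformal_def)
  obtain nx where nx: "\<And>a. conformal c a \<Longrightarrow> conformal c (nx a) \<and> tail (bidirected G) (nx a) = head (bidirected G) a"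
    using conformal_step[OF c(1)] by metis
  define f where "f i = (nx ^^ i) (e, 0 < c $ e)" for i
  have f: "conformal c (f i)" for i by (induction i) (use a0 nx in \<open>simp_all add: f_def\<close>)
  have link: "tail (bidirected G) (f (Suc i)) = head (bidirected G) (f i)" for i
    using nx[OF f[of i]] by (simp add: f_def)
  define t where "t i = tail (bidirected G) (f i)" for i
  have tv: "t i \<in> verts G" for i
    using f[of i] by (cases "f i") (auto simp: t_def conformal_def)
  have "\<not> inj t"
  proof
    assume "inj t"
    then have "infinite (range t)" by (rule range_inj_infinite)
    moreover have "range t \<subseteq> verts G" using tv by auto
    ultimately show False using finite_subset finite_verts by blast
  qed
  then have ex: "\<exists>j. \<exists>i<j. t i = t j"
    unfolding inj_def by (metis linorder_neqE_nat)
  \<comment> \<open>The first return to an earlier vertex closes a circuit without repeated edges.\<close>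
  define j where "j = (LEAST j. \<exists>i<j. t i = t j)"
  obtain i where i: "i < j" "t i = t j" using LeastI_ex[OF ex] unfolding j_def by blast
  have inj: "inj_on t {..<j}"
  proof (rule linorder_inj_onI')
    fix k l assume kl: "k \<in> {..<j}" "l \<in> {..<j}" "k < l"
    show "t k \<noteq> t l"
    proof
      assume "t k = t l"
      then have "j \<le> l" unfolding j_def using kl(3) by (intro Least_le) blast
      then show False using kl by simp
    qed
  qed
  define p where "p = map f [i..<j]"
  have "walk (t i) (map f [i..<k]) (t k)" if "i \<le> k" for k
    using that
  proof (induction k rule: dec_induct)
    case base
    then show ?case by (simp add: walk_Nil tv)
  next
    case (step k)
    have "walk (t k) [f k] (t (Suc k))"
      using f[of k] tv[of "Suc k"] link[of k] by (simp add: walk_Cons walk_Nil t_def conformal_def)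
    from walk_append[OF step.IH this] step.hyps show ?case by simp
  qed
  then have w: "walk (t i) p (t i)" using i unfolding p_def by (metis less_imp_le)
  \<comment> \<open>The sign of \<open>c\<close> fixes the direction in which an edge is used, so
    equal edges mean equal arcs and equal tails, and the tails before the first return are
    distinct.\<close>
  have "inj_on (\<lambda>k. fst (f k)) {i..<j}"
  proof (rule inj_onI)
    fix k l assume kl: "k \<in> {i..<j}" "l \<in> {i..<j}" "fst (f k) = fst (f l)"
    then have "f k = f l" using f[of k] f[of l] by (auto simp: conformal_def prod_eq_iff)
    then have "t k = t l" by (simp add: t_def)
    then show "k = l" using inj kl by (auto simp: inj_on_def)
  qed
  then have d: "distinct (map fst p)" by (simp add: p_def distinct_map comp_def)
  show ?thesis
    by (rule that[OF w _ d]) (use i f in \<open>auto simp: p_def\<close>)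
qed

lemma walk_chain_conformal:
  assumes "distinct (map fst p)" "\<And>a. a \<in> set p \<Longrightarrow> conformal c a"
  shows "walk_chain p $ e = (if e \<in> fst ` set p then sgn (c $ e) else 0)"
proof -
  have "walk_chain p $ e = (if (e, True) \<in> set p then 1 else if (e, False) \<in> set p then - 1 else 0)"
    by (rule walk_chain_distinct[OF assms(1)])
  moreover have "0 < c $ e" if "(e, True) \<in> set p" using assms(2)[OF that] by (simp add: conformal_def)
  moreover have "c $ e < 0" if "(e, False) \<in> set p" using assms(2)[OF that] by (auto simp: conformal_def)
  moreover have "e \<in> fst ` set p \<longleftrightarrow> (e, True) \<in> set p \<or> (e, False) \<in> set p"
  proof -
    have "e \<in> fst ` set p \<longleftrightarrow> (\<exists>d. (e, d) \<in> set p)" by force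
    then show ?thesis by (simp add: ex_bool_eq)
  qed
  ultimately show ?thesis by auto
qed

text \<open>The coefficients in a decomposition into circuits are rounded down. Subtracting
  \<open>m\<close> times a circuit empties its weakest edge \<open>e0\<close> and creates no new
  edge in the support, so the number of circuits, and with it the rounding error, is controlled by
  the size of the support.\<close>

lemma H1_int_cobounded_support:
  "c \<in> H1_real G \<Longrightarrow> \<exists>z\<in>H1_int G. l1_norm (c - z) \<le> CARD('e) * card {e. c $ e \<noteq> 0}"
proof (induction "card {e. c $ e \<noteq> 0}" arbitrary: c rule: less_induct)
  case less
  show ?case
  proof (cases "c = 0")
    case True
    then show ?thesis using H1_int_zero by (intro bexI[of _ 0]) auto
  next
    case False
    obtain u p where p: "walk u p u" "p \<noteq> []" "distinct (map fst p)" "\<And>a. a \<in> set p \<Longrightarrow> conformal c a"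
      using conformal_circuit[OF less.prems False] by blast
    let ?w = "walk_chain p" and ?E = "fst ` set p"
    define m where "m = Min ((\<lambda>e. \<bar>c $ e\<bar>) ` ?E)"
    have w: "?w $ e = (if e \<in> ?E then sgn (c $ e) else 0)" for e
      by (rule walk_chain_conformal[OF p(3,4)])
    have "m \<in> (\<lambda>e. \<bar>c $ e\<bar>) ` ?E" unfolding m_def by (rule Min_in) (use p(2) in auto)
    then obtain e0 where e0: "e0 \<in> ?E" "m = \<bar>c $ e0\<bar>" by blast
    have cE: "c $ e \<noteq> 0" if "e \<in> ?E" for e using that p(4) by (auto simp: conformal_def)
    define c' where "c' = c - m *\<^sub>R ?w"
    have wH: "?w \<in> H1_int G" by (rule walk_chain_in_H1_int[OF p(1)])
    have c': "c' \<in> H1_real G"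
      unfolding c'_def using less.prems wH H1_int_subset
      by (intro subspace_diff[OF subspace_H1_real] subspace_scale[OF subspace_H1_real]) auto
    have "{e. c' $ e \<noteq> 0} \<subseteq> {e. c $ e \<noteq> 0} - {e0}"
    proof
      fix e assume "e \<in> {e. c' $ e \<noteq> 0}"
      then have ne: "c $ e - m * ?w $ e \<noteq> 0" by (simp add: c'_def)
      have "e \<noteq> e0"
      proof
        assume "e = e0"
        then show False using ne e0 by (simp add: w abs_mult_sgn)
      qed
      moreover have "c $ e \<noteq> 0"
      proof (cases "e \<in> ?E")
        case False
        then show ?thesis using ne by (simp add: w)
      qed (rule cE)
      ultimately show "e \<in> {e. c $ e \<noteq> 0} - {e0}" by simp
    qed
    then have "{e. c' $ e \<noteq> 0} \<subset> {e. c $ e \<noteq> 0}" using cE[OF e0(1)] by blast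
    then have lt: "card {e. c' $ e \<noteq> 0} < card {e. c $ e \<noteq> 0}" by (intro psubset_card_mono) auto
    from less.hyps[OF this c'] obtain z where z: "z \<in> H1_int G"
      "l1_norm (c' - z) \<le> CARD('e) * card {e. c' $ e \<noteq> 0}" by blast
    define z' where "z' = z + \<lfloor>m\<rfloor> *\<^sub>R ?w"
    have z': "z' \<in> H1_int G" unfolding z'_def by (intro H1_int_add z H1_int_scale wH) simp
    \<comment> \<open>Only a fraction of one circuit is given up, and the entries of its chain have
      absolute value at most 1.\<close>
    have "c - z' = (c' - z) + (m - \<lfloor>m\<rfloor>) *\<^sub>R ?w"
      by (simp add: c'_def z'_def algebra_simps)
    then have "l1_norm (c - z') \<le> l1_norm (c' - z) + \<bar>m - \<lfloor>m\<rfloor>\<bar> * l1_norm ?w"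
      using l1_norm_triangle[of "c' - z" "(m - \<lfloor>m\<rfloor>) *\<^sub>R ?w"] by (simp only: l1_norm_scaleR)
    also have "\<bar>m - \<lfloor>m\<rfloor>\<bar> * l1_norm ?w \<le> 1 * real CARD('e)"
    proof (rule mult_mono)
      show "\<bar>m - \<lfloor>m\<rfloor>\<bar> \<le> 1" by linarith
      have "l1_norm ?w \<le> (\<Sum>e\<in>(UNIV :: 'e set). 1)"
        unfolding l1_norm_def by (intro sum_mono) (simp add: w abs_sgn_eq)
      then show "l1_norm ?w \<le> CARD('e)" by simp
    qed (simp_all add: l1_norm_nonneg)
    finally have "l1_norm (c - z') \<le> CARD('e) * (card {e. c' $ e \<noteq> 0} + 1)"
      using z(2) by (simp add: algebra_simps)
    also have "\<dots> \<le> CARD('e) * card {e. c $ e \<noteq> 0}"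
      unfolding of_nat_mult using lt by (intro mult_left_mono) simp_all
    finally show ?thesis using z' by blast
  qed
qed

lemma H1_int_cobounded:
  obtains K where "\<And>c. c \<in> H1_real G \<Longrightarrow> \<exists>z\<in>H1_int G. l1_norm (c - z) \<le> K"
proof
  fix c assume "c \<in> H1_real G"
  from H1_int_cobounded_support[OF this] obtain z where z: "z \<in> H1_int G"
    "l1_norm (c - z) \<le> CARD('e) * card {e. c $ e \<noteq> 0}" by blast
  have "real CARD('e) * real (card {e. c $ e \<noteq> 0}) \<le> real CARD('e) * real CARD('e)"
    by (intro mult_left_mono) (simp_all add: card_mono)
  with z(2) have "l1_norm (c - z) \<le> real (CARD('e) * CARD('e))"
    unfolding of_nat_mult by linarith
  with z(1) show "\<exists>z\<in>H1_int G. l1_norm (c - z) \<le> real (CARD('e) * CARD('e))" by blast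
qed

section \<open>Closed walks realizing integral cycles\<close>

lemma connected_walk:
  assumes "Digraph_Component.connected G" "u \<in> verts G" "v \<in> verts G"
  obtains p where "walk u p v"
proof -
  \<comment> \<open>Connectedness is reachability in the symmetric closure, each of whose arcs is an
    edge taken in one of its two directions.\<close>
  have "(u, v) \<in> rtrancl_on (verts (with_proj (mk_symmetric G))) (arcs_ends (with_proj (mk_symmetric G)))"
    using assms unfolding Digraph_Component.connected_def strongly_connected_def reachable_def by simp
  then have "\<exists>p. walk u p v"
  proof (induction rule: rtrancl_on_induct)
    case base
    then show ?case using assms(2) by (intro exI[of _ "[]"]) (simp add: walk_Nil)
  next
    case (step y z)
    then obtain p where p: "walk u p y" by blast
    from step(2) obtain e where e: "e \<in> arcs G"
      "(y, z) = (tail G e, head G e) \<or> (y, z) = (head G e, tail G e)"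
      by (auto simp: parcs_mk_symmetric)
    have "\<exists>d. walk y [(e, d)] z"
      using e by (auto simp: walk_Cons walk_Nil ex_bool_eq)
    then show ?case using walk_append[OF p] by blast
  qed
  then show ?thesis using that by blast
qed

text \<open>Formulated by the heads in the list, the property clearly survives the insertion of
  further arcs; \<open>x0\<close> is added because the start of a walk need not be a head.\<close>

definition visits :: "('e \<times> bool) list \<Rightarrow> 'v set \<Rightarrow> 'v \<Rightarrow> bool" where
  "visits p V x0 \<longleftrightarrow> V \<subseteq> insert x0 (head (bidirected G) ` set p)"

lemma visits_split:
  "walk x p y \<Longrightarrow> visits p V x \<Longrightarrow> v \<in> V \<Longrightarrow> \<exists>q r. p = q @ r \<and> walk x q v \<and> walk v r y"
proof -
  have "walk x p y \<Longrightarrow> v = x \<or> v \<in> head (bidirected G) ` set p \<Longrightarrow>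
      \<exists>q r. p = q @ r \<and> walk x q v \<and> walk v r y"
  proof (induction p arbitrary: x)
    case Nil
    then show ?case by (auto simp: walk_Nil)
  next
    case (Cons a p)
    show ?case
    proof (cases "v = x")
      case True
      then show ?thesis using Cons.prems(1) walk_verts[OF Cons.prems(1)]
        by (intro exI[of _ "[]"] exI[of _ "a # p"]) (simp add: walk_Nil)
    next
      case False
      from Cons.prems(1) have w: "walk (head (bidirected G) a) p y" by (simp add: walk_Cons)
      have "v = head (bidirected G) a \<or> v \<in> head (bidirected G) ` set p"
        using Cons.prems(2) False by auto
      from Cons.IH[OF w this] obtain q r where "p = q @ r" "walk (head (bidirected G) a) q v" "walk v r y"
        by blast
      then show ?thesis using Cons.prems(1)
        by (intro exI[of _ "a # q"] exI[of _ r]) (simp add: walk_Cons)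
    qed
  qed
  then show "walk x p y \<Longrightarrow> visits p V x \<Longrightarrow> v \<in> V \<Longrightarrow> \<exists>q r. p = q @ r \<and> walk x q v \<and> walk v r y"
    unfolding visits_def by blast
qed

lemma walk_head_last: "walk u p v \<Longrightarrow> v = u \<or> v \<in> head (bidirected G) ` set p"
proof (induction p arbitrary: u)
  case Nil
  then show ?case by (simp add: walk_Nil)
next
  case (Cons a p)
  then have "walk (head (bidirected G) a) p v" by (simp add: walk_Cons)
  from Cons.IH[OF this] show ?case by auto
qed

text \<open>From \<open>x0\<close> to each vertex and back along the reversed walk, so that the
  chains cancel. The length of this tour becomes the additive error \<open>N\<close> in the
  comparison of lengths with the norm.\<close>

lemma null_homologous_tour:
  assumes "Digraph_Component.connected G" "x0 \<in> verts G"
  obtains p where "walk x0 p x0" "walk_chain p = 0" "visits p (verts G) x0"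
proof -
  have "\<exists>p. walk x0 p x0 \<and> walk_chain p = 0 \<and> visits p V x0" if "finite V" "V \<subseteq> verts G" for V
    using that
  proof (induction V rule: finite_induct)
    case empty
    then show ?case using assms(2) by (intro exI[of _ "[]"]) (simp add: walk_Nil visits_def)
  next
    case (insert v V)
    then obtain p where p: "walk x0 p x0" "walk_chain p = 0" "visits p V x0" by auto
    obtain q where q: "walk x0 q v" using connected_walk[OF assms, of v] insert.prems by auto
    obtain q' where q': "walk v q' x0" "walk_chain q' = - walk_chain q" using walk_reverse[OF q] .
    have "walk x0 (p @ q @ q') x0" by (intro walk_append[OF p(1)] walk_append[OF q] q')
    moreover have "walk_chain (p @ q @ q') = 0" by (simp add: p q')
    moreover have "visits (p @ q @ q') (insert v V) x0"
      using p(3) walk_head_last[OF q] by (auto simp: visits_def image_Un)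
    ultimately show ?case by blast
  qed
  from this[of "verts G"] show ?thesis using that by auto
qed

text \<open>Along the circuit the entries of \<open>h\<close> are nonzero integers, so removing one
  unit of flow lowers each absolute value by exactly 1.\<close>

lemma l1_norm_minus_circuit:
  assumes h: "h \<in> H1_int G" and d: "distinct (map fst p)" and c: "\<And>a. a \<in> set p \<Longrightarrow> conformal h a"
  shows "l1_norm (h - walk_chain p) = l1_norm h - length p"
proof -
  let ?E = "fst ` set p"
  have "\<bar>h $ e - walk_chain p $ e\<bar> = \<bar>h $ e\<bar> - of_bool (e \<in> ?E)" for e
  proof (cases "e \<in> ?E")
    case True
    then have "h $ e \<noteq> 0" using c by (auto simp: conformal_def)
    moreover have "h $ e \<in> \<int>" using h by (simp add: H1_int_def)
    ultimately have "1 \<le> \<bar>h $ e\<bar>" by (simp add: Ints_nonzero_abs_ge1)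
    then show ?thesis using True
      by (cases "0 < h $ e") (simp_all add: walk_chain_conformal[OF d c] sgn_if)
  next
    case False
    then show ?thesis by (simp add: walk_chain_conformal[OF d c])
  qed
  then have "l1_norm (h - walk_chain p) = l1_norm h - card ?E"
    by (simp add: l1_norm_def sum_subtractf)
  also have "card ?E = length p" using distinct_card[OF d] by simp
  finally show ?thesis .
qed

lemma H1_int_realized:
  assumes p0: "walk x0 p0 x0" "walk_chain p0 = 0" "visits p0 (verts G) x0"
  shows "h \<in> H1_int G \<Longrightarrow> \<exists>p. walk x0 p x0 \<and> walk_chain p = h \<and> visits p (verts G) x0 \<and>
    real (length p) = l1_norm h + length p0"
proof (induction "nat \<lfloor>l1_norm h\<rfloor>" arbitrary: h rule: less_induct)
  case less
  show ?case
  proof (cases "h = 0")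
    case True
    then show ?thesis using p0 by auto
  next
    case False
    have hr: "h \<in> H1_real G" using less.prems H1_int_subset by blast
    obtain u p where p: "walk u p u" "p \<noteq> []" "distinct (map fst p)" "\<And>a. a \<in> set p \<Longrightarrow> conformal h a"
      using conformal_circuit[OF hr False] by blast
    let ?h = "h - walk_chain p"
    have l: "l1_norm ?h = l1_norm h - length p"
      by (rule l1_norm_minus_circuit[OF less.prems p(3,4)])
    \<comment> \<open>The circuit is nonempty, so the norm drops by at least 1 and its floor
      decreases strictly.\<close>
    have "real (length p) \<ge> 1" using p(2) by (cases p) auto
    then have lt: "nat \<lfloor>l1_norm ?h\<rfloor> < nat \<lfloor>l1_norm h\<rfloor>"
      using l l1_norm_nonneg[of ?h] by linarith
    have h': "?h \<in> H1_int G"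
      using H1_int_add[OF less.prems H1_int_scale[OF walk_chain_in_H1_int[OF p(1)], of "- 1"]] by simp
    from less.hyps[OF lt h'] obtain q where q: "walk x0 q x0" "walk_chain q = ?h"
      "visits q (verts G) x0" "real (length q) = l1_norm ?h + length p0" by blast
    have "u \<in> verts G" using walk_verts[OF p(1)] by simp
    from visits_split[OF q(1,3) this] obtain r s where rs: "q = r @ s" "walk x0 r u" "walk u s x0" by blast
    have "walk x0 (r @ p @ s) x0" by (intro walk_append[OF rs(2)] walk_append[OF p(1)] rs(3))
    moreover have "walk_chain (r @ p @ s) = h" using q(2) by (simp add: rs(1) algebra_simps)
    moreover have "visits (r @ p @ s) (verts G) x0" using q(3) by (auto simp: visits_def rs(1) image_Un)
    moreover have "real (length (r @ p @ s)) = l1_norm h + length p0" using q(4) l by (simp add: rs(1))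
    ultimately show ?thesis by blast
  qed
qed

section \<open>Lengths of homotopy and homology classes\<close>

lemma homotopy_refl: "p \<in> based_cycles G x0 \<Longrightarrow> (p, p) \<in> homotopy G x0"
  by (simp add: homotopy_def)

lemma homotopy_walk_chain:
  assumes "(p, q) \<in> homotopy G x0"
  shows "walk_chain q = walk_chain p"
proof -
  have "(p, q) \<in> (backtrack_insertion G x0 \<union> (backtrack_insertion G x0)\<inverse>)\<^sup>*"
    using assms by (simp add: homotopy_def)
  then show ?thesis
  proof (induction rule: rtrancl_induct)
    case (step y z)
    have "walk_chain z = walk_chain y"
      using step(2) unfolding backtrack_insertion_def by (auto split: if_splits)
    then show ?case using step(3) by simp
  qed simp
qed

lemma homology_class_eq:
  assumes "p \<in> based_cycles G x0"
  shows "homology_class (homotopy G x0 `` {p}) = walk_chain p"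
proof -
  have "walk_chain ` (homotopy G x0 `` {p}) = {walk_chain p}"
  proof
    show "walk_chain ` (homotopy G x0 `` {p}) \<subseteq> {walk_chain p}"
      using homotopy_walk_chain by auto
    show "{walk_chain p} \<subseteq> walk_chain ` (homotopy G x0 `` {p})"
      using homotopy_refl[OF assms] by auto
  qed
  then show ?thesis by (simp add: homology_class_def)
qed

lemma homology_length_le:
  assumes p: "p \<in> based_cycles G x0"
  shows "homology_length G x0 (walk_chain p) \<le> length p"
proof -
  let ?\<alpha> = "homotopy G x0 `` {p}"
  have "?\<alpha> \<in> pi1 G x0" unfolding pi1_def using p by (rule quotientI)
  then have "homology_length G x0 (walk_chain p) \<le> pi1_length ?\<alpha>"
    unfolding homology_length_def using homology_class_eq[OF p] by (intro Least_le) blast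
  also have "pi1_length ?\<alpha> \<le> length p"
    unfolding pi1_length_def using homotopy_refl[OF p] by (intro Least_le) blast
  finally show ?thesis .
qed

text \<open>Both minima are attained, so some closed walk has exactly this length; its chain is that
  of \<open>p\<close>, because homotopy does not change chains.\<close>

lemma homology_length_ge:
  assumes p: "p \<in> based_cycles G x0"
  shows "l1_norm (walk_chain p) \<le> homology_length G x0 (walk_chain p)"
proof -
  let ?P = "\<lambda>n. \<exists>\<alpha> \<in> pi1 G x0. homology_class \<alpha> = walk_chain p \<and> pi1_length \<alpha> = n"
  have "homotopy G x0 `` {p} \<in> pi1 G x0" unfolding pi1_def using p by (rule quotientI)
  then have "\<exists>n. ?P n" using homology_class_eq[OF p] by blast
  from LeastI_ex[OF this] obtain \<alpha> where \<alpha>: "\<alpha> \<in> pi1 G x0" "homology_class \<alpha> = walk_chain p"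
    "pi1_length \<alpha> = homology_length G x0 (walk_chain p)" unfolding homology_length_def by blast
  from \<alpha>(1) obtain r where r: "r \<in> based_cycles G x0" "\<alpha> = homotopy G x0 `` {r}"
    unfolding pi1_def by (rule quotientE)
  have "\<exists>n. \<exists>s\<in>\<alpha>. length s = n" using homotopy_refl[OF r(1)] r(2) by blast
  from LeastI_ex[OF this] obtain s where s: "s \<in> \<alpha>" "length s = pi1_length \<alpha>"
    unfolding pi1_length_def by blast
  have "walk_chain s = walk_chain r" using s(1) homotopy_walk_chain by (simp add: r(2))
  also have "walk_chain r = walk_chain p" using \<alpha>(2) homology_class_eq[OF r(1)] r(2) by simp
  finally have "l1_norm (walk_chain p) \<le> length s" using l1_norm_walk_chain[of s] by simp
  then show ?thesis using s(2) \<alpha>(3) by simp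
qed

lemma homology_length_bounds:
  assumes "Digraph_Component.connected G" "x0 \<in> verts G"
  obtains N :: nat where "\<And>h. h \<in> H1_int G \<Longrightarrow>
    l1_norm h \<le> homology_length G x0 h \<and> homology_length G x0 h \<le> l1_norm h + N"
proof -
  obtain p0 where p0: "walk x0 p0 x0" "walk_chain p0 = 0" "visits p0 (verts G) x0"
    using null_homologous_tour[OF assms] .
  have "l1_norm h \<le> homology_length G x0 h \<and> homology_length G x0 h \<le> l1_norm h + length p0"
    if h: "h \<in> H1_int G" for h
  proof -
    obtain p where p: "walk x0 p x0" "walk_chain p = h" "real (length p) = l1_norm h + length p0"
      using H1_int_realized[OF p0 h] by blast
    then have "p \<in> based_cycles G x0" by (simp add: based_cycles_def)
    from homology_length_le[OF this] homology_length_ge[OF this] p show ?thesis by simp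
  qed
  then show ?thesis using that by blast
qed

section \<open>Closest lattice points and the limit\<close>

lemma finite_H1_int_bounded: "finite {z \<in> H1_int G. norm z \<le> R}"
proof -
  let ?F = "PiE UNIV (\<lambda>_ :: 'e. real_of_int ` {- \<lceil>R\<rceil>..\<lceil>R\<rceil>})"
  have "{z \<in> H1_int G. norm z \<le> R} \<subseteq> vec_lambda ` ?F"
  proof
    fix z assume z: "z \<in> {z \<in> H1_int G. norm z \<le> R}"
    have "z $ e \<in> real_of_int ` {- \<lceil>R\<rceil>..\<lceil>R\<rceil>}" for e
    proof -
      obtain k where k: "z $ e = real_of_int k" using z by (auto simp: H1_int_def elim: Ints_cases)
      have "\<bar>z $ e\<bar> \<le> R" using component_le_norm_cart[of z e] z by simp
      then have "- \<lceil>R\<rceil> \<le> k" "k \<le> \<lceil>R\<rceil>" unfolding k by linarith+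
      then show ?thesis unfolding k by simp
    qed
    then show "z \<in> vec_lambda ` ?F" by (intro image_eqI[of _ _ "vec_nth z"]) auto
  qed
  moreover have "finite ?F" by (intro finite_PiE) auto
  ultimately show ?thesis using finite_subset by blast
qed

text \<open>Positivity is given only on the cycles, so the lower bound comes from compactness of
  their unit sphere; the upper bound is the continuity of a bilinear form on the whole
  space.\<close>

lemma euclidean_on_equivalent_norm:
  assumes q: "euclidean_on (H1_real G) q"
  obtains m M where "0 < m" "\<And>x. x \<in> H1_real G \<Longrightarrow> m * (norm x)\<^sup>2 \<le> q x x"
    "\<And>x. q x x \<le> M * (norm x)\<^sup>2"
proof -
  have pos: "0 < q x x" if "x \<in> H1_real G" "x \<noteq> 0" for x
    using q that by (simp add: euclidean_on_def)
  interpret q: bounded_bilinear q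
    using q by (simp add: euclidean_on_def bilinear_conv_bounded_bilinear)
  obtain M where M: "\<And>a b. norm (q a b) \<le> norm a * norm b * M" using q.bounded by blast
  have up: "q x x \<le> M * (norm x)\<^sup>2" for x
    using M[of x x] by (simp add: power2_eq_square mult_ac)
  let ?U = "sphere 0 1 \<inter> H1_real G"
  have cpt: "compact ?U" by (intro compact_Int_closed compact_sphere closed_subspace subspace_H1_real)
  have cont: "continuous_on ?U (\<lambda>x. q x x)" by (intro q.continuous_on continuous_on_id)
  have "\<exists>m>0. \<forall>x\<in>?U. m \<le> q x x"
  proof (cases "?U = {}")
    case False
    obtain v where v: "v \<in> ?U" "\<forall>y\<in>?U. q v v \<le> q y y"
      using continuous_attains_inf[OF cpt False cont] by metis
    have "v \<noteq> 0" using v(1) by auto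
    then have "0 < q v v" using v(1) by (intro pos) simp_all
    then show ?thesis using v(2) by (intro exI[of _ "q v v"] conjI)
  qed (auto intro: zero_less_one)
  then obtain m where m: "m > 0" "\<And>x. x \<in> ?U \<Longrightarrow> m \<le> q x x" by metis
  have "m * (norm x)\<^sup>2 \<le> q x x" if x: "x \<in> H1_real G" for x
  proof (cases "x = 0")
    case False
    then have "x /\<^sub>R norm x \<in> ?U" using x subspace_scale[OF subspace_H1_real x] by simp
    from m(2)[OF this] have "m \<le> inverse (norm x) * (inverse (norm x) * q x x)"
      by (simp add: q.scaleR_left q.scaleR_right)
    then show ?thesis using False by (simp add: field_simps power2_eq_square)
  qed (simp add: q.zero_left)
  then show ?thesis using that[OF m(1) _ up] by blast
qed

text \<open>The distance bound follows by comparison with the lattice point from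
  \<open>H1_int_cobounded\<close>, after passing from \<open>q\<close> to the norm. But
  \<open>arg_min\<close> is a choice operator, so a minimizer must be shown to exist first.\<close>

lemma closest_H1_int_near:
  assumes q: "euclidean_on (H1_real G) q"
  obtains K where "\<And>u. u \<in> H1_real G \<Longrightarrow> closest_H1_int G q u \<in> H1_int G \<and> l1_norm (closest_H1_int G q u - u) \<le> K"
proof -
  obtain m M where mM: "0 < m" "\<And>x. x \<in> H1_real G \<Longrightarrow> m * (norm x)\<^sup>2 \<le> q x x"
    "\<And>x. q x x \<le> M * (norm x)\<^sup>2"
    using euclidean_on_equivalent_norm[OF q] by blast
  obtain K0 where K0: "\<And>c. c \<in> H1_real G \<Longrightarrow> \<exists>z\<in>H1_int G. l1_norm (c - z) \<le> K0"
    using H1_int_cobounded by blast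
  define K where "K = sqrt (\<bar>M\<bar> * K0\<^sup>2 / m)"
  have "closest_H1_int G q u \<in> H1_int G \<and> l1_norm (closest_H1_int G q u - u) \<le> CARD('e) * K"
    if u: "u \<in> H1_real G" for u
  proof -
    let ?f = "\<lambda>z. q (u - z) (u - z)"
    obtain z0 where z0: "z0 \<in> H1_int G" "l1_norm (u - z0) \<le> K0" using K0[OF u] by blast
    have sub: "u - z \<in> H1_real G" if "z \<in> H1_int G" for z
      using that u H1_int_subset by (intro subspace_diff[OF subspace_H1_real]) auto
    have "norm (u - z0) \<le> K0" using norm_le_l1_norm[of "u - z0"] z0(2) by simp
    then have n0: "(norm (u - z0))\<^sup>2 \<le> K0\<^sup>2" by (intro power_mono) simp_all
    have f0: "?f z0 \<le> \<bar>M\<bar> * K0\<^sup>2"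
    proof -
      have "?f z0 \<le> M * (norm (u - z0))\<^sup>2" by (rule mM(3))
      also have "\<dots> \<le> \<bar>M\<bar> * K0\<^sup>2" using n0 by (intro mult_mono) auto
      finally show ?thesis .
    qed
    have near: "norm (u - z) \<le> K" if "z \<in> H1_int G" "?f z \<le> ?f z0" for z
    proof -
      have "m * (norm (u - z))\<^sup>2 \<le> \<bar>M\<bar> * K0\<^sup>2" using mM(2)[OF sub[OF that(1)]] that(2) f0 by linarith
      then have "(norm (u - z))\<^sup>2 \<le> \<bar>M\<bar> * K0\<^sup>2 / m" using mM(1) by (simp add: pos_le_divide_eq mult.commute)
      then show ?thesis unfolding K_def by (rule real_le_rsqrt)
    qed
    \<comment> \<open>Only the lattice points at least as close as \<open>z0\<close> compete; they
      are bounded, hence finitely many.\<close>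
    let ?Z = "{z \<in> H1_int G. ?f z \<le> ?f z0}"
    have "?Z \<subseteq> {z \<in> H1_int G. norm z \<le> K + norm u}"
    proof
      fix z assume z: "z \<in> ?Z"
      have "norm z \<le> norm (u - z) + norm u" using norm_triangle_sub[of z u] by (simp add: norm_minus_commute)
      then show "z \<in> {z \<in> H1_int G. norm z \<le> K + norm u}" using z near[of z] by simp
    qed
    then have "finite ?Z" using finite_H1_int_bounded finite_subset by blast
    moreover have "?Z \<noteq> {}" using z0(1) by blast
    ultimately obtain z1 where z1: "is_arg_min ?f (\<lambda>z. z \<in> ?Z) z1"
      using ex_is_arg_min_if_finite by blast
    then have z1': "z1 \<in> H1_int G" "?f z1 \<le> ?f z0" by (auto simp: is_arg_min_def)
    have "\<not> ?f y < ?f z1" if y: "y \<in> H1_int G" for y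
    proof
      assume lt: "?f y < ?f z1"
      then have "y \<in> ?Z" using y z1'(2) by simp
      then show False using z1 lt unfolding is_arg_min_def by blast
    qed
    then have "is_arg_min ?f (\<lambda>z. z \<in> H1_int G) z1"
      using z1'(1) unfolding is_arg_min_def by blast
    then have a: "is_arg_min ?f (\<lambda>z. z \<in> H1_int G) (closest_H1_int G q u)"
      unfolding closest_H1_int_def arg_min_def by (rule someI)
    then have c: "closest_H1_int G q u \<in> H1_int G" "?f (closest_H1_int G q u) \<le> ?f z0"
      using z0(1) by (auto simp: is_arg_min_linorder)
    have "l1_norm (closest_H1_int G q u - u) \<le> CARD('e) * norm (u - closest_H1_int G q u)"
      using l1_norm_le_norm by (metis l1_norm_minus_commute)
    also have "\<dots> \<le> CARD('e) * K" using near[OF c] by (intro mult_left_mono) simp_all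
    finally show ?thesis using c(1) by simp
  qed
  then show ?thesis using that by blast
qed

text \<open>The length exceeds the norm of the lattice point by at most \<open>N\<close>, and the
  lattice point is within \<open>K\<close> of \<open>n u\<close>. Both errors are independent of
  \<open>n\<close> and vanish after division by it.\<close>

lemma stable_norm_eq_l1_norm:
  assumes G: "Digraph_Component.connected G" "x0 \<in> verts G"
    and q: "euclidean_on (H1_real G) q" and u: "u \<in> H1_real G"
  shows "stable_norm G x0 q u = l1_norm u"
proof -
  obtain N :: nat where N: "\<And>h. h \<in> H1_int G \<Longrightarrow>
      l1_norm h \<le> homology_length G x0 h \<and> homology_length G x0 h \<le> l1_norm h + N"
    using homology_length_bounds[OF G] by blast
  obtain K where K: "\<And>u. u \<in> H1_real G \<Longrightarrow>
      closest_H1_int G q u \<in> H1_int G \<and> l1_norm (closest_H1_int G q u - u) \<le> K"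
    using closest_H1_int_near[OF q] by blast
  let ?h = "\<lambda>n :: nat. closest_H1_int G q (real n *\<^sub>R u)"
  let ?s = "\<lambda>n :: nat. real (homology_length G x0 (?h n)) / real n"
  have bound: "\<bar>?s n - l1_norm u\<bar> \<le> (K + N) / real n" if n: "n > 0" for n
  proof -
    have nu: "real n *\<^sub>R u \<in> H1_real G" by (rule subspace_scale[OF subspace_H1_real u])
    have h: "?h n \<in> H1_int G" "l1_norm (?h n - real n *\<^sub>R u) \<le> K" using K[OF nu] by simp_all
    have "l1_norm (?h n) \<le> l1_norm (?h n - real n *\<^sub>R u) + l1_norm (real n *\<^sub>R u)"
      using l1_norm_triangle[of "?h n - real n *\<^sub>R u" "real n *\<^sub>R u"] by simp
    moreover have "l1_norm (real n *\<^sub>R u) \<le> l1_norm (?h n - real n *\<^sub>R u) + l1_norm (?h n)"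
      using l1_norm_triangle[of "real n *\<^sub>R u - ?h n" "?h n"] l1_norm_minus_commute[of "?h n"] by simp
    moreover have "l1_norm (real n *\<^sub>R u) = real n * l1_norm u" by (simp add: l1_norm_scaleR)
    ultimately have "\<bar>real (homology_length G x0 (?h n)) - real n * l1_norm u\<bar> \<le> K + N"
      using h(2) N[OF h(1)] by linarith
    then have "\<bar>real (homology_length G x0 (?h n)) - real n * l1_norm u\<bar> / real n \<le> (K + N) / real n"
      by (rule divide_right_mono) simp
    moreover have "\<bar>real (homology_length G x0 (?h n)) - real n * l1_norm u\<bar> / real n = \<bar>?s n - l1_norm u\<bar>"
    proof -
      have "?s n - l1_norm u = (real (homology_length G x0 (?h n)) - real n * l1_norm u) / real n"
        using n by (simp add: diff_divide_distrib)
      then show ?thesis by (simp add: abs_divide)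
    qed
    ultimately show ?thesis by simp
  qed
  have "?s \<longlonglongrightarrow> l1_norm u"
  proof (rule LIM_zero_cancel, rule tendsto_rabs_zero_cancel, rule tendsto_sandwich)
    show "\<forall>\<^sub>F n in sequentially. 0 \<le> \<bar>?s n - l1_norm u\<bar>" by simp
    show "\<forall>\<^sub>F n in sequentially. \<bar>?s n - l1_norm u\<bar> \<le> (K + N) / real n"
      using eventually_gt_at_top[of 0] by eventually_elim (rule bound)
    show "(\<lambda>n. (K + N) / real n) \<longlonglongrightarrow> 0" by (rule lim_const_over_n)
  qed simp
  then show ?thesis unfolding stable_norm_def by (rule limI)
qed

lemma stable_ball_volume:
  assumes G: "Digraph_Component.connected G" "x0 \<in> verts G"
    and q: "euclidean_on (H1_real G) q" and b: "betti G = b" "b \<ge> 1"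
  shows "2 ^ b / fact b * (real b / volume G) ^ b \<le> measure (haar G) (stable_ball G x0 q)"
    and "measure (haar G) (stable_ball G x0 q) \<le> 2 ^ b / fact b"
proof -
  have "stable_ball G x0 q = {x \<in> H1_real G. (\<Sum>i\<in>arcs G. \<bar>x $ i\<bar>) \<le> 1}"
  proof -
    have "stable_norm G x0 q x = (\<Sum>i\<in>arcs G. \<bar>x $ i\<bar>)" if "x \<in> H1_real G" for x
      unfolding stable_norm_eq_l1_norm[OF G q that] l1_norm_def
      using H1_real_support[OF that] by (intro sum_UNIV_eq) simp
    then show ?thesis unfolding stable_ball_def by auto
  qed
  then show "2 ^ b / fact b * (real b / volume G) ^ b \<le> measure (haar G) (stable_ball G x0 q)"
    "measure (haar G) (stable_ball G x0 q) \<le> 2 ^ b / fact b"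
    using cross_polytope_section_volume[OF subspace_H1_real H1_real_support] b
    unfolding haar_def betti_def volume_def by auto
qed

end

section \<open>The bouquet of circles\<close>

lemma multigraph_bouquet: "multigraph (bouquet w (A :: 'e::finite set))"
  by unfold_locales (auto simp: bouquet_def)

lemma connected_bouquet: "Digraph_Component.connected (bouquet w A)"
proof -
  have "(w, w) \<in> rtrancl_on {w} R" for R :: "('a \<times> 'a) set" by (rule rtrancl_on_refl) simp
  then show ?thesis
    unfolding Digraph_Component.connected_def strongly_connected_def reachable_def
    by (simp add: bouquet_def)
qed

text \<open>Every edge both enters and leaves the only vertex, so every chain is a cycle.\<close>

lemma H1_real_bouquet: "H1_real (bouquet w A) = {c. \<forall>e. e \<notin> A \<longrightarrow> c $ e = 0}"
  unfolding H1_real_def chains_def boundary_def by (simp add: bouquet_def)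

lemma betti_bouquet: "betti (bouquet w (A :: 'e::finite set)) = card A"
proof -
  have eq: "H1_real (bouquet w A) = {c. \<forall>i\<in>Basis. i \<notin> (\<lambda>e. axis e 1) ` A \<longrightarrow> c \<bullet> i = 0}"
    unfolding H1_real_bouquet
  proof (intro Collect_cong iffI ballI impI allI)
    fix c i :: "real ^ 'e"
    assume c: "\<forall>e. e \<notin> A \<longrightarrow> c $ e = 0" and i: "i \<in> Basis" "i \<notin> (\<lambda>e. axis e 1) ` A"
    from i(1) obtain e where e: "i = axis e 1" by (auto simp: Basis_vec_def)
    with i(2) have "e \<notin> A" by blast
    then show "c \<bullet> i = 0" using c by (simp add: e inner_axis)
  next
    fix c :: "real ^ 'e" and e
    assume c: "\<forall>i\<in>Basis. i \<notin> (\<lambda>e. axis e 1) ` A \<longrightarrow> c \<bullet> i = 0" and e: "e \<notin> A"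
    have "axis e (1 :: real) \<in> Basis" by (auto simp: Basis_vec_def)
    moreover have "axis e (1 :: real) \<notin> (\<lambda>e. axis e 1) ` A" using e by (auto simp: axis_eq_axis)
    ultimately have "c \<bullet> axis e 1 = 0" using c by blast
    then show "c $ e = 0" by (simp add: inner_axis)
  qed
  have "(\<lambda>e. axis e 1) ` A \<subseteq> (Basis :: (real ^ 'e) set)" by (auto simp: Basis_vec_def)
  then have "dim (H1_real (bouquet w A)) = card ((\<lambda>e. axis e 1 :: real ^ 'e) ` A)"
    unfolding eq by (rule dim_substandard)
  also have "\<dots> = card A" by (rule card_image) (auto simp: inj_on_def axis_eq_axis)
  finally show ?thesis by (simp add: betti_def)
qed

theorem theorem2:
  fixes G :: "('v, 'e::finite) pre_digraph"
    and x0 :: 'v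
    and q :: "real ^ 'e \<Rightarrow> real ^ 'e \<Rightarrow> real"
    and b :: nat
  assumes "fin_digraph G"
    and "Digraph_Component.connected G"
    and "betti G = b"
    and "b \<ge> 1"
    and "x0 \<in> verts G"
    and "euclidean_on (H1_real G) q"
  shows "2 ^ b / fact b * (real b / volume G) ^ b \<le> measure (haar G) (stable_ball G x0 q) \<and>
         measure (haar G) (stable_ball G x0 q) \<le> 2 ^ b / fact b \<and>
         (\<forall>(w :: 'v) (A :: 'e set) q'.
            card A = b \<and> euclidean_on (H1_real (bouquet w A)) q' \<longrightarrow>
              betti (bouquet w A) = b \<and>
              measure (haar (bouquet w A)) (stable_ball (bouquet w A) w q')
                = 2 ^ b / fact b * (real b / volume (bouquet w A)) ^ b \<and>
              measure (haar (bouquet w A)) (stable_ball (bouquet w A) w q') = 2 ^ b / fact b)"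
proof (intro conjI allI impI)
  interpret multigraph G using assms(1) by (simp add: multigraph_def)
  show "2 ^ b / fact b * (real b / volume G) ^ b \<le> measure (haar G) (stable_ball G x0 q)"
    and "measure (haar G) (stable_ball G x0 q) \<le> 2 ^ b / fact b"
    by (rule stable_ball_volume[OF assms(2,5,6,3,4)])+
next
  fix w :: 'v and A :: "'e set" and q'
  assume A: "card A = b \<and> euclidean_on (H1_real (bouquet w A)) q'"
  let ?G = "bouquet w A"
  interpret bouquet: multigraph ?G by (rule multigraph_bouquet)
  show betti: "betti ?G = b" using A by (simp add: betti_bouquet)
  \<comment> \<open>The volume is \<open>b\<close> here, and \<open>b \<ge> 1\<close> rules out the
    quotient \<open>0 / 0\<close>, which is 0 by convention.\<close>
  have "real b / volume ?G = 1" using A assms(4) by (simp add: volume_def bouquet_def)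
  then have one: "2 ^ b / fact b * (real b / volume ?G) ^ b = 2 ^ b / fact b" by simp
  have w: "w \<in> verts ?G" by (simp add: bouquet_def)
  note bounds = bouquet.stable_ball_volume[OF connected_bouquet w conjunct2[OF A] betti assms(4)]
  show vol: "measure (haar ?G) (stable_ball ?G w q') = 2 ^ b / fact b"
    using bounds unfolding one by (rule antisym[rotated])
  show "measure (haar ?G) (stable_ball ?G w q') = 2 ^ b / fact b * (real b / volume ?G) ^ b"
    unfolding one by (rule vol)
qed

end
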